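(* Let $\Bbbk$ be a field of characteristic zero and let $\mathsf{Gr}$ be the (linearized) species of graphs with its cosymmetric $\mathsf{E}$-bicomodule structure given by restriction of graphs. The class of the cardinality cocycle $\kappa$ generates $H^1(\mathsf{Gr})$, and the class of the cocycle $p^4:\mathsf{Gr}\to\mathsf{E}^{\cdot 4}$ generates $H^4(\mathsf{Gr})$. For every $n\ge1$ the $n$-th cup power of the class of $p^4$ is nonzero, so that $H^{4n}(\mathsf{Gr})\neq0$ for all $n\ge1$. Hence the cohomology algebra $H^*(\mathsf{Gr})$ contains both an exterior algebra on a generator of degree $1$ and a polynomial algebra on a generator of degree $4$.
   Context: A (linear) species is a functor from finite sets and bijections to $\Bbbk$-modules. A decomposition of $I$ is a tuple of disjoint, possibly empty, subsets with union $I$. The Cauchy product is $(\mathsf{X}\cdot\mathsf{Y})[I]=\bigoplus_{(S,T)}\mathsf{X}[S]\otimes\mathsf{Y}[T]$ over decompositions. $\mathsf{E}[I]=\Bbbk e_I$ is the exponential species, with coproduct $e_I\mapsto e_S\otimes e_T$. $\mathsf{Gr}[I]$ is free on the set of (simple, undirected) graphs with vertex set $I$; for $S\subseteq I$ the restriction $g|_S$ is the induced subgraph on $S$, and the coactions are $\lambda(g)=\sum e_S\otimes g|_T$, $\rho(g)=\sum g|_S\otimes e_T$. $H^*(\mathsf{X})$ is the cohomology of $C^n(\mathsf{X})=\operatorname{Hom}(\mathsf{X},\mathsf{E}^{\cdot n})$; cochains are given by coefficients $\alpha(F_1,\ldots,F_n)(z)\in\Bbbk$ for $(F_1,\ldots,F_n)$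 a decomposition of $I$ and $z\in\mathsf{X}[I]$, and $\delta=\sum_{i=0}^{n+1}(-1)^id^i$ with $(d^0\alpha)(F_0,\ldots,F_n)(z)=\alpha(F_1,\ldots,F_n)(z|_{F_0^c})$, $(d^i\alpha)(F_0,\ldots,F_n)(z)=\alpha(F_0,\ldots,F_{i-1}\cup F_i,\ldots,F_n)(z)$ for $0<i<n+1$, $(d^{n+1}\alpha)(F_0,\ldots,F_n)(z)=\alpha(F_0,\ldots,F_{n-1})(z|_{F_n^c})$. The product on $H^*(\mathsf{Gr})$ is induced by $(\alpha\smile\beta)(F_1,\ldots,F_{p+q})(g)=\alpha(F_1,\ldots,F_p)(g|_{F_1\cup\cdots\cup F_p})\,\beta(F_{p+1},\ldots,F_{p+q})(g|_{F_{p+1}\cup\cdots\cup F_{p+q}})$ on graphs $g$. The cardinality cocycle is $\kappa(I)(g)=|I|e_I$. For a decomposition $(F_1,F_2,F_3,F_4)$ of $I$ and a graph $g$ on $I$, $p^4(F_1,F_2,F_3,F_4)(g)$ is the number of inclusions (injective graph homomorphisms) $\zeta:p_4\to g$ with $\zeta(i)\in F_i$ for $i=1,\ldots,4$, where $p_4$ is the path graph with vertices $1,2,3,4$ and edges $12,23,34$. *)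

theory Defs
  imports
    "HOL-Library.Poly_Mapping"
    "HOL-Library.FuncSet"
    "HOL-Library.Disjoint_Sets"
    "HOL-Library.Function_Algebras"
    "HOL-Computational_Algebra.Polynomial"
    "HOL-Algebra.QuotRing"
    "HOL-Algebra.Module"
begin

section \<open>The linearized species of graphs\<close>

text \<open>
  Finite sets are the finite subsets of a type \<open>'v\<close>, which the theorem assumes to be infinite
  (this full subcategory is then equivalent to the category of all finite sets and bijections).
  A simple undirected graph with vertex set \<open>I\<close> is given by its set of edges, each edge being a
  two-element subset of \<open>I\<close>; the vertex set is not recorded in the graph.
\<close>

definition graphs :: "'v set \<Rightarrow> 'v set set set" where
  "graphs I = {g. \<forall>e\<in>g. e \<subseteq> I \<and> card e = 2}"

definition relabel :: "('v \<Rightarrow> 'w) \<Rightarrow> 'v set set \<Rightarrow> 'w set set" where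
  "relabel \<sigma> g = (\<lambda>e. \<sigma> ` e) ` g"

definition induced :: "'v set \<Rightarrow> 'v set set \<Rightarrow> 'v set set" where
  "induced S g = {e \<in> g. e \<subseteq> S}"

definition Gr :: "'v set \<Rightarrow> ('v set set \<Rightarrow>\<^sub>0 'k::field) set" where
  "Gr I = {z. Poly_Mapping.keys z \<subseteq> graphs I}"

definition free_map :: "('a \<Rightarrow> 'b) \<Rightarrow> ('a \<Rightarrow>\<^sub>0 'k::field) \<Rightarrow> ('b \<Rightarrow>\<^sub>0 'k)" where
  "free_map f z = (\<Sum>g\<in>Poly_Mapping.keys z. Poly_Mapping.single (f g) (Poly_Mapping.lookup z g))"

definition free_ext :: "('a \<Rightarrow> 'k::field) \<Rightarrow> ('a \<Rightarrow>\<^sub>0 'k) \<Rightarrow> 'k" where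
  "free_ext f z = (\<Sum>g\<in>Poly_Mapping.keys z. Poly_Mapping.lookup z g * f g)"

abbreviation Gr_transport ::
    "('v \<Rightarrow> 'v) \<Rightarrow> ('v set set \<Rightarrow>\<^sub>0 'k::field) \<Rightarrow> ('v set set \<Rightarrow>\<^sub>0 'k)" where
  "Gr_transport \<sigma> \<equiv> free_map (relabel \<sigma>)"

text \<open>
  The restriction \<open>z \<mapsto> z|\<^sub>S\<close>; it determines both coactions, as
  \<open>\<lambda>(z) = \<Sum> e\<^sub>S \<otimes> z|\<^sub>T\<close> and \<open>\<rho>(z) = \<Sum> z|\<^sub>S \<otimes> e\<^sub>T\<close>.
\<close>

abbreviation Gr_restrict ::
    "'v set \<Rightarrow> ('v set set \<Rightarrow>\<^sub>0 'k::field) \<Rightarrow> ('v set set \<Rightarrow>\<^sub>0 'k)" where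
  "Gr_restrict S \<equiv> free_map (induced S)"


section \<open>Cochains and their differential\<close>

definition decomps :: "nat \<Rightarrow> 'v set list set" where
  "decomps n = {F. length F = n \<and> finite (\<Union>(set F)) \<and> disjoint_family_on (\<lambda>i. F ! i) {..<n}}"

text \<open>
  A morphism of species \<open>\<alpha> : Gr \<rightarrow> E\<^sup>n\<close> (Cauchy power) is encoded by its coefficients: for a
  decomposition \<open>F = [F\<^sub>1, \<dots>, F\<^sub>n]\<close> of \<open>I\<close> and \<open>z \<in> Gr[I]\<close>, the scalar \<open>\<alpha> F z\<close> is the
  coefficient of \<open>e\<^bsub>F\<^sub>1\<^esub> \<otimes> \<dots> \<otimes> e\<^bsub>F\<^sub>n\<^esub>\<close> in \<open>\<alpha>(z)\<close>. The set \<open>I\<close> is the union of \<open>F\<close>. Coefficients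
  outside this domain are set to \<open>0\<close>, so that equality of cochains is equality of functions.
\<close>

type_synonym ('v, 'k) cochain = "'v set list \<Rightarrow> ('v set set \<Rightarrow>\<^sub>0 'k) \<Rightarrow> 'k"

definition cochain_dom :: "nat \<Rightarrow> ('v set list \<times> ('v set set \<Rightarrow>\<^sub>0 'k::field)) set" where
  "cochain_dom n = {(F, z). F \<in> decomps n \<and> z \<in> Gr (\<Union>(set F))}"

definition cochains :: "nat \<Rightarrow> ('v, 'k::field) cochain set" where
  "cochains n = {\<alpha>.
     (\<forall>F z. (F, z) \<notin> cochain_dom n \<longrightarrow> \<alpha> F z = 0) \<and>
     (\<forall>F\<in>decomps n. \<forall>x\<in>Gr (\<Union>(set F)). \<forall>y\<in>Gr (\<Union>(set F)). \<alpha> F (x + y) = \<alpha> F x + \<alpha> F y) \<and>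
     (\<forall>F\<in>decomps n. \<forall>c. \<forall>x\<in>Gr (\<Union>(set F)). \<alpha> F (Poly_Mapping.map ((*) c) x) = c * \<alpha> F x) \<and>
     (\<forall>F\<in>decomps n. \<forall>z\<in>Gr (\<Union>(set F)). \<forall>\<sigma> J. bij_betw \<sigma> (\<Union>(set F)) J \<longrightarrow>
        \<alpha> (map (\<lambda>S. \<sigma> ` S) F) (Gr_transport \<sigma> z) = \<alpha> F z)}"

definition cochain_of :: "nat \<Rightarrow> ('v set list \<Rightarrow> 'v set set \<Rightarrow> 'k::field) \<Rightarrow> ('v, 'k) cochain" where
  "cochain_of n a = (\<lambda>F z. if (F, z) \<in> cochain_dom n then free_ext (a F) z else 0)"

text \<open>\<open>coface n i\<close> is \<open>d\<^sup>i : C\<^sup>n \<rightarrow> C\<^bsup>n+1\<^esup>\<close>, evaluated at \<open>F = [F\<^sub>0, \<dots>, F\<^sub>n]\<close>.\<close>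

definition coface :: "nat \<Rightarrow> nat \<Rightarrow> ('v, 'k::field) cochain \<Rightarrow> ('v, 'k) cochain" where
  "coface n i \<alpha> = (\<lambda>F z.
     if (F, z) \<notin> cochain_dom (Suc n) then 0
     else if i = 0 then \<alpha> (tl F) (Gr_restrict (\<Union>(set F) - hd F) z)
     else if i = Suc n then \<alpha> (butlast F) (Gr_restrict (\<Union>(set F) - last F) z)
     else \<alpha> (take (i - 1) F @ (F ! (i - 1) \<union> F ! i) # drop (i + 1) F) z)"

definition coboundary :: "nat \<Rightarrow> ('v, 'k::field) cochain \<Rightarrow> ('v, 'k) cochain" where
  "coboundary n \<alpha> = (\<lambda>F z. \<Sum>i\<le>Suc n. (-1) ^ i * coface n i \<alpha> F z)"

definition cocycles :: "nat \<Rightarrow> ('v, 'k::field) cochain set" where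
  "cocycles n = {\<alpha> \<in> cochains n. coboundary n \<alpha> = 0}"

definition cup :: "nat \<Rightarrow> nat \<Rightarrow> ('v, 'k::field) cochain \<Rightarrow> ('v, 'k) cochain \<Rightarrow> ('v, 'k) cochain" where
  "cup p q \<alpha> \<beta> = cochain_of (p + q) (\<lambda>F g.
     \<alpha> (take p F) (Poly_Mapping.single (induced (\<Union>(set (take p F))) g) 1) *
     \<beta> (drop p F) (Poly_Mapping.single (induced (\<Union>(set (drop p F))) g) 1))"

definition cup_unit :: "('v, 'k::field) cochain" where
  "cup_unit = cochain_of 0 (\<lambda>F g. 1)"


section \<open>The cohomology algebra\<close>

text \<open>
  An element of \<open>\<Oplus>\<^sub>n C\<^sup>n\<close> is the sequence of its homogeneous components. The cohomology is
  the quotient of the ring of cocycles by the ideal of coboundaries.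
\<close>

definition homogeneous :: "nat \<Rightarrow> ('v, 'k::field) cochain \<Rightarrow> nat \<Rightarrow> ('v, 'k) cochain" where
  "homogeneous n \<alpha> = (\<lambda>m. if m = n then \<alpha> else 0)"

definition scale :: "'k::field \<Rightarrow> (nat \<Rightarrow> ('v, 'k) cochain) \<Rightarrow> nat \<Rightarrow> ('v, 'k) cochain" where
  "scale c a = (\<lambda>n F z. c * a n F z)"

definition cochain_algebra :: "('k::field, nat \<Rightarrow> ('v, 'k) cochain) module" where
  "cochain_algebra =
     \<lparr>carrier = {a. (\<forall>n. a n \<in> cochains n) \<and> finite {n. a n \<noteq> 0}},
      mult = (\<lambda>a b n. \<Sum>p\<le>n. cup p (n - p) (a p) (b (n - p))),
      one = homogeneous 0 cup_unit,
      zero = 0,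
      add = (+),
      smult = scale\<rparr>"

definition differential :: "(nat \<Rightarrow> ('v, 'k::field) cochain) \<Rightarrow> nat \<Rightarrow> ('v, 'k) cochain" where
  "differential a n = (case n of 0 \<Rightarrow> 0 | Suc m \<Rightarrow> coboundary m (a m))"

definition cocycle_algebra :: "('k::field, nat \<Rightarrow> ('v, 'k) cochain) module" where
  "cocycle_algebra =
     cochain_algebra\<lparr>carrier := {a \<in> carrier cochain_algebra. differential a = 0}\<rparr>"

definition coboundary_ideal :: "(nat \<Rightarrow> ('v, 'k::field) cochain) set" where
  "coboundary_ideal = differential ` carrier cochain_algebra"

definition cohomology :: "('k::field, (nat \<Rightarrow> ('v, 'k) cochain) set) module" where
  "cohomology = ring.extend (cocycle_algebra Quot coboundary_ideal)
     (module.fields (\<lambda>c X. \<Union>a\<in>X. coboundary_ideal +>\<^bsub>cocycle_algebra\<^esub> scale c a))"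

definition cohomology_class :: "nat \<Rightarrow> ('v, 'k::field) cochain \<Rightarrow> (nat \<Rightarrow> ('v, 'k) cochain) set" where
  "cohomology_class n \<alpha> = coboundary_ideal +>\<^bsub>cocycle_algebra\<^esub> homogeneous n \<alpha>"

text \<open>
  The differential is homogeneous, so the classes of degree-\<open>n\<close> cocycles in the total quotient
  form a copy of \<open>H\<^sup>n(Gr) = Z\<^sup>n / B\<^sup>n\<close>.
\<close>

definition cohomology_deg :: "nat \<Rightarrow> (nat \<Rightarrow> ('v, 'k::field) cochain) set set" where
  "cohomology_deg n = cohomology_class n ` cocycles n"


section \<open>The cocycles \<open>\<kappa>\<close> and \<open>p\<^sup>4\<close>\<close>

definition kappa :: "('v, 'k::field) cochain" where
  "kappa = cochain_of 1 (\<lambda>F g. of_nat (card (hd F)))"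

definition path4_vertices :: "nat set" where
  "path4_vertices = {1, 2, 3, 4}"

definition path4 :: "nat set set" where
  "path4 = {{1, 2}, {2, 3}, {3, 4}}"

definition path4_inclusions :: "'v set list \<Rightarrow> 'v set set \<Rightarrow> (nat \<Rightarrow> 'v) set" where
  "path4_inclusions F g =
     {\<zeta> \<in> path4_vertices \<rightarrow>\<^sub>E \<Union>(set F).
        inj_on \<zeta> path4_vertices \<and> (\<forall>e\<in>path4. \<zeta> ` e \<in> g) \<and>
        (\<forall>i\<in>path4_vertices. \<zeta> i \<in> F ! (i - 1))}"

definition p4 :: "('v, 'k::field) cochain" where
  "p4 = cochain_of 4 (\<lambda>F g. of_nat (card (path4_inclusions F g)))"


section \<open>Exterior and polynomial algebras on one generator\<close>

text \<open>
  The exterior algebra of a one-dimensional space with basis \<open>x\<close> is \<open>\<Lambda>\<^sup>0 \<oplus> \<Lambda>\<^sup>1\<close> with basis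
  \<open>1, x\<close> and \<open>x \<and> x = 0\<close>; the pair \<open>(a, b)\<close> is \<open>a + b x\<close>.
\<close>

definition exterior_algebra :: "('k::field, 'k \<times> 'k) module" where
  "exterior_algebra =
     \<lparr>carrier = UNIV,
      mult = (\<lambda>(a, b) (c, d). (a * c, a * d + b * c)),
      one = (1, 0),
      zero = (0, 0),
      add = (\<lambda>(a, b) (c, d). (a + c, b + d)),
      smult = (\<lambda>c (a, b). (c * a, c * b))\<rparr>"

definition polynomial_algebra :: "('k::field, 'k poly) module" where
  "polynomial_algebra =
     \<lparr>carrier = UNIV, mult = (*), one = 1, zero = 0, add = (+), smult = Polynomial.smult\<rparr>"

definition algebra_hom :: "('k, 'a) module \<Rightarrow> ('k, 'b) module \<Rightarrow> ('a \<Rightarrow> 'b) set" where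
  "algebra_hom A B =
     {\<phi> \<in> ring_hom A B. \<forall>c. \<forall>x\<in>carrier A. \<phi> (c \<odot>\<^bsub>A\<^esub> x) = c \<odot>\<^bsub>B\<^esub> \<phi> x}"

end

theory Submission
  imports Defs "HOL-Algebra.Subrings" "HOL-Computational_Algebra.Formal_Power_Series"
begin

text \<open>
  The bicomodule is cosymmetric: the outer cofaces only delete the vertices of the first or of the last
  block. Moebius inversion over the subsets of the vertex set (\<open>moebius_cob\<close>) therefore turns the
  coboundary into a reduced one, in which an outer coface survives only when the block that it deletes is
  empty. For each vertex set \<open>I\<close> and each graph on \<open>I\<close> one is left with the same complex, the reduced
  cochains of a simplicial sphere of dimension \<open>|I|\<close>. An explicit homotopy, which splits off one vertex at a
  time (\<open>htpy_red_cob\<close>), shows that its cohomology is concentrated in degree \<open>|I|\<close>, where it is detected by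
  antisymmetrization over the orderings of \<open>I\<close> (\<open>exactness\<close>). In characteristic zero primitives can be
  averaged over relabellings, so a cocycle of degree \<open>n\<close> is a coboundary as soon as its
  antisymmetrizations on graphs with \<open>n\<close> vertices vanish (\<open>cocycle_exact\<close>); conversely antisymmetrizations
  of coboundaries vanish (\<open>test_coboundary\<close>).

  Generators. There is only one graph on one vertex, and the antisymmetrization of \<open>kappa\<close> on it is one. A graph
  on four vertices is a path or has two vertices with the same neighbours (\<open>four_vertices\<close>). In the second case
  the transposition of these vertices is an automorphism, and every antisymmetrization vanishes.
  Hence degree four is spanned by any cocycle whose antisymmetrization on the path is not zero.

  Powers. On the disjoint union of \<open>n\<close> paths, the \<open>n\<close>-th power of \<open>p4\<close> is nonzero exactly on the orderings that run
  through the paths one after the other. Reversing a path on four vertices is an even permutation, and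
  so is the exchange of two such paths. All signs agree, and the antisymmetrization is a positive integer
  (\<open>test_p4_cup_power\<close>). This gives the powers of the class of \<open>p4\<close>, the generator of degree four and, comparing
  degrees, the polynomial algebra. The square of \<open>kappa\<close> is a coboundary, which gives the exterior algebra.
\<close>

section \<open>The reduced complex of decompositions\<close>

abbreviation ground :: "'v set list \<Rightarrow> 'v set" where
  "ground F \<equiv> \<Union>(set F)"

fun disj :: "'v set list \<Rightarrow> bool" where
  "disj [] \<longleftrightarrow> True"
| "disj (x # r) \<longleftrightarrow> x \<inter> ground r = {} \<and> disj r"

text \<open>
  For a fixed vertex set \<open>I\<close> the reduced complex consists of functions \<open>\<phi>\<close> on the decompositions of \<open>I\<close>.
  Its coboundary is the alternating sum of all mergers of neighbouring blocks, together with the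
  removal of the first or last block when that block is empty. These are the reduced simplicial
  cochains of the \<open>I\<close>-fold smash power of the simplicial circle: a decomposition into \<open>n\<close> blocks is a
  map from \<open>I\<close> to the \<open>n\<close> simplices of dimension \<open>n\<close> other than the base point.
  The part without the first coface is isolated in \<open>faces\<close>, with alternating signs, because it
  satisfies a recursion along the list; every identity below is proved by following that recursion.
\<close>

fun faces :: "('v set list \<Rightarrow> 'k::comm_ring_1) \<Rightarrow> 'v set list \<Rightarrow> 'k" where
  "faces \<phi> [] = 0"
| "faces \<phi> [x] = (if x = {} then \<phi> [] else 0)"
| "faces \<phi> (x # y # r) = \<phi> ((x \<union> y) # r) - faces (\<lambda>l. \<phi> (x # l)) (y # r)"

definition face0 :: "('v set list \<Rightarrow> 'k::comm_ring_1) \<Rightarrow> 'v set list \<Rightarrow> 'k" where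
  "face0 \<phi> F = (case F of [] \<Rightarrow> 0 | x # r \<Rightarrow> if x = {} then \<phi> r else 0)"

lemma face0_simps [simp]:
  "face0 \<phi> [] = 0"
  "face0 \<phi> (x # r) = (if x = {} then \<phi> r else 0)"
  by (simp_all add: face0_def)

definition red_cob :: "('v set list \<Rightarrow> 'k::comm_ring_1) \<Rightarrow> 'v set list \<Rightarrow> 'k" where
  "red_cob \<phi> F = face0 \<phi> F - faces \<phi> F"

lemma red_cob_Nil [simp]: "red_cob \<phi> [] = 0"
  by (simp add: red_cob_def)

text \<open>
  The signed shuffle with the one-point block \<open>{v}\<close>: the block is inserted in all possible positions.
\<close>

fun shuffle :: "'v \<Rightarrow> ('v set list \<Rightarrow> 'k::comm_ring_1) \<Rightarrow> 'v set list \<Rightarrow> 'k" where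
  "shuffle v \<phi> [] = \<phi> [{v}]"
| "shuffle v \<phi> (x # r) = \<phi> ({v} # x # r) - shuffle v (\<lambda>l. \<phi> (x # l)) r"

definition del_pt :: "'v \<Rightarrow> 'v set list \<Rightarrow> 'v set list" where
  "del_pt v = map (\<lambda>y. y - {v})"

lemma del_pt_simps [simp]:
  "del_pt v [] = []" "del_pt v (x # r) = (x - {v}) # del_pt v r" "length (del_pt v r) = length r"
  by (simp_all add: del_pt_def)

text \<open>
  The homotopy takes \<open>v\<close> out of its block and reinserts \<open>{v}\<close> as a block of its own, in every position
  up to the one that \<open>v\<close> came from.
\<close>

fun htpy :: "'v \<Rightarrow> ('v set list \<Rightarrow> 'k::comm_ring_1) \<Rightarrow> 'v set list \<Rightarrow> 'k" where
  "htpy v \<phi> [] = 0"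
| "htpy v \<phi> (x # r) = - \<phi> ({v} # (x - {v}) # del_pt v r)
     - (if v \<in> x then 0 else htpy v (\<lambda>l. \<phi> (x # l)) r)"

lemma faces_lin:
  "faces (\<lambda>l. \<phi> l + \<psi> l) F = faces \<phi> F + faces \<psi> F"
  "faces (\<lambda>l. \<phi> l - \<psi> l) F = faces \<phi> F - faces \<psi> F"
  "faces (\<lambda>l. - \<phi> l) F = - faces \<phi> F"
  "faces (\<lambda>l. c * \<phi> l) F = c * faces \<phi> F"
proof -
  show "faces (\<lambda>l. \<phi> l + \<psi> l) F = faces \<phi> F + faces \<psi> F"
    by (induction \<phi> F arbitrary: \<psi> rule: faces.induct) auto
  show *: "faces (\<lambda>l. \<phi> l - \<psi> l) F = faces \<phi> F - faces \<psi> F" for \<psi>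
    by (induction \<phi> F arbitrary: \<psi> rule: faces.induct) auto
  show "faces (\<lambda>l. - \<phi> l) F = - faces \<phi> F"
    by (induction \<phi> F rule: faces.induct) auto
  show "faces (\<lambda>l. c * \<phi> l) F = c * faces \<phi> F"
    by (induction \<phi> F rule: faces.induct) (auto simp: algebra_simps)
qed

lemma faces_0: "faces (\<lambda>l. 0) F = 0"
  using faces_lin(2)[of "\<lambda>l. 0" "\<lambda>l. 0" F] by simp

lemma shuffle_diff:
  "shuffle v (\<lambda>l. \<phi> l - \<psi> l) F = shuffle v \<phi> F - shuffle v \<psi> F"
  by (induction v \<phi> F arbitrary: \<psi> rule: shuffle.induct) auto

lemma shuffle_0: "shuffle v (\<lambda>l. 0) F = 0"
  using shuffle_diff[of v "\<lambda>l. 0" "\<lambda>l. 0" F] by simp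

lemma htpy_diff:
  "htpy v (\<lambda>l. \<phi> l - \<psi> l) F = htpy v \<phi> F - htpy v \<psi> F"
  by (induction v \<phi> F arbitrary: \<psi> rule: htpy.induct) auto

lemma htpy_0: "htpy v (\<lambda>l. 0) F = 0"
  using htpy_diff[of v "\<lambda>l. 0" "\<lambda>l. 0" F] by simp

text \<open>
  The faces of a decomposition are decompositions of the same set. The congruence rules record this,
  so that hypotheses about decompositions of a fixed set can be used inside the operators.
\<close>

lemma faces_cong:
  assumes "\<And>l. Suc (length l) = length F \<Longrightarrow> ground l = ground F \<Longrightarrow> (disj F \<longrightarrow> disj l) \<Longrightarrow> \<phi> l = \<psi> l"
  shows "faces \<phi> F = faces \<psi> F"
  using assms
proof (induction \<phi> F arbitrary: \<psi> rule: faces.induct)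
  case (3 \<phi> x y r)
  have "\<phi> ((x \<union> y) # r) = \<psi> ((x \<union> y) # r)"
    by (rule "3.prems") auto
  moreover have "faces (\<lambda>l. \<phi> (x # l)) (y # r) = faces (\<lambda>l. \<psi> (x # l)) (y # r)"
    by (rule "3.IH", rule "3.prems") auto
  ultimately show ?case by simp
qed auto

lemma red_cob_cong:
  assumes "\<And>l. Suc (length l) = length F \<Longrightarrow> ground l = ground F \<Longrightarrow> (disj F \<longrightarrow> disj l) \<Longrightarrow> \<phi> l = \<psi> l"
  shows "red_cob \<phi> F = red_cob \<psi> F"
proof -
  have "face0 \<phi> F = face0 \<psi> F"
    using assms by (cases F) auto
  with faces_cong[OF assms] show ?thesis by (simp add: red_cob_def)
qed

lemma shuffle_cong:
  assumes "\<And>l. length l = Suc (length F) \<Longrightarrow> ground l = insert v (ground F) \<Longrightarrow>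
      (disj F \<and> v \<notin> ground F \<longrightarrow> disj l) \<Longrightarrow> \<phi> l = \<psi> l"
  shows "shuffle v \<phi> F = shuffle v \<psi> F"
  using assms
proof (induction v \<phi> F arbitrary: \<psi> rule: shuffle.induct)
  case (2 v \<phi> x r)
  have "\<phi> ({v} # x # r) = \<psi> ({v} # x # r)"
    by (rule "2.prems") auto
  moreover have "shuffle v (\<lambda>l. \<phi> (x # l)) r = shuffle v (\<lambda>l. \<psi> (x # l)) r"
    by (rule "2.IH", rule "2.prems") auto
  ultimately show ?case by simp
qed auto

lemma del_pt_Union: "ground (del_pt v r) = ground r - {v}"
  by (auto simp: del_pt_def)

lemma disj_del_pt: "disj r \<Longrightarrow> disj (del_pt v r)"
  by (induction r) (auto simp: del_pt_Union)

lemma htpy_cong: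
  assumes "\<And>l. length l = Suc (length F) \<Longrightarrow> ground l = insert v (ground F) \<Longrightarrow>
      (disj F \<longrightarrow> disj l) \<Longrightarrow> \<phi> l = \<psi> l"
  shows "htpy v \<phi> F = htpy v \<psi> F"
  using assms
proof (induction v \<phi> F arbitrary: \<psi> rule: htpy.induct)
  case (2 v \<phi> x r)
  have "\<phi> ({v} # (x - {v}) # del_pt v r) = \<psi> ({v} # (x - {v}) # del_pt v r)"
    by (rule "2.prems") (auto simp: del_pt_Union intro: disj_del_pt)
  moreover have "htpy v (\<lambda>l. \<phi> (x # l)) r = htpy v (\<lambda>l. \<psi> (x # l)) r" if "v \<notin> x"
    using that by (rule "2.IH", intro "2.prems") auto
  ultimately show ?case by simp
qed auto

definition merge_hd :: "'v set \<Rightarrow> 'v set list \<Rightarrow> 'v set list" where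
  "merge_hd x l = (x \<union> hd l) # tl l"

lemma merge_hd_Cons [simp]: "merge_hd x (z # l) = (x \<union> z) # l"
  by (simp add: merge_hd_def)

lemma faces_Cons:
  "l \<noteq> [] \<Longrightarrow> faces \<phi> (x # l) = \<phi> (merge_hd x l) - faces (\<lambda>m. \<phi> (x # m)) l"
  by (cases l) auto

lemma faces_faces: "faces (faces \<phi>) F = 0"
proof (induction \<phi> F rule: faces.induct)
  case (3 \<phi> x y r)
  show ?case
  proof (cases r)
    case Nil
    then show ?thesis by auto
  next
    case (Cons z r')
    have "faces (\<lambda>l. faces \<phi> (x # l)) (y # r)
        = faces (\<lambda>l. \<phi> (merge_hd x l) - faces (\<lambda>m. \<phi> (x # m)) l) (y # r)"
      by (rule faces_cong) (subst faces_Cons, auto simp: Cons)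
    also have "\<dots> = faces (\<lambda>l. \<phi> (merge_hd x l)) (y # r)"
      using 3 by (simp add: faces_lin)
    finally have *: "faces (\<lambda>l. faces \<phi> (x # l)) (y # r) = faces (\<lambda>l. \<phi> (merge_hd x l)) (y # r)" .
    show ?thesis
      by (subst faces.simps(3), subst *) (simp add: Cons Un_assoc)
  qed
qed auto

lemma red_cob_red_cob: "red_cob (red_cob \<phi>) F = 0"
proof -
  have *: "faces (face0 \<phi>) F + face0 (faces \<phi>) F = face0 (face0 \<phi>) F"
  proof (cases F)
    case (Cons x r)
    then show ?thesis
      by (cases r) (auto simp: faces_lin faces_0)
  qed auto
  have "red_cob (red_cob \<phi>) F = face0 (face0 \<phi>) F - face0 (faces \<phi>) F - faces (face0 \<phi>) F + faces (faces \<phi>) F"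
    unfolding red_cob_def by (cases F) (auto simp: faces_lin faces_0)
  with * show ?thesis by (simp add: faces_faces algebra_simps)
qed

lemma shuffle_faces: "shuffle v (faces \<phi>) F = - faces (shuffle v \<phi>) F"
proof (induction \<phi> F rule: faces.induct)
  case (2 \<phi> x)
  then show ?case by auto
next
  case (3 \<phi> x y r)
  have "shuffle v (\<lambda>l. faces \<phi> (x # l)) (y # r)
      = shuffle v (\<lambda>l. \<phi> (merge_hd x l) - faces (\<lambda>m. \<phi> (x # m)) l) (y # r)"
    by (rule shuffle_cong) (subst faces_Cons, auto)
  also have "\<dots> = shuffle v (\<lambda>l. \<phi> (merge_hd x l)) (y # r) + faces (shuffle v (\<lambda>m. \<phi> (x # m))) (y # r)"
    using 3 by (simp add: shuffle_diff)
  finally show ?case by (simp add: faces_lin algebra_simps Un_commute)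
qed auto

lemma shuffle_red_cob: "shuffle v (red_cob \<phi>) F = - red_cob (shuffle v \<phi>) F"
proof -
  have "shuffle v (face0 \<phi>) F = - face0 (shuffle v \<phi>) F"
    by (cases F) (auto simp: shuffle_0)
  then show ?thesis
    unfolding red_cob_def by (simp add: shuffle_diff shuffle_faces)
qed

text \<open>
  Two points inserted one after the other occur in both orders, with opposite signs.
  This is the source of the sign character in the cohomology of the reduced complex.
\<close>

lemma shuffle_anticommute: "shuffle v (shuffle w \<phi>) F = - shuffle w (shuffle v \<phi>) F"
  by (induction v \<phi> F rule: shuffle.induct) (auto simp: shuffle_diff algebra_simps)

definition pushlast :: "'v \<Rightarrow> ('v set list \<Rightarrow> 'k::comm_ring_1) \<Rightarrow> 'v set list \<Rightarrow> 'k" where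
  "pushlast v \<phi> F = (if F \<noteq> [] \<and> last F = {v} then \<phi> (butlast F) else 0)"

text \<open>
  Deleting \<open>v\<close> from all blocks commutes with the mergers. The exception is a last block \<open>{v}\<close>, which
  becomes empty and thereby acquires a face.
\<close>

lemma faces_del_pt:
  "F \<noteq> [] \<Longrightarrow> faces (\<lambda>l. \<phi> (del_pt v l)) F = faces \<phi> (del_pt v F)
     - (if last F = {v} then (-1) ^ (length F - 1) * \<phi> (del_pt v (butlast F)) else 0)"
proof (induction F arbitrary: \<phi>)
  case (Cons x r)
  show ?case
  proof (cases r)
    case Nil
    then show ?thesis by auto
  next
    case (Cons y r')
    have "faces (\<lambda>l. \<phi> (del_pt v (x # l))) r = faces (\<lambda>l. \<phi> ((x - {v}) # l)) (del_pt v r)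
        - (if last r = {v} then (-1) ^ (length r - 1) * \<phi> ((x - {v}) # del_pt v (butlast r)) else 0)"
      using Cons.IH[of "\<lambda>l. \<phi> ((x - {v}) # l)"] Cons by simp
    then show ?thesis
      unfolding Cons by (simp add: Un_Diff del: del_pt_simps(2)) (simp add: Un_Diff)
  qed
qed auto

text \<open>
  For each position of \<open>{v}\<close> in the homotopy, the merger with the block on its right cancels against
  the merger with the block on its left in the next position. The telescoping sum leaves \<open>\<phi> F\<close> up to
  sign; the other faces cancel against the homotopy of the faces. The only obstruction is a last block \<open>{v}\<close>:
  taking out \<open>v\<close> creates the additional face of \<open>faces_del_pt\<close>, and a shuffle with \<open>v\<close> remains.
\<close>

lemma htpy_faces:
  assumes "disj F" "v \<in> ground F"
  shows "faces (htpy v \<phi>) F + htpy v (faces \<phi>) F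
    = - \<phi> F + (-1) ^ (length F - 1) * pushlast v (shuffle v \<phi>) F"
  using assms
proof (induction \<phi> F rule: faces.induct)
  case (2 \<phi> x)
  then show ?case by (auto simp: pushlast_def insert_absorb)
next
  case (3 \<phi> x y r)
  have disj: "disj (y # r)" "x \<inter> ground (y # r) = {}" using "3.prems" by auto
  show ?case
  proof (cases "v \<in> x")
    case True
    then have nv: "v \<notin> y" "v \<notin> ground r" using disj by auto
    have rem: "del_pt v r = r" "y - {v} = y" using nv by (auto simp: del_pt_def intro!: map_idI)
    have "(x - {v}) \<union> y = x \<union> y - {v}" using nv by auto
    have l: "last (y # r) \<noteq> {v}" using nv by (metis Sup_insert UnI1 Union_iff insertI1 last_in_set list.distinct(1) list.set(2) singletonI Un_iff)
    have "faces (\<lambda>l. htpy v \<phi> (x # l)) (y # r) = - faces (\<lambda>l. \<phi> ({v} # (x - {v}) # del_pt v l)) (y # r)"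
      using True by (simp add: faces_lin del: faces.simps)
    also have "\<dots> = - faces (\<lambda>l. \<phi> ({v} # (x - {v}) # l)) (y # r)"
      using faces_del_pt[of "y # r" "\<lambda>l. \<phi> ({v} # (x - {v}) # l)" v] l rem by simp
    finally show ?thesis
      using True l rem by (simp add: pushlast_def insert_absorb Un_Diff)
  next
    case False
    then have v: "v \<in> ground (y # r)" using "3.prems" by auto
    have x: "x - {v} = x" using False by auto
    let ?\<psi> = "\<lambda>l. \<phi> ({v} # x # l)"
    let ?e = "if last (y # r) = {v} then (-1) ^ length r * ?\<psi> (del_pt v (butlast (y # r))) else 0"
    have "faces (\<lambda>l. htpy v \<phi> (x # l)) (y # r)
        = - faces (\<lambda>l. ?\<psi> (del_pt v l)) (y # r) - faces (htpy v (\<lambda>l. \<phi> (x # l))) (y # r)"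
      using False x by (simp add: faces_lin del: faces.simps)
    also have "faces (\<lambda>l. ?\<psi> (del_pt v l)) (y # r) = faces ?\<psi> (del_pt v (y # r)) - ?e"
      using faces_del_pt[of "y # r" ?\<psi> v] by simp
    finally have 1: "faces (\<lambda>l. htpy v \<phi> (x # l)) (y # r)
        = - faces ?\<psi> (del_pt v (y # r)) + ?e - faces (htpy v (\<lambda>l. \<phi> (x # l))) (y # r)"
      by simp
    have "htpy v (\<lambda>l. faces \<phi> (x # l)) (y # r)
        = htpy v (\<lambda>l. \<phi> (merge_hd x l) - faces (\<lambda>m. \<phi> (x # m)) l) (y # r)"
      by (rule htpy_cong) (subst faces_Cons, auto)
    then have 2: "htpy v (\<lambda>l. faces \<phi> (x # l)) (y # r)
        = htpy v (\<lambda>l. \<phi> (merge_hd x l)) (y # r) - htpy v (faces (\<lambda>m. \<phi> (x # m))) (y # r)"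
      by (simp add: htpy_diff)
    have IH: "faces (htpy v (\<lambda>l. \<phi> (x # l))) (y # r) + htpy v (faces (\<lambda>l. \<phi> (x # l))) (y # r)
        = - \<phi> (x # y # r) + (-1) ^ length r * pushlast v (shuffle v (\<lambda>l. \<phi> (x # l))) (y # r)"
      using "3.IH"[OF disj(1) v] by simp
    have b: "del_pt v (butlast (y # r)) = butlast (y # r)" if "last (y # r) = {v}"
    proof -
      have "v \<notin> ground (butlast (y # r))"
        using disj(1) that
      proof (induction r arbitrary: y)
        case (Cons a r)
        from Cons.prems have "v \<in> ground (a # r)"
          using last_in_set[of "a # r"] by auto
        then have "v \<notin> y" using Cons.prems by auto
        moreover have "v \<notin> \<Union> (set (butlast (a # r)))"
          by (rule Cons.IH) (use Cons.prems in auto)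
        ultimately show ?case by auto
      qed auto
      then show ?thesis by (auto simp: del_pt_def intro!: map_idI)
    qed
    have P: "pushlast v (shuffle v \<phi>) (x # y # r)
        = (if last (y # r) = {v} then ?\<psi> (butlast (y # r)) else 0) - pushlast v (shuffle v (\<lambda>l. \<phi> (x # l))) (y # r)"
      by (simp add: pushlast_def)
    have U: "(x \<union> y) - {v} = x \<union> (y - {v})" using False by auto
    define y' r' where "y' = y - {v}" and "r' = del_pt v r"
    define W where "W = (if v \<in> y then 0 else htpy v (\<lambda>l. \<phi> ((x \<union> y) # l)) r)"
    have a: "faces (htpy v \<phi>) (x # y # r) = - \<phi> ({v} # (x \<union> y') # r') - W
        - faces (\<lambda>l. htpy v \<phi> (x # l)) (y # r)"
      using False U by (simp add: W_def y'_def r'_def)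
    have b': "htpy v (faces \<phi>) (x # y # r) = - (\<phi> (insert v x # y' # r')
        - (\<phi> ({v} # (x \<union> y') # r') - faces ?\<psi> (y' # r')))
        - htpy v (\<lambda>l. faces \<phi> (x # l)) (y # r)"
      using False x by (simp add: y'_def r'_def)
    have d: "htpy v (\<lambda>l. \<phi> (merge_hd x l)) (y # r) = - \<phi> (insert v x # y' # r') - W"
      by (simp add: y'_def r'_def W_def)
    have 1: "faces (\<lambda>l. htpy v \<phi> (x # l)) (y # r)
        = - faces ?\<psi> (y' # r') + ?e - faces (htpy v (\<lambda>l. \<phi> (x # l))) (y # r)"
      using 1 by (simp only: del_pt_simps y'_def r'_def)
    have e: "?e = (-1) ^ length r * (if last (y # r) = {v} then ?\<psi> (butlast (y # r)) else 0)"
      using b by simp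
    have "faces (htpy v \<phi>) (x # y # r) + htpy v (faces \<phi>) (x # y # r)
        = faces (htpy v (\<lambda>l. \<phi> (x # l))) (y # r) + htpy v (faces (\<lambda>l. \<phi> (x # l))) (y # r) - ?e"
      unfolding a b' 1 2 d by (simp only: algebra_simps) simp
    then show ?thesis
      unfolding IH e P by (simp add: right_diff_distrib)
  qed
qed auto

section \<open>Exactness outside the top degree\<close>

text \<open>
  The identity map is therefore homotopic to an operator that passes through the
  reduced complex of the vertex set without \<open>v\<close>, one degree lower.
\<close>

lemma htpy_red_cob:
  assumes "disj F" "v \<in> ground F"
  shows "red_cob (htpy v \<phi>) F + htpy v (red_cob \<phi>) F
    = \<phi> F - (-1) ^ (length F - 1) * pushlast v (shuffle v \<phi>) F"
proof -
  have "face0 (htpy v \<phi>) F + htpy v (face0 \<phi>) F = 0"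
    using assms by (cases F) (auto simp: htpy_0)
  then show ?thesis
    using htpy_faces[OF assms, of \<phi>]
    unfolding red_cob_def by (simp add: htpy_diff algebra_simps)
qed

text \<open>
  A face that does not involve the last block \<open>{v}\<close> keeps it, and merging another nonempty block into
  it destroys the form \<open>{v}\<close>; an empty neighbour is exactly what the face at the end of the shorter
  list accounts for.
\<close>

lemma faces_pushlast:
  "disj F \<Longrightarrow> v \<in> ground F \<Longrightarrow> faces (pushlast v \<phi>) F = pushlast v (faces \<phi>) F"
proof (induction \<phi> F rule: faces.induct)
  case (2 \<phi> x)
  then show ?case by (auto simp: pushlast_def)
next
  case (3 \<phi> x y r)
  show ?case
  proof (cases r)
    case Nil
    then show ?thesis using 3 by (auto simp: pushlast_def)
  next
    case (Cons z r')
    show ?thesis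
    proof (cases "v \<in> ground (y # r)")
      case True
      have "faces (\<lambda>l. pushlast v \<phi> (x # l)) (y # r) = faces (pushlast v (\<lambda>l. \<phi> (x # l))) (y # r)"
        by (rule faces_cong) (auto simp: pushlast_def Cons)
      also have "\<dots> = pushlast v (faces (\<lambda>l. \<phi> (x # l))) (y # r)"
        using "3.IH" "3.prems" True by auto
      finally show ?thesis
        by (simp add: pushlast_def Cons)
    next
      case False
      then have nl: "last r \<noteq> {v}"
        using Cons last_in_set[of r] by auto
      have "faces (\<lambda>l. pushlast v \<phi> (x # l)) (y # r) = faces (\<lambda>l. 0) (y # r)"
      proof (rule faces_cong)
        fix l assume l: "Suc (length l) = length (y # r)" "\<Union> (set l) = \<Union> (set (y # r))"
        then have "l \<noteq> []" using Cons by auto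
        moreover have "last l \<noteq> {v}"
        proof
          assume "last l = {v}"
          then have "v \<in> ground l" using \<open>l \<noteq> []\<close> last_in_set[of l] by blast
          then show False using l(2) False by simp
        qed
        ultimately show "pushlast v \<phi> (x # l) = 0" by (simp add: pushlast_def)
      qed
      then show ?thesis
        using nl by (simp add: pushlast_def Cons faces_0)
    qed
  qed
qed auto

lemma red_cob_pushlast:
  assumes "disj F" "v \<in> ground F"
  shows "red_cob (pushlast v \<phi>) F = pushlast v (red_cob \<phi>) F"
proof -
  have "face0 (pushlast v \<phi>) F = pushlast v (face0 \<phi>) F"
    using assms by (cases F) (auto simp: pushlast_def)
  then show ?thesis
    unfolding red_cob_def faces_pushlast[OF assms] by (simp add: pushlast_def)
qed

lemma red_cob_add: "red_cob (\<lambda>l. \<phi> l + \<psi> l) F = red_cob \<phi> F + red_cob \<psi> F"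
  unfolding red_cob_def faces_lin by (cases F) auto

lemma red_cob_scale: "red_cob (\<lambda>l. c * \<phi> l) F = c * red_cob \<phi> F"
  unfolding red_cob_def faces_lin by (cases F) (auto simp: algebra_simps)

lemma red_cob_0: "red_cob (\<lambda>l. 0) F = 0"
  unfolding red_cob_def faces_0 by (cases F) auto

definition decs :: "nat \<Rightarrow> 'v set \<Rightarrow> 'v set list set" where
  "decs n I = {F. length F = n \<and> disj F \<and> ground F = I}"

text \<open>
  Iterated signed shuffles. On \<open>n\<close> vertices and \<open>n\<close> blocks this is the signed sum of the values at all
  orderings of the vertices, each vertex forming a block.
\<close>

fun alt :: "'v list \<Rightarrow> ('v set list \<Rightarrow> 'k::comm_ring_1) \<Rightarrow> 'k" where
  "alt [] \<phi> = \<phi> []"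
| "alt (v # vs) \<phi> = alt vs (shuffle v \<phi>)"

lemma faces_replicate:
  "faces \<phi> (replicate (Suc k) {}) = (if even k then \<phi> (replicate k {}) else 0)"
proof (induction k arbitrary: \<phi>)
  case (Suc k)
  have "faces \<phi> (replicate (Suc (Suc k)) {}) = \<phi> (replicate (Suc k) {}) - faces (\<lambda>l. \<phi> ({} # l)) (replicate (Suc k) {})"
    by simp
  then show ?case unfolding Suc by simp
qed auto

lemma red_cob_replicate:
  "red_cob \<phi> (replicate (Suc k) {}) = (if even k then 0 else \<phi> (replicate k {}))"
  unfolding red_cob_def faces_replicate by simp

lemma disj_append: "disj (F @ G) \<longleftrightarrow> disj F \<and> disj G \<and> ground F \<inter> ground G = {}"
  by (induction F) auto

lemma decs_butlast:
  assumes "F \<in> decs (Suc m) (insert v I)" "last F = {v}" "v \<notin> I"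
  shows "butlast F \<in> decs m I"
proof -
  have "F = butlast F @ [{v}]"
    using assms(1,2) append_butlast_last_id[of F] by (cases "F = []") (simp_all add: decs_def)
  moreover define G where "G = butlast F"
  ultimately have "F = G @ [{v}]" by simp
  then show ?thesis
    using assms unfolding decs_def by (auto simp: disj_append)
qed

lemma decs_empty: "decs n {} = {replicate n {}}"
proof -
  have "F \<in> decs n {} \<Longrightarrow> F = replicate n {}" for F :: "'a set list"
    by (auto simp: decs_def replicate_eqI)
  moreover have "disj (replicate n {})" "replicate n {} \<in> decs n ({} :: 'a set)"
    by (induction n) (auto simp: decs_def)
  ultimately show ?thesis by blast
qed

text \<open>
  Induction on the vertices: \<open>htpy_red_cob\<close> replaces a cocycle by its shuffle with \<open>v\<close>, a cocycle on one vertex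
  less and in one degree less. If the vertices are exhausted first, what remains are decompositions
  of the empty set, where the coboundary is alternately zero and the identity; if the degree is
  exhausted first, a nonempty set has no decomposition into zero blocks. Only when both run out
  simultaneously is there an obstruction, namely the value of \<open>alt\<close>.
\<close>

lemma exactness:
  assumes "distinct vs"
    and "\<And>F. F \<in> decs (Suc n) (set vs) \<Longrightarrow> red_cob \<beta> F = 0"
    and "length vs = n \<Longrightarrow> alt vs \<beta> = 0"
  shows "\<exists>\<gamma>. \<forall>F \<in> decs n (set vs). red_cob \<gamma> F = \<beta> F"
  using assms
proof (induction vs arbitrary: n \<beta>)
  case Nil
  show ?case
  proof (cases n)
    case 0
    then have "\<forall>F \<in> decs n (set []). red_cob \<beta> F = \<beta> F"
      using Nil by (simp add: decs_empty)
    then show ?thesis by (rule exI[of _ \<beta>])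
  next
    case (Suc k)
    have "red_cob \<beta> (replicate (Suc n) {}) = 0"
      using Nil.prems(2) by (simp add: decs_empty)
    then have *: "even k \<longrightarrow> \<beta> (replicate n {}) = 0"
      unfolding red_cob_replicate Suc by (simp split: if_splits del: replicate.simps)
    \<comment> \<open>A constant function is a primitive: in odd degrees the cocycle condition forces the value zero.\<close>
    have "red_cob (\<lambda>_. \<beta> (replicate n {})) (replicate n {}) = \<beta> (replicate n {})"
      unfolding Suc red_cob_replicate using * unfolding Suc by simp
    then have "\<forall>F \<in> decs n (set []). red_cob (\<lambda>_. \<beta> (replicate n {})) F = \<beta> F"
      by (simp add: decs_empty)
    then show ?thesis by (rule exI[of _ "\<lambda>_. \<beta> (replicate n {})"])
  qed
next
  case (Cons v vs)
  show ?case
  proof (cases n)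
    case 0
    then have "decs n (set (v # vs)) = {}" by (auto simp: decs_def)
    then show ?thesis by simp
  next
    case (Suc m)
    have v: "v \<notin> set vs" "distinct vs" using Cons.prems(1) by auto
    have "\<exists>\<gamma>. \<forall>F \<in> decs m (set vs). red_cob \<gamma> F = shuffle v \<beta> F"
    proof (rule Cons.IH)
      show "red_cob (shuffle v \<beta>) F = 0" if "F \<in> decs (Suc m) (set vs)" for F
      proof -
        have "shuffle v (red_cob \<beta>) F = shuffle v (\<lambda>l. 0) F"
          using that v by (intro shuffle_cong Cons.prems(2)) (auto simp: decs_def Suc)
        then show ?thesis using shuffle_red_cob[of v \<beta> F] by (simp add: shuffle_0)
      qed
    qed (use Cons.prems v Suc in auto)
    then obtain \<gamma>' where \<gamma>': "\<And>F. F \<in> decs m (set vs) \<Longrightarrow> red_cob \<gamma>' F = shuffle v \<beta> F" by blast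
    \<comment> \<open>The homotopy leaves the shuffle of the cocycle; appending the block of v turns its primitive into one on the larger set.\<close>
    define \<gamma> where "\<gamma> F = htpy v \<beta> F + (-1) ^ m * pushlast v \<gamma>' F" for F
    have "red_cob \<gamma> F = \<beta> F" if F: "F \<in> decs n (set (v # vs))" for F
    proof -
      have F': "disj F" "v \<in> ground F" "length F = Suc m" "F \<noteq> []"
        using F Suc by (auto simp: decs_def)
      have "htpy v (red_cob \<beta>) F = htpy v (\<lambda>l. 0) F"
        using F F' by (intro htpy_cong Cons.prems(2)) (auto simp: decs_def insert_absorb)
      then have 1: "red_cob (htpy v \<beta>) F = \<beta> F - (-1) ^ m * pushlast v (shuffle v \<beta>) F"
        using htpy_red_cob[OF F'(1,2), of \<beta>] F' by (simp add: htpy_0)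
      have "pushlast v (red_cob \<gamma>') F = pushlast v (shuffle v \<beta>) F"
        using \<gamma>'[OF decs_butlast[of F m v "set vs"]] F Suc v by (auto simp: pushlast_def)
      then show ?thesis
        unfolding \<gamma>_def red_cob_add red_cob_scale red_cob_pushlast[OF F'(1,2)] 1 by simp
    qed
    then show ?thesis by blast
  qed
qed

section \<open>The alternating functional\<close>

lemma shuffle_scale: "shuffle v (\<lambda>l. c * \<phi> l) F = c * shuffle v \<phi> F"
  by (induction v \<phi> F rule: shuffle.induct) (auto simp: algebra_simps)

lemma alt_scale: "alt vs (\<lambda>l. c * \<phi> l) = c * alt vs \<phi>"
proof (induction vs arbitrary: \<phi>)
  case (Cons v vs)
  then show ?case by (simp add: shuffle_scale[abs_def])
qed auto

lemma alt_minus: "alt vs (\<lambda>l. - \<phi> l) = - alt vs \<phi>"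
  using alt_scale[of vs "-1" \<phi>] by simp

lemma alt_diff: "alt vs (\<lambda>l. \<phi> l - \<psi> l) = alt vs \<phi> - alt vs \<psi>"
proof (induction vs arbitrary: \<phi> \<psi>)
  case (Cons v vs)
  then show ?case by (simp add: shuffle_diff[abs_def])
qed auto

text \<open>
  The shuffles anticommute with the coboundary, so they carry it along until no block is left,
  and there it vanishes.
\<close>

lemma alt_red_cob: "alt vs (red_cob \<gamma>) = 0"
proof (induction vs arbitrary: \<gamma>)
  case (Cons v vs)
  have "alt (v # vs) (red_cob \<gamma>) = alt vs (\<lambda>l. - red_cob (shuffle v \<gamma>) l)"
    by (simp add: shuffle_red_cob[abs_def])
  then show ?case by (simp add: alt_minus Cons)
qed auto

lemma alt_swap: "alt (a # b # vs) \<phi> = - alt (b # a # vs) \<phi>"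
proof -
  have "shuffle b (shuffle a \<phi>) = (\<lambda>F. - shuffle a (shuffle b \<phi>) F)"
    by (rule ext) (rule shuffle_anticommute)
  then show ?thesis by (simp add: alt_minus)
qed

lemma alt_cong:
  assumes "distinct vs" "\<And>F. F \<in> decs (length vs) (set vs) \<Longrightarrow> \<phi> F = \<psi> F"
  shows "alt vs \<phi> = alt vs \<psi>"
  using assms
proof (induction vs arbitrary: \<phi> \<psi>)
  case Nil
  then show ?case by (simp add: decs_empty)
next
  case (Cons v vs)
  have "alt vs (shuffle v \<phi>) = alt vs (shuffle v \<psi>)"
    by (rule Cons.IH, use Cons.prems(1) in simp, rule shuffle_cong, rule Cons.prems(2))
      (use Cons.prems(1) in \<open>auto simp: decs_def\<close>)
  then show ?case by simp
qed

lemma shuffle_image: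
  "shuffle (\<sigma> v) \<phi> (map ((`) \<sigma>) F) = shuffle v (\<lambda>l. \<phi> (map ((`) \<sigma>) l)) F"
  by (induction F arbitrary: \<phi>) auto

lemma alt_map: "alt (map \<sigma> vs) \<phi> = alt vs (\<lambda>l. \<phi> (map ((`) \<sigma>) l))"
proof (induction vs arbitrary: \<phi>)
  case (Cons v vs)
  then show ?case by (simp add: shuffle_image)
qed auto

lemma faces_image: "faces \<phi> (map ((`) \<sigma>) F) = faces (\<lambda>l. \<phi> (map ((`) \<sigma>) l)) F"
proof (induction "\<lambda>l. \<phi> (map ((`) \<sigma>) l)" F arbitrary: \<phi> rule: faces.induct)
  case (3 x y r)
  have "faces (\<lambda>l. \<phi> (\<sigma> ` x # l)) (map ((`) \<sigma>) (y # r)) = faces (\<lambda>l. \<phi> (\<sigma> ` x # map ((`) \<sigma>) l)) (y # r)"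
    by (rule 3) simp
  then show ?case by (simp add: image_Un)
qed auto

lemma red_cob_image: "red_cob \<phi> (map ((`) \<sigma>) F) = red_cob (\<lambda>l. \<phi> (map ((`) \<sigma>) l)) F"
  unfolding red_cob_def faces_image by (cases F) auto

text \<open>
  The sign of a list, by counting inversions.
\<close>

fun inv_sign :: "nat list \<Rightarrow> 'k::comm_ring_1" where
  "inv_sign [] = 1"
| "inv_sign (x # xs) = (\<Prod>y\<leftarrow>xs. if x < y then 1 else -1) * inv_sign xs"

lemma inv_sign_insert_min:
  assumes "\<forall>y \<in> set pre \<union> set post. v < y"
  shows "inv_sign (pre @ v # post) = (-1) ^ length pre * inv_sign (pre @ post)"
  using assms
proof (induction pre)
  case Nil
  have "(\<Prod>y\<leftarrow>post. if v < y then 1 else -1 :: 'a) = 1"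
    using Nil by (induction post) auto
  then show ?case by simp
next
  case (Cons x pre)
  then show ?case by (auto simp: algebra_simps)
qed

text \<open>
  If all terms of a signed shuffle have the sign \<open>s\<close>, then no cancellation occurs. The first term is kept
  apart because it will be the nonzero one.
\<close>

lemma shuffle_Nats:
  fixes \<phi> :: "'v set list \<Rightarrow> 'k::field_char_0"
  assumes "\<And>pre post. zs = pre @ post \<Longrightarrow>
    s * (-1) ^ length pre * \<phi> (map (\<lambda>i. {e i}) (pre @ v # post)) \<in> \<nat>"
  shows "\<exists>k. s * shuffle (e v) \<phi> (map (\<lambda>i. {e i}) zs)
    = s * \<phi> (map (\<lambda>i. {e i}) (v # zs)) + of_nat k"
  using assms
proof (induction zs arbitrary: s \<phi>)
  case Nil
  show ?case by (rule exI[of _ 0]) simp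
next
  case (Cons z zs)
  let ?\<phi> = "\<lambda>l. \<phi> ({e z} # l)"
  have *: "(- s) * (-1) ^ length pre * ?\<phi> (map (\<lambda>i. {e i}) (pre @ v # post)) \<in> \<nat>" if "zs = pre @ post" for pre post
    using Cons.prems[of "z # pre" post] that by simp
  from Cons.IH[of "- s" ?\<phi>, OF *] obtain k where
    k: "- s * shuffle (e v) ?\<phi> (map (\<lambda>i. {e i}) zs) = - s * ?\<phi> (map (\<lambda>i. {e i}) (v # zs)) + of_nat k"
    by auto
  from *[of "[]" zs] obtain j where "- s * ?\<phi> (map (\<lambda>i. {e i}) (v # zs)) = of_nat j"
    by (auto elim: Nats_cases)
  with k have "- s * shuffle (e v) ?\<phi> (map (\<lambda>i. {e i}) zs) = of_nat (j + k)"
    by simp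
  then have "s * shuffle (e v) \<phi> (map (\<lambda>i. {e i}) (z # zs))
      = s * \<phi> (map (\<lambda>i. {e i}) (v # z # zs)) + of_nat (j + k)"
    by (simp only: list.map shuffle.simps right_diff_distrib mult_minus_left) simp
  then show ?case by (rule exI)
qed

text \<open>
  A way to see that \<open>alt\<close> does not vanish without summing over permutations: if \<open>\<phi>\<close> times the sign
  of the ordering is always a natural number, then \<open>alt\<close> is a sum of natural numbers.
\<close>

lemma alt_positive:
  fixes \<phi> :: "'v set list \<Rightarrow> 'k::field_char_0"
  assumes "sorted_wrt (<) vs"
    and "\<And>zs. distinct zs \<Longrightarrow> set zs = set vs \<Longrightarrow> inv_sign zs * \<phi> (map (\<lambda>i. {e i}) zs) \<in> \<nat>"
    and "\<phi> (map (\<lambda>i. {e i}) vs) \<noteq> 0"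
  shows "alt (map e vs) \<phi> \<noteq> 0"
  using assms
proof (induction vs arbitrary: \<phi>)
  case (Cons v vs)
  have lt: "\<forall>y \<in> set vs. v < y" and dv: "v \<notin> set vs" using Cons.prems(1) by auto
  have *: "\<exists>k. inv_sign zs * shuffle (e v) \<phi> (map (\<lambda>i. {e i}) zs)
      = inv_sign zs * \<phi> (map (\<lambda>i. {e i}) (v # zs)) + of_nat k"
    if zs: "distinct zs" "set zs = set vs" for zs
  proof (rule shuffle_Nats)
    fix pre post assume pp: "zs = pre @ post"
    have "inv_sign (pre @ v # post) * \<phi> (map (\<lambda>i. {e i}) (pre @ v # post)) \<in> \<nat>"
      by (rule Cons.prems(2)) (use zs pp dv in auto)
    moreover have "inv_sign (pre @ v # post) = (-1 :: 'k) ^ length pre * inv_sign zs"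
      using inv_sign_insert_min[of pre post v] pp zs lt by auto
    ultimately show "inv_sign zs * (-1) ^ length pre * \<phi> (map (\<lambda>i. {e i}) (pre @ v # post)) \<in> \<nat>"
      by (simp add: algebra_simps)
  qed
  have **: "inv_sign zs * \<phi> (map (\<lambda>i. {e i}) (v # zs)) \<in> \<nat>" if zs: "distinct zs" "set zs = set vs" for zs
  proof -
    have "inv_sign (v # zs) * \<phi> (map (\<lambda>i. {e i}) (v # zs)) \<in> \<nat>"
      by (rule Cons.prems(2)) (use zs dv in auto)
    then show ?thesis using inv_sign_insert_min[of "[]" zs v, where 'a='k] zs lt by auto
  qed
  have d: "distinct vs" using Cons.prems(1) by (simp add: strict_sorted_iff)
  have "alt (map e vs) (shuffle (e v) \<phi>) \<noteq> 0"
  proof (rule Cons.IH)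
    show "sorted_wrt (<) vs" using Cons.prems(1) by simp
    show "inv_sign zs * shuffle (e v) \<phi> (map (\<lambda>i. {e i}) zs) \<in> \<nat>" if "distinct zs" "set zs = set vs" for zs
      using *[OF that] **[OF that] by auto
    have "inv_sign vs * \<phi> (map (\<lambda>i. {e i}) (v # vs)) \<noteq> 0"
    proof -
      have "inv_sign xs \<noteq> (0 :: 'k)" for xs :: "nat list"
      proof (induction xs)
        case (Cons x xs)
        have "(\<Prod>y\<leftarrow>xs. if x < y then 1 else -1 :: 'k) \<noteq> 0"
          by (auto simp: prod_list_zero_iff)
        then show ?case using Cons by simp
      qed auto
      then show ?thesis using Cons.prems(3) by simp
    qed
    moreover obtain j where "inv_sign vs * \<phi> (map (\<lambda>i. {e i}) (v # vs)) = of_nat j"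
      using **[OF d] by (auto elim: Nats_cases)
    moreover obtain k where "inv_sign vs * shuffle (e v) \<phi> (map (\<lambda>i. {e i}) vs)
      = inv_sign vs * \<phi> (map (\<lambda>i. {e i}) (v # vs)) + of_nat k"
      using *[OF d] by auto
    ultimately have "inv_sign vs * shuffle (e v) \<phi> (map (\<lambda>i. {e i}) vs) = of_nat (j + k)" "j \<noteq> 0"
      by (metis of_nat_add, metis of_nat_0)
    then have "inv_sign vs * shuffle (e v) \<phi> (map (\<lambda>i. {e i}) vs) \<noteq> 0"
      by (metis add_is_0 of_nat_eq_0_iff)
    then show "shuffle (e v) \<phi> (map (\<lambda>i. {e i}) vs) \<noteq> 0" by auto
  qed
  then show ?case by simp
qed auto

section \<open>Moebius inversion\<close>

text \<open>
  The inner cofaces alone, which the full coboundary and the reduced one have in common.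
\<close>

fun mid :: "('v set list \<Rightarrow> 'k::comm_ring_1) \<Rightarrow> 'v set list \<Rightarrow> 'k" where
  "mid \<phi> [] = 0"
| "mid \<phi> [x] = 0"
| "mid \<phi> (x # y # r) = \<phi> ((x \<union> y) # r) - mid (\<lambda>l. \<phi> (x # l)) (y # r)"

lemma faces_mid:
  "faces \<phi> F = mid \<phi> F + (if F \<noteq> [] \<and> last F = {} then (-1) ^ (length F - 1) * \<phi> (butlast F) else 0)"
  by (induction \<phi> F rule: mid.induct) (auto simp: algebra_simps)

lemma red_cob_mid:
  "red_cob \<phi> F = face0 \<phi> F - mid \<phi> F + (if F \<noteq> [] \<and> last F = {} then (-1) ^ length F * \<phi> (butlast F) else 0)"
  unfolding red_cob_def faces_mid by (cases F) auto

lemma mid_cong: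
  assumes "\<And>l. Suc (length l) = length F \<Longrightarrow> ground l = ground F \<Longrightarrow> (disj F \<longrightarrow> disj l) \<Longrightarrow> \<phi> l = \<psi> l"
  shows "mid \<phi> F = mid \<psi> F"
  using assms
proof (induction \<phi> F arbitrary: \<psi> rule: mid.induct)
  case (3 \<phi> x y r)
  have "\<phi> ((x \<union> y) # r) = \<psi> ((x \<union> y) # r)"
    by (rule "3.prems") auto
  moreover have "mid (\<lambda>l. \<phi> (x # l)) (y # r) = mid (\<lambda>l. \<psi> (x # l)) (y # r)"
    by (rule "3.IH", rule "3.prems") auto
  ultimately show ?case by simp
qed auto

lemma mid_add: "mid (\<lambda>l. \<phi> l + \<psi> l) F = mid \<phi> F + mid \<psi> F"
  by (induction \<phi> F arbitrary: \<psi> rule: mid.induct) auto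

lemma mid_scale: "mid (\<lambda>l. c * \<phi> l) F = c * mid \<phi> F"
  by (induction \<phi> F rule: mid.induct) (auto simp: algebra_simps)

lemma mid_0: "mid (\<lambda>l. 0) F = 0"
  using mid_scale[of 0 "\<lambda>_. 0" F] by simp

lemma mid_sum: "mid (\<lambda>l. \<Sum>i\<in>A. \<phi> i l) F = (\<Sum>i\<in>A. mid (\<phi> i) F)"
  by (induction A rule: infinite_finite_induct) (simp_all add: mid_0 mid_add)

lemma red_cob_sum: "red_cob (\<lambda>l. \<Sum>i\<in>A. \<phi> i l) F = (\<Sum>i\<in>A. red_cob (\<phi> i) F)"
  by (induction A rule: infinite_finite_induct) (simp_all add: red_cob_0 red_cob_add)

definition restr :: "'v set \<Rightarrow> 'v set list \<Rightarrow> 'v set list" where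
  "restr J = map (\<lambda>S. S \<inter> J)"

lemma restr_simps [simp]:
  "restr J [] = []" "restr J (x # r) = (x \<inter> J) # restr J r" "length (restr J F) = length F"
  by (simp_all add: restr_def)

lemma Union_restr: "ground (restr J F) = ground F \<inter> J"
  by (auto simp: restr_def)

lemma restr_restr: "J \<subseteq> K \<Longrightarrow> restr J (restr K F) = restr J F"
  by (auto simp: restr_def)

lemma restr_Union: "ground F \<subseteq> J \<Longrightarrow> restr J F = F"
  by (auto simp: restr_def intro!: map_idI)

lemma disj_restr: "disj F \<Longrightarrow> disj (restr J F)"
  by (induction F) (auto simp: Union_restr)

lemma mid_restr: "mid \<phi> (restr J F) = mid (\<lambda>l. \<phi> (restr J l)) F"
proof (induction F arbitrary: \<phi>)
  case (Cons x r)
  show ?case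
  proof (cases r)
    case (Cons y r')
    then show ?thesis using Cons.IH[of "\<lambda>l. \<phi> ((x \<inter> J) # l)"] by (simp add: Int_Un_distrib2)
  qed auto
qed auto

lemma induced_induced: "J \<subseteq> K \<Longrightarrow> induced J (induced K g) = induced J g"
  by (auto simp: induced_def)

lemma induced_graphs [intro]: "g \<in> graphs I \<Longrightarrow> induced J g \<in> graphs (I \<inter> J)"
  by (auto simp: induced_def graphs_def)

lemma induced_graphs': "g \<in> graphs I \<Longrightarrow> J \<subseteq> I \<Longrightarrow> induced J g \<in> graphs J"
  using induced_graphs[of g I J] by (simp add: Int_absorb1)

lemma induced_id: "g \<in> graphs I \<Longrightarrow> I \<subseteq> J \<Longrightarrow> induced J g = g"
  by (auto simp: induced_def graphs_def)

type_synonym ('v, 'k) coeff = "'v set list \<Rightarrow> 'v set set \<Rightarrow> 'k"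

text \<open>
  Both the zeta transform and its Moebius inverse in the lattice of vertex subsets have this shape.
  The zeta transform builds a function of decompositions with graphs from contributions of induced subgraphs.
\<close>

definition wsum :: "(nat \<Rightarrow> 'k::comm_ring_1) \<Rightarrow> ('v, 'k) coeff \<Rightarrow> ('v, 'k) coeff" where
  "wsum w a F g = (\<Sum>J\<in>Pow (ground F). w (card (ground F - J)) * a (restr J F) (induced J g))"

abbreviation zeta :: "('v, 'k::comm_ring_1) coeff \<Rightarrow> ('v, 'k) coeff" where
  "zeta \<equiv> wsum (\<lambda>_. 1)"

abbreviation moebius :: "('v, 'k::comm_ring_1) coeff \<Rightarrow> ('v, 'k) coeff" where
  "moebius \<equiv> wsum (\<lambda>k. (-1) ^ k)"

lemma alternating_Pow:
  "finite S \<Longrightarrow> (\<Sum>L\<in>Pow S. (-1) ^ card L :: 'k::comm_ring_1) = (if S = {} then 1 else 0)"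
proof (induction S rule: finite_induct)
  case (insert x S)
  have "(\<Sum>L\<in>insert x ` Pow S. (-1) ^ card L :: 'k) = (\<Sum>L\<in>Pow S. - ((-1) ^ card L))"
  proof (subst sum.reindex)
    show "inj_on (insert x) (Pow S)" using insert by (auto simp: inj_on_def)
    show "sum ((\<lambda>L. (-1) ^ card L) \<circ> insert x) (Pow S) = (\<Sum>L\<in>Pow S. - ((-1) ^ card L :: 'k))"
    proof (rule sum.cong)
      fix L assume "L \<in> Pow S"
      then have "finite L" "x \<notin> L" using insert finite_subset by auto
      then show "((\<lambda>L. (-1) ^ card L) \<circ> insert x) L = - ((-1) ^ card L :: 'k)" by simp
    qed simp
  qed
  moreover have "Pow S \<inter> insert x ` Pow S = {}" using insert by auto
  ultimately show ?case
    using insert by (simp add: Pow_insert sum.union_disjoint sum_negf)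
qed auto

lemma Pow_Pow_swap:
  assumes "finite I"
  shows "(\<Sum>K\<in>Pow I. \<Sum>J\<in>Pow K. h K J) = (\<Sum>J\<in>Pow I. \<Sum>K\<in>{K. J \<subseteq> K \<and> K \<subseteq> I}. h K J)"
proof -
  have "(\<Sum>K\<in>Pow I. \<Sum>J\<in>Pow K. h K J) = (\<Sum>K\<in>Pow I. \<Sum>J\<in>{J \<in> Pow I. J \<subseteq> K}. h K J)"
    by (intro sum.cong) auto
  also have "\<dots> = (\<Sum>J\<in>Pow I. \<Sum>K\<in>{K \<in> Pow I. J \<subseteq> K}. h K J)"
    using assms by (intro sum.swap_restrict) auto
  also have "\<dots> = (\<Sum>J\<in>Pow I. \<Sum>K\<in>{K. J \<subseteq> K \<and> K \<subseteq> I}. h K J)"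
    by (intro sum.cong) auto
  finally show ?thesis .
qed

lemma Moebius_inversion:
  fixes f :: "'v set \<Rightarrow> 'k::comm_ring_1"
  assumes "finite I"
  shows "(\<Sum>K\<in>Pow I. \<Sum>J\<in>Pow K. (-1) ^ card (K - J) * f J) = f I"
    and "(\<Sum>K\<in>Pow I. (-1) ^ card (I - K) * (\<Sum>J\<in>Pow K. f J)) = f I"
proof -
  have 1: "(\<Sum>K\<in>{K. J \<subseteq> K \<and> K \<subseteq> I}. (-1) ^ card (K - J) :: 'k) = (if J = I then 1 else 0)"
    if "J \<subseteq> I" for J
  proof -
    have "(\<Sum>K\<in>{K. J \<subseteq> K \<and> K \<subseteq> I}. (-1) ^ card (K - J) :: 'k) = (\<Sum>L\<in>Pow (I - J). (-1) ^ card L)"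
      by (rule sum.reindex_bij_witness[of _ "\<lambda>L. L \<union> J" "\<lambda>K. K - J"]) (use that in auto)
    then show ?thesis using alternating_Pow[of "I - J", where 'k='k] assms that by auto
  qed
  have 2: "(\<Sum>K\<in>{K. J \<subseteq> K \<and> K \<subseteq> I}. (-1) ^ card (I - K) :: 'k) = (if J = I then 1 else 0)"
    if "J \<subseteq> I" for J
  proof -
    have "(\<Sum>K\<in>{K. J \<subseteq> K \<and> K \<subseteq> I}. (-1) ^ card (I - K) :: 'k) = (\<Sum>L\<in>Pow (I - J). (-1) ^ card L)"
      by (rule sum.reindex_bij_witness[of _ "\<lambda>L. I - L" "\<lambda>K. I - K"]) (use that in auto)
    then show ?thesis using alternating_Pow[of "I - J", where 'k='k] assms that by auto
  qed
  have *: "(\<Sum>J\<in>Pow I. (if J = I then 1 else 0) * f J) = f I"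
    using assms by (simp add: if_distrib[of "\<lambda>x. x * _"] sum.delta cong: if_cong)
  show "(\<Sum>K\<in>Pow I. \<Sum>J\<in>Pow K. (-1) ^ card (K - J) * f J) = f I"
    unfolding Pow_Pow_swap[OF assms] sum_distrib_right[symmetric]
    by (subst *[symmetric], intro sum.cong) (auto simp: 1)
  show "(\<Sum>K\<in>Pow I. (-1) ^ card (I - K) * (\<Sum>J\<in>Pow K. f J)) = f I"
    unfolding sum_distrib_left Pow_Pow_swap[OF assms] sum_distrib_right[symmetric]
    by (subst *[symmetric], intro sum.cong) (auto simp: 2)
qed

lemma wsum_restr:
  assumes "K \<subseteq> ground F"
  shows "wsum w a (restr K F) (induced K g)
    = (\<Sum>J\<in>Pow K. w (card (K - J)) * a (restr J F) (induced J g))"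
proof -
  have "ground (restr K F) = K" using assms by (auto simp: Union_restr)
  then show ?thesis
    unfolding wsum_def by (intro sum.cong) (auto simp: restr_restr induced_induced)
qed

lemma zeta_moebius:
  assumes "finite (ground F)" "g \<in> graphs (ground F)"
  shows "zeta (moebius a) F g = a F g"
proof -
  have "zeta (moebius a) F g = (\<Sum>K\<in>Pow (ground F). \<Sum>J\<in>Pow K. (-1) ^ card (K - J) * a (restr J F) (induced J g))"
    by (subst wsum_def) (auto intro!: sum.cong simp: wsum_restr)
  also have "\<dots> = a (restr (ground F) F) (induced (ground F) g)"
    by (rule Moebius_inversion) (use assms in auto)
  finally show ?thesis using assms by (simp add: restr_Union induced_id)
qed

lemma moebius_zeta:
  assumes "finite (ground F)" "g \<in> graphs (ground F)"
  shows "moebius (zeta a) F g = a F g"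
proof -
  have "moebius (zeta a) F g = (\<Sum>K\<in>Pow (ground F). (-1) ^ card (ground F - K) * (\<Sum>J\<in>Pow K. a (restr J F) (induced J g)))"
    by (subst wsum_def) (auto intro!: sum.cong simp: wsum_restr)
  also have "\<dots> = a (restr (ground F) F) (induced (ground F) g)"
    by (rule Moebius_inversion) (use assms in auto)
  finally show ?thesis using assms by (simp add: restr_Union induced_id)
qed

text \<open>
  The coboundary on coefficients at single graphs, its inner part written recursively.
\<close>

definition cob :: "('v, 'k::comm_ring_1) coeff \<Rightarrow> ('v, 'k) coeff" where
  "cob a F g = (if F = [] then 0 else
     a (tl F) (induced (ground (tl F)) g) - mid (\<lambda>l. a l g) F
     + (-1) ^ length F * a (butlast F) (induced (ground (butlast F)) g))"

definition cdom :: "nat \<Rightarrow> ('v set list \<times> 'v set set) set" where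
  "cdom n = {(F, g). length F = n \<and> disj F \<and> finite (ground F) \<and> g \<in> graphs (ground F)}"

lemma cdom_restr: "(F, g) \<in> cdom n \<Longrightarrow> J \<subseteq> ground F \<Longrightarrow> (restr J F, induced J g) \<in> cdom n"
  by (auto simp: cdom_def disj_restr Union_restr Int_absorb1 induced_graphs' intro: finite_subset)

lemma cdom_tl: "(x # r, g) \<in> cdom (Suc n) \<Longrightarrow> (r, induced (ground r) g) \<in> cdom n"
  by (auto simp: cdom_def induced_graphs')

lemma cdom_butlast:
  assumes "(G @ [x], g) \<in> cdom (Suc n)"
  shows "(G, induced (ground G) g) \<in> cdom n"
  using assms by (auto simp: cdom_def disj_append intro: induced_graphs')

lemma cob_cong:
  assumes "\<And>F g. (F, g) \<in> cdom n \<Longrightarrow> a F g = b F g" "(F, g) \<in> cdom (Suc n)"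
  shows "cob a F g = cob b F g"
proof -
  have "F \<noteq> []" using assms(2) by (auto simp: cdom_def)
  then have F: "F = hd F # tl F" "F = butlast F @ [last F]" by simp_all
  have 1: "mid (\<lambda>l. a l g) F = mid (\<lambda>l. b l g) F"
    by (rule mid_cong, rule assms(1)) (use assms(2) in \<open>auto simp: cdom_def\<close>)
  have 2: "(tl F, induced (ground (tl F)) g) \<in> cdom n"
    using cdom_tl[of "hd F" "tl F"] F assms by metis
  have 3: "(butlast F, induced (ground (butlast F)) g) \<in> cdom n"
    using cdom_butlast[of "butlast F" "last F"] F assms by metis
  show ?thesis
    unfolding cob_def 1 assms(1)[OF 2] assms(1)[OF 3] ..
qed

lemma wsum_cong:
  assumes "\<And>F g. (F, g) \<in> cdom n \<Longrightarrow> a F g = b F g" "(F, g) \<in> cdom n"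
  shows "wsum w a F g = wsum w b F g"
  unfolding wsum_def
  by (intro sum.cong refl arg_cong[where f = "\<lambda>x. _ * x"] assms(1) cdom_restr[OF assms(2)]) auto

text \<open>
  A subset \<open>J\<close> contributes to the outer coface, where the first block has been deleted, exactly if it
  avoids that block, that is, if the first block of the restricted decomposition is empty.
  The cosymmetry enters here: both outer cofaces are the same restriction of graphs.
\<close>

lemma cob_zeta:
  assumes "disj F" "finite (ground F)"
  shows "cob (zeta c) F g = zeta (\<lambda>F g. red_cob (\<lambda>l. c l g) F) F g"
proof (cases "F = []")
  case True
  then show ?thesis by (simp add: cob_def wsum_def)
next
  case False
  let ?I = "ground F"
  have Z: "zeta c G (induced (ground G) g) = (\<Sum>J\<in>Pow (ground G). c (restr J G) (induced J g))" for G
    unfolding wsum_def by (intro sum.cong) (auto simp: induced_induced)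
  obtain x r where xr: "F = x # r" using False by (cases F) auto
  have "(\<Sum>J\<in>Pow ?I. face0 (\<lambda>l. c l (induced J g)) (restr J F))
      = (\<Sum>J\<in>Pow ?I. if x \<inter> J = {} then c (restr J r) (induced J g) else 0)"
    by (simp add: xr)
  also have "\<dots> = (\<Sum>J\<in>Pow (ground r). c (restr J r) (induced J g))"
    by (rule sum.mono_neutral_cong_right) (use assms xr in auto)
  also have "\<dots> = zeta c (tl F) (induced (ground (tl F)) g)"
    unfolding Z xr by simp
  finally have 1: "(\<Sum>J\<in>Pow ?I. face0 (\<lambda>l. c l (induced J g)) (restr J F))
      = zeta c (tl F) (induced (ground (tl F)) g)" .
  obtain G y where Gy: "F = G @ [y]" using False by (metis append_butlast_last_id)
  have "(\<Sum>J\<in>Pow ?I. if y \<inter> J = {} then c (restr J G) (induced J g) else 0)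
      = (\<Sum>J\<in>Pow (ground G). c (restr J G) (induced J g))"
    by (rule sum.mono_neutral_cong_right) (use assms Gy in \<open>auto simp: disj_append\<close>)
  also have "\<dots> = zeta c (butlast F) (induced (ground (butlast F)) g)"
    unfolding Z Gy by simp
  finally have 2: "(\<Sum>J\<in>Pow ?I. if y \<inter> J = {} then c (restr J G) (induced J g) else 0)
      = zeta c (butlast F) (induced (ground (butlast F)) g)" .
  have "mid (\<lambda>l. zeta c l g) F = mid (\<lambda>l. \<Sum>J\<in>Pow ?I. c (restr J l) (induced J g)) F"
    by (rule mid_cong) (simp add: wsum_def)
  then have 3: "mid (\<lambda>l. zeta c l g) F = (\<Sum>J\<in>Pow ?I. mid (\<lambda>l. c l (induced J g)) (restr J F))"
    unfolding mid_sum mid_restr by simp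
  have 4: "(if restr J F \<noteq> [] \<and> last (restr J F) = {} then (-1) ^ length (restr J F) * c (butlast (restr J F)) (induced J g) else 0)
      = (-1) ^ length F * (if y \<inter> J = {} then c (restr J G) (induced J g) else 0)" for J
    unfolding Gy by (simp add: restr_def)
  have "zeta (\<lambda>F g. red_cob (\<lambda>l. c l g) F) F g = (\<Sum>J\<in>Pow ?I. red_cob (\<lambda>l. c l (induced J g)) (restr J F))"
    by (simp add: wsum_def)
  then show ?thesis
    unfolding cob_def 3 red_cob_mid 4
    by (simp add: False sum.distrib sum_subtractf 1 2 flip: sum_distrib_left)
qed

text \<open>
  Moebius inversion thus makes the coboundary blind to the graph.
\<close>

lemma moebius_cob:
  assumes "(F, g) \<in> cdom (Suc n)"
  shows "moebius (cob a) F g = red_cob (\<lambda>l. moebius a l g) F"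
proof -
  have *: "cob a F g = zeta (\<lambda>F g. red_cob (\<lambda>l. moebius a l g) F) F g" if "(F, g) \<in> cdom (Suc n)" for F g
  proof -
    have "cob a F g = cob (zeta (moebius a)) F g"
      by (rule cob_cong[OF _ that]) (auto simp: zeta_moebius cdom_def)
    also have "\<dots> = zeta (\<lambda>F g. red_cob (\<lambda>l. moebius a l g) F) F g"
      using that by (intro cob_zeta) (auto simp: cdom_def)
    finally show ?thesis .
  qed
  have "moebius (cob a) F g = moebius (zeta (\<lambda>F g. red_cob (\<lambda>l. moebius a l g) F)) F g"
    by (rule wsum_cong[OF * assms])
  also have "\<dots> = red_cob (\<lambda>l. moebius a l g) F"
    using assms by (intro moebius_zeta) (auto simp: cdom_def)
  finally show ?thesis .
qed

lemma cob_cob: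
  assumes "(F, g) \<in> cdom (Suc (Suc n))"
  shows "cob (cob a) F g = 0"
proof -
  have "cob (cob a) F g = zeta (\<lambda>F g. red_cob (\<lambda>l. moebius (cob a) l g) F) F g"
    using assms zeta_moebius[of F g "cob (cob a)"] wsum_cong[OF moebius_cob[where a = "cob a"] assms]
    by (auto simp: cdom_def)
  also have "\<dots> = zeta (\<lambda>F g. 0) F g"
  proof (rule wsum_cong[OF _ assms])
    fix F :: "'a set list" and g assume Fg: "(F, g) \<in> cdom (Suc (Suc n))"
    have "red_cob (\<lambda>l. moebius (cob a) l g) F = red_cob (red_cob (\<lambda>l. moebius a l g)) F"
      by (rule red_cob_cong, rule moebius_cob[of _ _ n]) (use Fg in \<open>auto simp: cdom_def\<close>)
    then show "red_cob (\<lambda>l. moebius (cob a) l g) F = 0" by (simp add: red_cob_red_cob)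
  qed
  finally show ?thesis by (simp add: wsum_def)
qed

section \<open>Naturality and averaging\<close>

lemma relabel_graphs:
  assumes "g \<in> graphs I" "inj_on \<sigma> I"
  shows "relabel \<sigma> g \<in> graphs (\<sigma> ` I)"
  using assms unfolding graphs_def relabel_def
  by (auto simp: card_image inj_on_subset)

lemma induced_relabel:
  assumes "g \<in> graphs I" "inj_on \<sigma> I" "J \<subseteq> I"
  shows "induced (\<sigma> ` J) (relabel \<sigma> g) = relabel \<sigma> (induced J g)"
proof -
  have "\<sigma> ` e \<subseteq> \<sigma> ` J \<longleftrightarrow> e \<subseteq> J" if "e \<in> g" for e
  proof -
    have "\<sigma> x \<in> \<sigma> ` J \<longleftrightarrow> x \<in> J" if "x \<in> e" for x
      using that \<open>e \<in> g\<close> assms by (intro inj_on_image_mem_iff[OF assms(2)]) (auto simp: graphs_def)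
    then show ?thesis by blast
  qed
  then show ?thesis by (auto simp: induced_def relabel_def)
qed

lemma relabel_relabel: "relabel \<tau> (relabel \<sigma> g) = relabel (\<tau> \<circ> \<sigma>) g"
  by (auto simp: relabel_def image_image image_comp)

lemma relabel_cong: "g \<in> graphs I \<Longrightarrow> (\<And>x. x \<in> I \<Longrightarrow> \<sigma> x = \<tau> x) \<Longrightarrow> relabel \<sigma> g = relabel \<tau> g"
  unfolding relabel_def graphs_def by (intro image_cong) (auto intro!: image_cong)

lemma map_image_cong: "(\<And>x. x \<in> ground F \<Longrightarrow> \<sigma> x = \<tau> x) \<Longrightarrow> map ((`) \<sigma>) F = map ((`) \<tau>) F"
  by (auto intro!: image_cong)

lemma Union_map_image: "ground (map ((`) \<sigma>) F) = \<sigma> ` ground F"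
  by auto

lemma disj_image: "disj F \<Longrightarrow> inj_on \<sigma> (ground F) \<Longrightarrow> disj (map ((`) \<sigma>) F)"
proof (induction F)
  case (Cons x r)
  have "\<sigma> ` x \<inter> \<sigma> ` ground r = \<sigma> ` (x \<inter> ground r)"
    using Cons.prems by (intro inj_on_image_Int[symmetric, of \<sigma> "ground (x # r)"]) auto
  then have "\<sigma> ` x \<inter> ground (map ((`) \<sigma>) r) = {}"
    using Cons.prems unfolding Union_map_image by simp
  moreover have "inj_on \<sigma> (ground r)" using Cons.prems by (auto intro: inj_on_subset)
  ultimately show ?case using Cons by simp
qed auto

lemma cdom_image:
  assumes "(F, g) \<in> cdom n" "inj_on \<sigma> (ground F)"
  shows "(map ((`) \<sigma>) F, relabel \<sigma> g) \<in> cdom n"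
  using assms disj_image[of F \<sigma>] relabel_graphs[of g "ground F" \<sigma>]
  by (simp add: cdom_def image_Union flip: image_Union)

lemma restr_image:
  assumes "inj_on \<sigma> (ground F)" "J \<subseteq> ground F"
  shows "restr (\<sigma> ` J) (map ((`) \<sigma>) F) = map ((`) \<sigma>) (restr J F)"
proof -
  have "\<sigma> ` x \<inter> \<sigma> ` J = \<sigma> ` (x \<inter> J)" if "x \<in> set F" for x
    using that assms by (intro inj_on_image_Int[symmetric, of \<sigma> "ground F"]) auto
  then show ?thesis by (simp add: restr_def)
qed

definition natural :: "nat \<Rightarrow> ('v, 'k) coeff \<Rightarrow> bool" where
  "natural n a \<longleftrightarrow> (\<forall>F g \<sigma>. (F, g) \<in> cdom n \<longrightarrow> inj_on \<sigma> (ground F) \<longrightarrow>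
     a (map ((`) \<sigma>) F) (relabel \<sigma> g) = a F g)"

lemma naturalD:
  "natural n a \<Longrightarrow> (F, g) \<in> cdom n \<Longrightarrow> inj_on \<sigma> (ground F) \<Longrightarrow>
     a (map ((`) \<sigma>) F) (relabel \<sigma> g) = a F g"
  by (auto simp: natural_def)

lemma wsum_natural:
  fixes a :: "('v, 'k::comm_ring_1) coeff"
  assumes "natural n a"
  shows "natural n (wsum w a)"
  unfolding natural_def
proof (intro allI impI)
  fix F :: "'v set list" and g and \<sigma> :: "'v \<Rightarrow> 'v"
  assume F: "(F, g) \<in> cdom n" and inj: "inj_on \<sigma> (ground F)"
  let ?I = "ground F"
  have "wsum w a (map ((`) \<sigma>) F) (relabel \<sigma> g)
      = (\<Sum>J\<in>(`) \<sigma> ` Pow ?I. w (card (\<sigma> ` ?I - J)) * a (restr J (map ((`) \<sigma>) F)) (induced J (relabel \<sigma> g)))"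
    unfolding wsum_def Union_map_image image_Pow_surj[OF refl] ..
  also have "\<dots> = (\<Sum>J\<in>Pow ?I. w (card (\<sigma> ` ?I - \<sigma> ` J)) * a (restr (\<sigma> ` J) (map ((`) \<sigma>) F)) (induced (\<sigma> ` J) (relabel \<sigma> g)))"
    by (subst sum.reindex) (use inj inj_on_image_Pow in auto)
  also have "\<dots> = wsum w a F g"
    unfolding wsum_def
  proof (rule sum.cong[OF refl])
    fix J assume J: "J \<in> Pow ?I"
    have "\<sigma> ` ?I - \<sigma> ` J = \<sigma> ` (?I - J)"
      using J inj by (intro inj_on_image_set_diff[symmetric, of \<sigma> ?I]) auto
    moreover have "card (\<sigma> ` (?I - J)) = card (?I - J)"
      using inj by (intro card_image) (auto intro: inj_on_subset)
    moreover have "a (restr (\<sigma> ` J) (map ((`) \<sigma>) F)) (induced (\<sigma> ` J) (relabel \<sigma> g)) = a (restr J F) (induced J g)"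
    proof -
      have "inj_on \<sigma> (ground (restr J F))"
        using inj by (rule inj_on_subset) (auto simp: Union_restr)
      moreover have "induced (\<sigma> ` J) (relabel \<sigma> g) = relabel \<sigma> (induced J g)"
        using F J inj by (intro induced_relabel[of _ ?I]) (auto simp: cdom_def)
      ultimately show ?thesis
        using J inj naturalD[OF assms cdom_restr[OF F]] by (simp add: restr_image)
    qed
    ultimately show "w (card (\<sigma> ` ?I - \<sigma> ` J)) * a (restr (\<sigma> ` J) (map ((`) \<sigma>) F)) (induced (\<sigma> ` J) (relabel \<sigma> g))
        = w (card (?I - J)) * a (restr J F) (induced J g)" by simp
  qed
  finally show "wsum w a (map ((`) \<sigma>) F) (relabel \<sigma> g) = wsum w a F g" .
qed

lemma decs_cdom: "F \<in> decs n I \<Longrightarrow> finite I \<Longrightarrow> g \<in> graphs I \<Longrightarrow> (F, g) \<in> cdom n"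
  by (auto simp: decs_def cdom_def)

lemma alt_relabel:
  assumes "natural (length vs) a" "distinct vs" "g \<in> graphs (set vs)" "inj_on \<sigma> (set vs)"
  shows "alt (map \<sigma> vs) (\<lambda>F. a F (relabel \<sigma> g)) = alt vs (\<lambda>F. a F g)"
  unfolding alt_map
proof (rule alt_cong[OF assms(2)])
  fix F assume F: "F \<in> decs (length vs) (set vs)"
  then have "inj_on \<sigma> (ground F)" using assms by (auto simp: decs_def)
  with F show "a (map ((`) \<sigma>) F) (relabel \<sigma> g) = a F g"
    using assms by (intro naturalD[OF assms(1)] decs_cdom) auto
qed

definition bijections :: "'v set \<Rightarrow> 'v set \<Rightarrow> ('v \<Rightarrow> 'v) set" where
  "bijections I S = {\<tau> \<in> I \<rightarrow>\<^sub>E S. bij_betw \<tau> I S}"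

lemma finite_bijections: "finite I \<Longrightarrow> finite S \<Longrightarrow> finite (bijections I S)"
  using finite_PiE[of I "\<lambda>_. S"] by (simp add: bijections_def)

lemma bijections_nonempty:
  assumes "finite I" "finite S" "card I = card S"
  shows "bijections I S \<noteq> {}"
proof -
  obtain h where h: "bij_betw h I S" using assms finite_same_card_bij by blast
  then have "restrict h I \<in> bijections I S"
    by (auto simp: bijections_def bij_betw_def inj_on_def)
  then show ?thesis by blast
qed

text \<open>
  Primitives \<open>\<gamma>\<close> are chosen independently for every graph on the standard vertex sets \<open>S m\<close>. Averaging
  over all identifications with a standard set makes the choice compatible with relabelling;
  in particular it is invariant under the automorphisms of each graph.
\<close>

definition average :: "(nat \<Rightarrow> 'v set) \<Rightarrow> (nat \<Rightarrow> 'v set set \<Rightarrow> 'v set list \<Rightarrow> 'k::field) \<Rightarrow> ('v, 'k) coeff" where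
  "average S \<gamma> F g = (let I = ground F; T = bijections I (S (card I)) in
     (1 / of_nat (card T)) * (\<Sum>\<tau>\<in>T. \<gamma> (card I) (relabel \<tau> g) (map ((`) \<tau>) F)))"

lemma average_natural: "natural n (average S \<gamma>)"
  unfolding natural_def
proof (intro allI impI)
  fix F :: "'a set list" and g and \<sigma> :: "'a \<Rightarrow> 'a"
  assume F: "(F, g) \<in> cdom n" and inj: "inj_on \<sigma> (ground F)"
  let ?I = "ground F"
  let ?S = "S (card ?I)"
  let ?i = "\<lambda>\<tau>. restrict (\<tau> \<circ> \<sigma>) ?I" and ?j = "\<lambda>\<tau>. restrict (\<tau> \<circ> inv_into ?I \<sigma>) (\<sigma> ` ?I)"
  have c: "card (\<sigma> ` ?I) = card ?I" using inj by (rule card_image)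
  have bs: "bij_betw \<sigma> ?I (\<sigma> ` ?I)" using inj by (simp add: bij_betw_def)
  have i: "?i \<tau> \<in> bijections ?I ?S" if "\<tau> \<in> bijections (\<sigma> ` ?I) ?S" for \<tau>
  proof -
    have "bij_betw (\<tau> \<circ> \<sigma>) ?I ?S" using that bs by (auto simp: bijections_def intro: bij_betw_trans)
    then have b: "bij_betw (?i \<tau>) ?I ?S" by (subst bij_betw_cong[of _ _ "\<tau> \<circ> \<sigma>"]) auto
    then show ?thesis
      unfolding bijections_def PiE_def using bij_betw_imp_funcset[OF b] restrict_extensional by blast
  qed
  have j: "?j \<tau> \<in> bijections (\<sigma> ` ?I) ?S" if "\<tau> \<in> bijections ?I ?S" for \<tau>
  proof -
    have "bij_betw (\<tau> \<circ> inv_into ?I \<sigma>) (\<sigma> ` ?I) ?S"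
      using that bij_betw_inv_into[OF bs] by (auto simp: bijections_def intro: bij_betw_trans)
    then have b: "bij_betw (?j \<tau>) (\<sigma> ` ?I) ?S" by (subst bij_betw_cong[of _ _ "\<tau> \<circ> inv_into ?I \<sigma>"]) auto
    then show ?thesis
      unfolding bijections_def PiE_def using bij_betw_imp_funcset[OF b] restrict_extensional by blast
  qed
  have ij: "?j (?i \<tau>) = \<tau>" if "\<tau> \<in> bijections (\<sigma> ` ?I) ?S" for \<tau>
  proof
    fix x
    show "?j (?i \<tau>) x = \<tau> x"
    proof (cases "x \<in> \<sigma> ` ?I")
      case True
      then show ?thesis using inv_into_into[OF True] f_inv_into_f[OF True] by simp
    next
      case False
      then show ?thesis using that by (auto simp: bijections_def PiE_def extensional_def)
    qed
  qed
  have ji: "?i (?j \<tau>) = \<tau>" if "\<tau> \<in> bijections ?I ?S" for \<tau>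
  proof
    fix x
    show "?i (?j \<tau>) x = \<tau> x"
    proof (cases "x \<in> ?I")
      case True
      then have "\<sigma> x \<in> \<sigma> ` ?I" by blast
      then show ?thesis using True inv_into_f_f[OF inj True] by simp
    next
      case False
      then show ?thesis using that by (auto simp: bijections_def PiE_def extensional_def)
    qed
  qed
  have "bij_betw ?i (bijections (\<sigma> ` ?I) ?S) (bijections ?I ?S)"
    by (rule bij_betwI[where g = ?j]) (use i j ij ji in auto)
  then have card: "card (bijections (\<sigma> ` ?I) ?S) = card (bijections ?I ?S)"
    by (rule bij_betw_same_card)
  have "(\<Sum>\<tau>\<in>bijections (\<sigma> ` ?I) ?S. \<gamma> (card ?I) (relabel \<tau> (relabel \<sigma> g)) (map ((`) \<tau>) (map ((`) \<sigma>) F)))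
      = (\<Sum>\<tau>\<in>bijections ?I ?S. \<gamma> (card ?I) (relabel \<tau> g) (map ((`) \<tau>) F))"
  proof (rule sum.reindex_bij_witness[where i = ?j and j = ?i])
    fix \<tau> assume \<tau>: "\<tau> \<in> bijections (\<sigma> ` ?I) ?S"
    have "relabel (?i \<tau>) g = relabel \<tau> (relabel \<sigma> g)"
      unfolding relabel_relabel by (rule relabel_cong[of _ ?I]) (use F in \<open>auto simp: cdom_def\<close>)
    moreover have "map ((`) (?i \<tau>)) F = map ((`) \<tau>) (map ((`) \<sigma>) F)"
    proof -
      have "map ((`) (?i \<tau>)) F = map ((`) (\<tau> \<circ> \<sigma>)) F"
        by (rule map_image_cong) auto
      then show ?thesis by (simp add: image_comp)
    qed
    ultimately show "\<gamma> (card ?I) (relabel (?i \<tau>) g) (map ((`) (?i \<tau>)) F)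
      = \<gamma> (card ?I) (relabel \<tau> (relabel \<sigma> g)) (map ((`) \<tau>) (map ((`) \<sigma>) F))" by (simp only:)
  qed (use i j ij ji in auto)
  then show "average S \<gamma> (map ((`) \<sigma>) F) (relabel \<sigma> g) = average S \<gamma> F g"
    unfolding average_def Let_def Union_map_image c card by simp
qed

lemma average_primitive:
  fixes b :: "('v, 'k::field_char_0) coeff"
  assumes nat: "natural n b"
    and F: "(F, g) \<in> cdom n"
    and S: "\<And>m. finite (S m)" "\<And>m. card (S m) = m"
    and \<gamma>: "\<And>m h F. h \<in> graphs (S m) \<Longrightarrow> F \<in> decs n (S m) \<Longrightarrow> red_cob (\<gamma> m h) F = b F h"
  shows "red_cob (\<lambda>l. average S \<gamma> l g) F = b F g"
proof -
  let ?I = "ground F"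
  let ?T = "bijections ?I (S (card ?I))"
  have fin: "finite ?I" using F by (auto simp: cdom_def)
  have T: "finite ?T" "?T \<noteq> {}"
    using finite_bijections[OF fin S(1)] bijections_nonempty[OF fin S(1)] S(2) by simp_all
  have "red_cob (\<lambda>l. average S \<gamma> l g) F
      = red_cob (\<lambda>l. (1 / of_nat (card ?T)) * (\<Sum>\<tau>\<in>?T. \<gamma> (card ?I) (relabel \<tau> g) (map ((`) \<tau>) l))) F"
    by (rule red_cob_cong) (simp add: average_def Let_def)
  also have "\<dots> = (1 / of_nat (card ?T)) * (\<Sum>\<tau>\<in>?T. red_cob (\<gamma> (card ?I) (relabel \<tau> g)) (map ((`) \<tau>) F))"
    unfolding red_cob_scale red_cob_sum red_cob_image ..
  also have "(\<Sum>\<tau>\<in>?T. red_cob (\<gamma> (card ?I) (relabel \<tau> g)) (map ((`) \<tau>) F)) = (\<Sum>\<tau>\<in>?T. b F g)"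
  proof (rule sum.cong[OF refl])
    fix \<tau> assume \<tau>: "\<tau> \<in> ?T"
    then have inj: "inj_on \<tau> ?I" and im: "\<tau> ` ?I = S (card ?I)" by (auto simp: bijections_def bij_betw_def)
    from cdom_image[OF F inj] have "(map ((`) \<tau>) F, relabel \<tau> g) \<in> cdom n" .
    then have "relabel \<tau> g \<in> graphs (S (card ?I))" "map ((`) \<tau>) F \<in> decs n (S (card ?I))"
      unfolding cdom_def decs_def using im Union_map_image[of \<tau> F] by auto
    from \<gamma>[OF this] show "red_cob (\<gamma> (card ?I) (relabel \<tau> g)) (map ((`) \<tau>) F) = b F g"
      using naturalD[OF nat F inj] by simp
  qed
  finally show ?thesis using T by simp
qed

text \<open>
  Degreewise exactness of the reduced complex, transported back through Moebius inversion. The only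
  condition left concerns graphs with exactly \<open>n\<close> vertices, and for each of them the
  vanishing of \<open>alt\<close> for one ordering of the vertices suffices.
\<close>

theorem detection:
  fixes a :: "('v, 'k::field_char_0) coeff" and S :: "nat \<Rightarrow> 'v set"
  assumes nat: "natural n a"
    and cocycle: "\<And>F g. (F, g) \<in> cdom (Suc n) \<Longrightarrow> cob a F g = 0"
    and S: "\<And>m. finite (S m)" "\<And>m. card (S m) = m"
    and alt: "\<And>g. g \<in> graphs (S n) \<Longrightarrow>
       \<exists>vs. distinct vs \<and> set vs = S n \<and> alt vs (\<lambda>F. moebius a F g) = 0"
  shows "\<exists>c. (\<forall>m. natural m c) \<and> (\<forall>F g. (F, g) \<in> cdom n \<longrightarrow> cob c F g = a F g)"
proof -
  let ?b = "moebius a"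
  have natb: "natural n ?b" by (rule wsum_natural[OF nat])
  have coc: "red_cob (\<lambda>l. ?b l g) F = 0" if "(F, g) \<in> cdom (Suc n)" for F g
  proof -
    have "red_cob (\<lambda>l. ?b l g) F = moebius (cob a) F g" by (rule moebius_cob[OF that, symmetric])
    also have "\<dots> = moebius (\<lambda>F g. 0) F g" by (rule wsum_cong[OF cocycle that])
    finally show ?thesis by (simp add: wsum_def)
  qed
  have "\<exists>\<gamma>. \<forall>F\<in>decs n (S m). red_cob \<gamma> F = ?b F h" if h: "h \<in> graphs (S m)" for m h
  proof -
    obtain vs where vs: "distinct vs" "set vs = S m" "m = n \<longrightarrow> alt vs (\<lambda>F. ?b F h) = 0"
    proof (cases "m = n")
      case True
      then show ?thesis using alt h that by blast
    next
      case False
      then show ?thesis using finite_distinct_list[OF S(1)[of m]] that by blast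
    qed
    have "\<exists>\<gamma>. \<forall>F\<in>decs n (set vs). red_cob \<gamma> F = ?b F h"
    proof (rule exactness[OF vs(1)])
      show "red_cob (\<lambda>F. ?b F h) F = 0" if "F \<in> decs (Suc n) (set vs)" for F
        using decs_cdom[OF that _ h[folded vs(2)]] coc by simp
      show "alt vs (\<lambda>F. ?b F h) = 0" if "length vs = n"
        using that vs S(2)[of m] distinct_card[OF vs(1)] by simp
    qed
    then show ?thesis using vs by simp
  qed
  note ex = this
  define \<gamma> where "\<gamma> m h = (SOME \<gamma>. \<forall>F\<in>decs n (S m). red_cob \<gamma> F = ?b F h)" for m h
  have \<gamma>: "red_cob (\<gamma> m h) F = ?b F h" if "h \<in> graphs (S m)" "F \<in> decs n (S m)" for m h F
    unfolding \<gamma>_def using someI_ex[OF ex[OF that(1)]] that(2) by blast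
  have "cob (zeta (average S \<gamma>)) F g = a F g" if Fg: "(F, g) \<in> cdom n" for F g
  proof -
    have "cob (zeta (average S \<gamma>)) F g = zeta (\<lambda>F g. red_cob (\<lambda>l. average S \<gamma> l g) F) F g"
      using Fg by (intro cob_zeta) (auto simp: cdom_def)
    also have "\<dots> = zeta ?b F g"
      by (rule wsum_cong[OF average_primitive[OF natb _ S \<gamma>] Fg])
    also have "\<dots> = a F g" using Fg by (intro zeta_moebius) (auto simp: cdom_def)
    finally show ?thesis .
  qed
  then show ?thesis using wsum_natural[OF average_natural] by blast
qed

section \<open>Cochains and their coefficients\<close>

lemma decomps_iff: "F \<in> decomps n \<longleftrightarrow> length F = n \<and> finite (ground F) \<and> disj F"
proof -
  have "disj F \<longleftrightarrow> disjoint_family_on (\<lambda>i. F ! i) {..<length F}"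
  proof (induction F)
    case (Cons x r)
    have "disjoint_family_on (\<lambda>i. (x # r) ! i) {..<length (x # r)} \<longleftrightarrow>
        (\<forall>i<length r. x \<inter> r ! i = {}) \<and> disjoint_family_on (\<lambda>i. r ! i) {..<length r}"
      (is "?L \<longleftrightarrow> ?A \<and> ?B")
    proof
      assume L: ?L
      have "x \<inter> r ! i = {}" if "i < length r" for i
        using disjoint_family_onD[OF L, of 0 "Suc i"] that by simp
      moreover have "r ! i \<inter> r ! j = {}" if "i < length r" "j < length r" "i \<noteq> j" for i j
        using disjoint_family_onD[OF L, of "Suc i" "Suc j"] that by simp
      ultimately show "?A \<and> ?B" by (auto simp: disjoint_family_on_def)
    next
      assume *: "?A \<and> ?B"
      show ?L
        unfolding disjoint_family_on_def
      proof (intro ballI impI)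
        fix i j assume "i \<in> {..<length (x # r)}" "j \<in> {..<length (x # r)}" "i \<noteq> j"
        then show "(x # r) ! i \<inter> (x # r) ! j = {}"
          using * by (cases i; cases j) (auto simp: disjoint_family_on_def Int_commute)
      qed
    qed
    moreover have "x \<inter> ground r = {} \<longleftrightarrow> (\<forall>i<length r. x \<inter> r ! i = {})"
      unfolding set_conv_nth by blast
    ultimately show ?case using Cons by simp
  qed (auto simp: disjoint_family_on_def)
  then show ?thesis by (auto simp: decomps_def)
qed

lemma cdom_iff: "(F, g) \<in> cdom n \<longleftrightarrow> F \<in> decomps n \<and> g \<in> graphs (ground F)"
  by (auto simp: cdom_def decomps_iff)

lemma cochain_dom_iff: "(F, z) \<in> cochain_dom n \<longleftrightarrow> F \<in> decomps n \<and> (\<forall>g\<in>Poly_Mapping.keys z. (F, g) \<in> cdom n)"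
  by (auto simp: cochain_dom_def Gr_def cdom_iff)

lemma free_ext_superset:
  assumes "finite A" "Poly_Mapping.keys z \<subseteq> A"
  shows "free_ext f z = (\<Sum>g\<in>A. Poly_Mapping.lookup z g * f g)"
  unfolding free_ext_def using assms by (intro sum.mono_neutral_left) (auto simp: in_keys_iff)

lemma free_ext_add: "free_ext f (x + y) = free_ext f x + free_ext f y"
proof -
  let ?A = "Poly_Mapping.keys x \<union> Poly_Mapping.keys y"
  have "Poly_Mapping.keys (x + y) \<subseteq> ?A" by (rule Poly_Mapping.keys_add)
  then have "free_ext f (x + y) = (\<Sum>g\<in>?A. Poly_Mapping.lookup (x + y) g * f g)"
    by (intro free_ext_superset) auto
  moreover have "free_ext f x = (\<Sum>g\<in>?A. Poly_Mapping.lookup x g * f g)"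
    "free_ext f y = (\<Sum>g\<in>?A. Poly_Mapping.lookup y g * f g)"
    by (intro free_ext_superset; auto)+
  ultimately show ?thesis by (simp add: lookup_add algebra_simps sum.distrib)
qed

lemma free_ext_single: "free_ext f (Poly_Mapping.single g c) = c * f g"
  by (simp add: free_ext_superset[of "{g}"] lookup_single)

lemma free_ext_zero: "free_ext f 0 = 0"
  by (simp add: free_ext_def)

lemma free_ext_sum: "free_ext f (\<Sum>i\<in>A. x i) = (\<Sum>i\<in>A. free_ext f (x i))"
  by (induction A rule: infinite_finite_induct) (auto simp: free_ext_zero free_ext_add)

lemma lookup_scale: "Poly_Mapping.lookup (Poly_Mapping.map ((*) c) x) g = (c :: 'k::field) * Poly_Mapping.lookup x g"
  by (simp add: Poly_Mapping.map.rep_eq when_def)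

lemma free_ext_scale: "free_ext f (Poly_Mapping.map ((*) c) x) = (c :: 'k::field) * free_ext f x"
proof -
  have "Poly_Mapping.keys (Poly_Mapping.map ((*) c) x) \<subseteq> Poly_Mapping.keys x"
    by (auto simp: in_keys_iff lookup_scale)
  then have "free_ext f (Poly_Mapping.map ((*) c) x)
      = (\<Sum>g\<in>Poly_Mapping.keys x. Poly_Mapping.lookup (Poly_Mapping.map ((*) c) x) g * f g)"
    by (intro free_ext_superset) auto
  then show ?thesis by (simp add: lookup_scale free_ext_def sum_distrib_left mult.assoc)
qed

lemma free_ext_free_map: "free_ext a (free_map f z) = free_ext (\<lambda>g. a (f g)) z"
  unfolding free_map_def free_ext_sum free_ext_single by (simp add: free_ext_def)

lemma free_ext_cong: "(\<And>g. g \<in> Poly_Mapping.keys z \<Longrightarrow> f g = f' g) \<Longrightarrow> free_ext f z = free_ext f' z"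
  by (simp add: free_ext_def)

lemma free_ext_fun_add: "free_ext (\<lambda>g. f g + f' g) z = free_ext f z + free_ext f' z"
  by (simp add: free_ext_def algebra_simps sum.distrib)

lemma free_ext_fun_scale: "free_ext (\<lambda>g. c * f g) z = c * free_ext f z"
  by (simp add: free_ext_def sum_distrib_left algebra_simps)

lemma free_ext_fun_sum: "free_ext (\<lambda>g. \<Sum>i\<in>A. f i g) z = (\<Sum>i\<in>A. free_ext (f i) z)"
  unfolding free_ext_def sum_distrib_left by (rule sum.swap)

lemma keys_free_map: "Poly_Mapping.keys (free_map f z) \<subseteq> f ` Poly_Mapping.keys z"
proof -
  have "Poly_Mapping.keys (free_map f z)
      \<subseteq> (\<Union>g\<in>Poly_Mapping.keys z. Poly_Mapping.keys (Poly_Mapping.single (f g) (Poly_Mapping.lookup z g)))"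
    unfolding free_map_def by (rule Poly_Mapping.keys_sum)
  also have "\<dots> \<subseteq> f ` Poly_Mapping.keys z" by auto
  finally show ?thesis .
qed

lemma free_map_single: "free_map f (Poly_Mapping.single g 1) = Poly_Mapping.single (f g) (1 :: 'k::field)"
  by (simp add: free_map_def)

definition coef :: "('v, 'k::field) cochain \<Rightarrow> ('v, 'k) coeff" where
  "coef \<alpha> F g = \<alpha> F (Poly_Mapping.single g 1)"

lemma single_dom: "(F, Poly_Mapping.single g (1::'k::field)) \<in> cochain_dom n \<longleftrightarrow> (F, g) \<in> cdom n"
  by (auto simp: cochain_dom_iff cdom_iff)

lemma coef_cochain_of: "(F, g) \<in> cdom n \<Longrightarrow> coef (cochain_of n a) F g = a F g"
  by (simp add: coef_def cochain_of_def single_dom free_ext_single)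

lemma cochain_of_cong:
  "(\<And>F g. (F, g) \<in> cdom n \<Longrightarrow> a F g = b F g) \<Longrightarrow> cochain_of n a = cochain_of n b"
  by (intro ext) (auto simp: cochain_of_def cochain_dom_iff intro!: free_ext_cong)

lemma cochain_outside: "\<alpha> \<in> cochains n \<Longrightarrow> (F, z) \<notin> cochain_dom n \<Longrightarrow> \<alpha> F z = 0"
  by (auto simp: cochains_def)

lemma Gr_add: "x \<in> Gr I \<Longrightarrow> y \<in> Gr I \<Longrightarrow> x + y \<in> Gr I"
  using Poly_Mapping.keys_add[of x y] unfolding Gr_def by auto

text \<open>
  By linearity a cochain is determined by its coefficients at single graphs, so that cochains of
  degree \<open>n\<close> are the natural coefficient functions.
\<close>

lemma cochain_free_ext:
  assumes \<alpha>: "\<alpha> \<in> cochains n" and F: "F \<in> decomps n" and z: "z \<in> Gr (ground F)"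
  shows "\<alpha> F z = free_ext (coef \<alpha> F) z"
proof -
  let ?I = "ground F"
  have add: "\<And>x y. x \<in> Gr ?I \<Longrightarrow> y \<in> Gr ?I \<Longrightarrow> \<alpha> F (x + y) = \<alpha> F x + \<alpha> F y"
    and scale: "\<And>c x. x \<in> Gr ?I \<Longrightarrow> \<alpha> F (Poly_Mapping.map ((*) c) x) = c * \<alpha> F x"
    using \<alpha> F by (auto simp: cochains_def)
  have [simp]: "0 \<in> Gr ?I" by (simp add: Gr_def)
  have "Poly_Mapping.map ((*) 0) (0 :: 'a set set \<Rightarrow>\<^sub>0 'b) = 0"
    by (rule poly_mapping_eqI) (simp add: lookup_scale)
  then have zero: "\<alpha> F 0 = 0" using scale[of 0 0] by simp
  have single: "\<alpha> F (Poly_Mapping.single g c) = c * coef \<alpha> F g" if "g \<in> graphs ?I" for g c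
  proof -
    have "Poly_Mapping.map ((*) c) (Poly_Mapping.single g 1) = Poly_Mapping.single g c"
      by (rule poly_mapping_eqI) (simp add: lookup_scale lookup_single when_def)
    then show ?thesis
      using scale[of "Poly_Mapping.single g 1" c] that by (simp add: Gr_def coef_def)
  qed
  have sum: "(\<Sum>g\<in>A. Poly_Mapping.single g (c g)) \<in> Gr ?I \<and>
     \<alpha> F (\<Sum>g\<in>A. Poly_Mapping.single g (c g)) = (\<Sum>g\<in>A. c g * coef \<alpha> F g)"
    if "finite A" "A \<subseteq> graphs ?I" for A c
    using that
  proof (induction A rule: finite_induct)
    case (insert x A)
    have 1: "Poly_Mapping.single x (c x) \<in> Gr ?I" using insert by (auto simp: Gr_def)
    have 2: "(\<Sum>g\<in>A. Poly_Mapping.single g (c g)) \<in> Gr ?I" using insert by simp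
    have "Poly_Mapping.single x (c x) + (\<Sum>g\<in>A. Poly_Mapping.single g (c g)) \<in> Gr ?I"
      by (rule Gr_add[OF 1 2])
    then show ?case using insert add[OF 1 2] single[of x "c x"] by simp
  qed (simp add: zero)
  have "z = (\<Sum>g\<in>Poly_Mapping.keys z. Poly_Mapping.single g (Poly_Mapping.lookup z g))"
    by (rule poly_mapping_eqI) (auto simp: lookup_sum lookup_single when_def in_keys_iff)
  then have "\<alpha> F z = \<alpha> F (\<Sum>g\<in>Poly_Mapping.keys z. Poly_Mapping.single g (Poly_Mapping.lookup z g))"
    by (rule arg_cong)
  then show ?thesis
    using sum[of "Poly_Mapping.keys z" "Poly_Mapping.lookup z"] z by (simp add: Gr_def free_ext_def)
qed

lemma cochain_of_coef:
  assumes "\<alpha> \<in> cochains n"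
  shows "cochain_of n (coef \<alpha>) = \<alpha>"
  by (intro ext) (use assms in \<open>auto simp: cochain_of_def cochain_outside cochain_free_ext cochain_dom_def\<close>)

lemma cochain_eqI:
  assumes "\<alpha> \<in> cochains n" "\<beta> \<in> cochains n" "\<And>F g. (F, g) \<in> cdom n \<Longrightarrow> coef \<alpha> F g = coef \<beta> F g"
  shows "\<alpha> = \<beta>"
  using cochain_of_cong[of n "coef \<alpha>" "coef \<beta>"] assms by (simp add: cochain_of_coef)

lemma cochain_transport:
  assumes "\<alpha> \<in> cochains n" "F \<in> decomps n" "z \<in> Gr (ground F)" "bij_betw \<sigma> (ground F) J"
  shows "\<alpha> (map ((`) \<sigma>) F) (Gr_transport \<sigma> z) = \<alpha> F z"
proof -
  have "\<forall>F\<in>decomps n. \<forall>z\<in>Gr (ground F). \<forall>\<sigma> J. bij_betw \<sigma> (ground F) J \<longrightarrow>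
        \<alpha> (map ((`) \<sigma>) F) (Gr_transport \<sigma> z) = \<alpha> F z"
    using assms(1) unfolding cochains_def by simp
  then show ?thesis using assms(2-4) by blast
qed

lemma coef_natural:
  assumes "\<alpha> \<in> cochains n"
  shows "natural n (coef \<alpha>)"
  unfolding natural_def
proof (intro allI impI)
  fix F :: "'a set list" and g and \<sigma> :: "'a \<Rightarrow> 'a"
  assume F: "(F, g) \<in> cdom n" and inj: "inj_on \<sigma> (ground F)"
  have "\<alpha> (map ((`) \<sigma>) F) (Gr_transport \<sigma> (Poly_Mapping.single g 1)) = \<alpha> F (Poly_Mapping.single g 1)"
    by (rule cochain_transport[OF assms _ _ inj_on_imp_bij_betw[OF inj]]) (use F in \<open>auto simp: cdom_iff Gr_def\<close>)
  then show "coef \<alpha> (map ((`) \<sigma>) F) (relabel \<sigma> g) = coef \<alpha> F g"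
    by (simp add: free_map_single coef_def)
qed

lemma cochain_of_in_cochains:
  assumes "natural n a"
  shows "cochain_of n a \<in> cochains n"
proof -
  have 1: "(F, z) \<in> cochain_dom n \<longleftrightarrow> z \<in> Gr (ground F)" if "F \<in> decomps n" for F :: "'a set list" and z :: "'a set set \<Rightarrow>\<^sub>0 'b"
    using that by (simp add: cochain_dom_def)
  have 2: "x + y \<in> Gr I" if "x \<in> Gr I" "y \<in> Gr I" for x y :: "'a set set \<Rightarrow>\<^sub>0 'b" and I
    using that by (rule Gr_add)
  have 3: "Poly_Mapping.map ((*) c) x \<in> Gr I" if "x \<in> Gr I" for c and x :: "'a set set \<Rightarrow>\<^sub>0 'b" and I
    using that by (auto simp: Gr_def in_keys_iff lookup_scale)
  have 4: "cochain_of n a (map ((`) \<sigma>) F) (Gr_transport \<sigma> z) = cochain_of n a F z"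
    if F: "F \<in> decomps n" and z: "z \<in> Gr (ground F)" and bij: "bij_betw \<sigma> (ground F) J"
    for F z \<sigma> J
  proof -
    have inj: "inj_on \<sigma> (ground F)" using bij by (simp add: bij_betw_def)
    have d: "(F, z) \<in> cochain_dom n" using F z by (simp add: 1)
    then have g: "(F, g) \<in> cdom n" if "g \<in> Poly_Mapping.keys z" for g
      using that by (auto simp: cochain_dom_iff)
    have "(map ((`) \<sigma>) F, {}) \<in> cdom n"
      using cdom_image[of F "{}" n \<sigma>] F inj by (auto simp: cdom_iff graphs_def relabel_def)
    then have "(map ((`) \<sigma>) F, Gr_transport \<sigma> z) \<in> cochain_dom n"
      using cdom_image[OF g inj] keys_free_map[of "relabel \<sigma>" z]
      unfolding cochain_dom_iff by (auto simp: cdom_iff)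
    then show ?thesis
      using d naturalD[OF assms g inj] by (auto simp: cochain_of_def free_ext_free_map intro!: free_ext_cong)
  qed
  have 5: "cochain_of n a F z = (if z \<in> Gr (ground F) then free_ext (a F) z else 0)"
    if "F \<in> decomps n" for F z
    using that by (simp add: cochain_of_def 1)
  have 6: "cochain_of n a F z = 0" if "(F, z) \<notin> cochain_dom n" for F z
    using that by (simp add: cochain_of_def)
  show ?thesis
    unfolding cochains_def mem_Collect_eq
    by (intro conjI allI ballI impI)
      (erule 6, simp add: 2 5 free_ext_add, simp add: 3 5 free_ext_scale, rule 4)
qed

lemma mid_image: "mid \<phi> (map ((`) \<sigma>) F) = mid (\<lambda>l. \<phi> (map ((`) \<sigma>) l)) F"
proof (induction F arbitrary: \<phi>)
  case (Cons x r)
  show ?case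
  proof (cases r)
    case (Cons y r')
    then show ?thesis using Cons.IH[of "\<lambda>l. \<phi> (\<sigma> ` x # l)"] by (simp add: image_Un)
  qed auto
qed auto

lemma cob_natural:
  assumes "natural n a"
  shows "natural (Suc n) (cob a)"
  unfolding natural_def
proof (intro allI impI)
  fix F :: "'a set list" and g and \<sigma> :: "'a \<Rightarrow> 'a"
  assume F: "(F, g) \<in> cdom (Suc n)" and inj: "inj_on \<sigma> (ground F)"
  have ne: "F \<noteq> []" using F by (auto simp: cdom_def)
  have part: "a (map ((`) \<sigma>) G) (induced (ground (map ((`) \<sigma>) G)) (relabel \<sigma> g)) = a G (induced (ground G) g)"
    if G: "(G, induced (ground G) g) \<in> cdom n" and sub: "ground G \<subseteq> ground F" for G
  proof -
    have "induced (\<sigma> ` ground G) (relabel \<sigma> g) = relabel \<sigma> (induced (ground G) g)"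
      using F inj sub by (intro induced_relabel[of _ "ground F"]) (auto simp: cdom_def)
    then show ?thesis
      using naturalD[OF assms G inj_on_subset[OF inj sub]] unfolding Union_map_image by simp
  qed
  have F2: "F = hd F # tl F" "F = butlast F @ [last F]" using ne by simp_all
  have t: "(tl F, induced (ground (tl F)) g) \<in> cdom n" "ground (tl F) \<subseteq> ground F"
    using cdom_tl[of "hd F" "tl F"] F2 F by (metis, use ne in \<open>auto dest: list.set_sel(2)\<close>)
  have b: "(butlast F, induced (ground (butlast F)) g) \<in> cdom n" "ground (butlast F) \<subseteq> ground F"
    using cdom_butlast[of "butlast F" "last F"] F2 F by (metis, auto dest: in_set_butlastD)
  have m: "mid (\<lambda>l. a (map ((`) \<sigma>) l) (relabel \<sigma> g)) F = mid (\<lambda>l. a l g) F"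
    by (rule mid_cong, rule naturalD[OF assms]) (use F inj in \<open>auto simp: cdom_def\<close>)
  show "cob a (map ((`) \<sigma>) F) (relabel \<sigma> g) = cob a F g"
    using part[OF t] part[OF b] m ne
    by (simp add: cob_def map_tl[symmetric] map_butlast[symmetric] mid_image)
qed

text \<open>
  The link between the recursion for the inner cofaces and their indexed form.
\<close>

lemma mid_eq_sum:
  "mid \<phi> F = (\<Sum>i<length F - 1. (-1) ^ i * \<phi> (take i F @ (F ! i \<union> F ! Suc i) # drop (i + 2) F))"
proof (induction \<phi> F rule: mid.induct)
  case (3 \<phi> x y r)
  show ?case
    by (simp add: 3 sum.lessThan_Suc_shift sum_negf del: sum.lessThan_Suc)
qed auto

lemma coboundary_eq:
  assumes "\<alpha> \<in> cochains n"
  shows "coboundary n \<alpha> = cochain_of (Suc n) (cob (coef \<alpha>))"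
proof (intro ext)
  fix F :: "'a set list" and z :: "'a set set \<Rightarrow>\<^sub>0 'b"
  show "coboundary n \<alpha> F z = cochain_of (Suc n) (cob (coef \<alpha>)) F z"
  proof (cases "(F, z) \<in> cochain_dom (Suc n)")
    case False
    then show ?thesis by (simp add: coboundary_def coface_def cochain_of_def)
  next
    case True
    then have F: "length F = Suc n" "disj F" "finite (ground F)" and z: "z \<in> Gr (ground F)"
      by (auto simp: cochain_dom_def decomps_iff)
    then have ne: "F \<noteq> []" by auto
    have F2: "F = hd F # tl F" "F = butlast F @ [last F]" using ne by simp_all
    have gr: "Gr_restrict J z \<in> Gr J" if "J \<subseteq> ground F" for J
      using keys_free_map[of "induced J" z] z that by (auto simp: Gr_def dest!: subsetD intro!: induced_graphs'[OF _ that])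
    have i0: "coface n 0 \<alpha> F z = free_ext (\<lambda>g. coef \<alpha> (tl F) (induced (ground (tl F)) g)) z"
    proof -
      obtain x r where xr: "F = x # r" using ne by (cases F) auto
      have "ground F - hd F = ground (tl F)" using F(2) by (auto simp: xr)
      moreover have "tl F \<in> decomps n" using F by (auto simp: xr decomps_iff)
      moreover have "Gr_restrict (ground (tl F)) z \<in> Gr (ground (tl F))" by (rule gr) (auto simp: xr)
      ultimately show ?thesis
        using True cochain_free_ext[OF assms] by (simp add: coface_def free_ext_free_map)
    qed
    have iN: "coface n (Suc n) \<alpha> F z = free_ext (\<lambda>g. coef \<alpha> (butlast F) (induced (ground (butlast F)) g)) z"
    proof -
      obtain G x where Gx: "F = G @ [x]" using F2 by blast
      have "ground F - last F = ground (butlast F)" using F(2) by (auto simp: Gx disj_append)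
      moreover have "butlast F \<in> decomps n" using F by (auto simp: Gx decomps_iff disj_append)
      moreover have "Gr_restrict (ground (butlast F)) z \<in> Gr (ground (butlast F))" by (rule gr) (auto simp: Gx)
      ultimately show ?thesis
        using True cochain_free_ext[OF assms] by (simp add: coface_def free_ext_free_map)
    qed
    have ii: "coface n (Suc i) \<alpha> F z = free_ext (\<lambda>g. coef \<alpha> (take i F @ (F ! i \<union> F ! Suc i) # drop (i + 2) F) g) z"
      if "i < n" for i
    proof -
      let ?F = "take i F @ (F ! i \<union> F ! Suc i) # drop (i + 2) F"
      have Fi: "F = take i F @ F ! i # F ! Suc i # drop (i + 2) F"
        using that F(1) by (simp add: Cons_nth_drop_Suc)
      have d: "disj (take i F @ F ! i # F ! Suc i # drop (i + 2) F)"
        "finite (ground (take i F @ F ! i # F ! Suc i # drop (i + 2) F))"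
        using F(2,3) Fi by simp_all
      have u: "ground ?F = ground F"
        by (subst (5) Fi) auto
      have "length ?F = n" using that F(1) by simp
      moreover have "disj ?F" using d(1) by (auto simp: disj_append)
      ultimately have "?F \<in> decomps n" using u F(3) by (simp add: decomps_iff)
      then show ?thesis
        using True that cochain_free_ext[OF assms, of ?F z] z u by (simp add: coface_def)
    qed
    have "coboundary n \<alpha> F z = coface n 0 \<alpha> F z + (\<Sum>i<n. (-1) ^ Suc i * coface n (Suc i) \<alpha> F z)
        + (-1) ^ Suc n * coface n (Suc n) \<alpha> F z"
    proof -
      have "(\<Sum>i\<le>Suc n. (-1) ^ i * coface n i \<alpha> F z)
          = (\<Sum>i<Suc n. (-1) ^ i * coface n i \<alpha> F z) + (-1) ^ Suc n * coface n (Suc n) \<alpha> F z"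
        by (simp add: lessThan_Suc_atMost)
      then show ?thesis unfolding coboundary_def sum.lessThan_Suc_shift by simp
    qed
    also have "(\<Sum>i<n. (-1) ^ Suc i * coface n (Suc i) \<alpha> F z)
        = - free_ext (\<lambda>g. mid (\<lambda>l. coef \<alpha> l g) F) z"
      unfolding mid_eq_sum free_ext_fun_sum free_ext_fun_scale using F(1)
      by (simp add: ii sum_negf)
    finally have 1: "coboundary n \<alpha> F z = free_ext (\<lambda>g. coef \<alpha> (tl F) (induced (ground (tl F)) g)) z
        - free_ext (\<lambda>g. mid (\<lambda>l. coef \<alpha> l g) F) z
        + (-1) ^ length F * free_ext (\<lambda>g. coef \<alpha> (butlast F) (induced (ground (butlast F)) g)) z"
      unfolding i0 iN F(1) by simp
    have "free_ext (cob (coef \<alpha>) F) z = free_ext (\<lambda>g. (coef \<alpha> (tl F) (induced (ground (tl F)) g)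
        + (-1) * mid (\<lambda>l. coef \<alpha> l g) F)
        + (-1) ^ length F * coef \<alpha> (butlast F) (induced (ground (butlast F)) g)) z"
      using ne by (intro free_ext_cong) (simp add: cob_def)
    then show ?thesis
      unfolding free_ext_fun_add free_ext_fun_scale using True 1 by (simp add: cochain_of_def)
  qed
qed

lemma coboundary_in_cochains: "\<alpha> \<in> cochains n \<Longrightarrow> coboundary n \<alpha> \<in> cochains (Suc n)"
  unfolding coboundary_eq by (intro cochain_of_in_cochains cob_natural coef_natural)

lemma coef_coboundary:
  "\<alpha> \<in> cochains n \<Longrightarrow> (F, g) \<in> cdom (Suc n) \<Longrightarrow> coef (coboundary n \<alpha>) F g = cob (coef \<alpha>) F g"
  by (simp add: coboundary_eq coef_cochain_of)

lemma zero_in_cochains: "0 \<in> cochains n"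
  by (simp add: cochains_def)

lemma coef_zero: "coef 0 F g = 0"
  by (simp add: coef_def)

lemma coboundary_coboundary:
  assumes "\<alpha> \<in> cochains n"
  shows "coboundary (Suc n) (coboundary n \<alpha>) = 0"
proof (rule cochain_eqI[OF _ zero_in_cochains])
  show "coboundary (Suc n) (coboundary n \<alpha>) \<in> cochains (Suc (Suc n))"
    by (intro coboundary_in_cochains assms)
  fix F :: "'a set list" and g assume F: "(F, g) \<in> cdom (Suc (Suc n))"
  have "coef (coboundary (Suc n) (coboundary n \<alpha>)) F g = cob (coef (coboundary n \<alpha>)) F g"
    using F by (intro coef_coboundary coboundary_in_cochains assms)
  also have "\<dots> = cob (cob (coef \<alpha>)) F g"
    by (rule cob_cong[OF coef_coboundary[OF assms] F])
  finally show "coef (coboundary (Suc n) (coboundary n \<alpha>)) F g = coef 0 F g"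
    using cob_cob[OF F] by (simp add: coef_zero)
qed

text \<open>
  The functional that detects cohomology classes in the degree equal to the number of vertices.
\<close>

definition test :: "'v list \<Rightarrow> 'v set set \<Rightarrow> ('v, 'k::field) cochain \<Rightarrow> 'k" where
  "test vs g \<alpha> = alt vs (\<lambda>F. moebius (coef \<alpha>) F g)"

lemma test_coboundary:
  assumes "\<gamma> \<in> cochains n" "length vs = Suc n" "distinct vs" "g \<in> graphs (set vs)"
  shows "test vs g (coboundary n \<gamma>) = 0"
proof -
  have "test vs g (coboundary n \<gamma>) = alt vs (red_cob (\<lambda>l. moebius (coef \<gamma>) l g))"
    unfolding test_def
  proof (rule alt_cong[OF assms(3)])
    fix F assume "F \<in> decs (length vs) (set vs)"
    then have F: "(F, g) \<in> cdom (Suc n)" using assms by (intro decs_cdom[of _ _ "set vs"]) auto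
    have "moebius (coef (coboundary n \<gamma>)) F g = moebius (cob (coef \<gamma>)) F g"
      by (rule wsum_cong[OF coef_coboundary[OF assms(1)] F])
    then show "moebius (coef (coboundary n \<gamma>)) F g = red_cob (\<lambda>l. moebius (coef \<gamma>) l g) F"
      by (simp only: moebius_cob[OF F])
  qed
  then show ?thesis by (simp add: alt_red_cob)
qed

theorem cocycle_exact:
  fixes \<alpha> :: "('v, 'k::field_char_0) cochain" and S :: "nat \<Rightarrow> 'v set"
  assumes \<alpha>: "\<alpha> \<in> cocycles (Suc n)"
    and S: "\<And>m. finite (S m)" "\<And>m. card (S m) = m"
    and test: "\<And>g. g \<in> graphs (S (Suc n)) \<Longrightarrow> \<exists>vs. distinct vs \<and> set vs = S (Suc n) \<and> test vs g \<alpha> = 0"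
  shows "\<exists>\<gamma>\<in>cochains n. coboundary n \<gamma> = \<alpha>"
proof -
  have c: "\<alpha> \<in> cochains (Suc n)" and z: "coboundary (Suc n) \<alpha> = 0"
    using \<alpha> by (auto simp: cocycles_def)
  have "\<exists>c. (\<forall>m. natural m c) \<and> (\<forall>F g. (F, g) \<in> cdom (Suc n) \<longrightarrow> cob c F g = coef \<alpha> F g)"
  proof (rule detection[OF coef_natural[OF c] _ S])
    show "cob (coef \<alpha>) F g = 0" if "(F, g) \<in> cdom (Suc (Suc n))" for F g
      using coef_coboundary[OF c that] z by (simp add: coef_zero)
  qed (use test in \<open>auto simp: test_def\<close>)
  then obtain c where c': "\<And>m. natural m c" "\<And>F g. (F, g) \<in> cdom (Suc n) \<Longrightarrow> cob c F g = coef \<alpha> F g"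
    by blast
  let ?\<gamma> = "cochain_of n c"
  have \<gamma>: "?\<gamma> \<in> cochains n" by (rule cochain_of_in_cochains[OF c'(1)])
  have "coboundary n ?\<gamma> = \<alpha>"
  proof (rule cochain_eqI[OF coboundary_in_cochains[OF \<gamma>] c])
    fix F :: "'v set list" and g assume F: "(F, g) \<in> cdom (Suc n)"
    have "coef (coboundary n ?\<gamma>) F g = cob (coef ?\<gamma>) F g" by (rule coef_coboundary[OF \<gamma> F])
    also have "\<dots> = cob c F g" by (rule cob_cong[OF coef_cochain_of F])
    finally show "coef (coboundary n ?\<gamma>) F g = coef \<alpha> F g" using c'(2)[OF F] by simp
  qed
  with \<gamma> show ?thesis by blast
qed

section \<open>The cup product and the Leibniz rule\<close>

definition sc :: "'k::field \<Rightarrow> ('v, 'k) cochain \<Rightarrow> ('v, 'k) cochain" where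
  "sc c \<alpha> = (\<lambda>F z. c * \<alpha> F z)"

lemma coef_add: "coef (\<alpha> + \<beta>) F g = coef \<alpha> F g + coef \<beta> F g"
  by (simp add: coef_def)

lemma coef_sc: "coef (sc c \<alpha>) F g = c * coef \<alpha> F g"
  by (simp add: coef_def sc_def)

lemma cochain_of_add: "cochain_of n (\<lambda>F g. a F g + b F g) = cochain_of n a + cochain_of n b"
  by (intro ext) (simp add: cochain_of_def free_ext_fun_add)

lemma cochain_of_sc: "cochain_of n (\<lambda>F g. c * a F g) = sc c (cochain_of n a)"
  by (intro ext) (simp add: cochain_of_def free_ext_fun_scale sc_def)

lemma add_in_cochains:
  assumes "\<alpha> \<in> cochains n" "\<beta> \<in> cochains n"
  shows "\<alpha> + \<beta> \<in> cochains n"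
proof -
  have "natural n (\<lambda>F g. coef \<alpha> F g + coef \<beta> F g)"
    using assms[THEN coef_natural] by (simp add: natural_def)
  from cochain_of_in_cochains[OF this] show ?thesis
    using assms by (simp add: cochain_of_add cochain_of_coef)
qed

lemma sc_in_cochains:
  assumes "\<alpha> \<in> cochains n"
  shows "sc c \<alpha> \<in> cochains n"
proof -
  have "natural n (\<lambda>F g. c * coef \<alpha> F g)"
    using assms[THEN coef_natural] by (simp add: natural_def)
  from cochain_of_in_cochains[OF this] show ?thesis
    using assms by (simp add: cochain_of_sc cochain_of_coef)
qed

lemma sc_simps: "sc 0 \<alpha> = 0" "sc 1 \<alpha> = \<alpha>" "sc c 0 = 0" "sc (-1) \<alpha> = - \<alpha>" "sc c (sc d \<alpha>) = sc (c * d) \<alpha>"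
  "sc c (\<alpha> + \<beta>) = sc c \<alpha> + sc c \<beta>" "sc (c + d) \<alpha> = sc c \<alpha> + sc d \<alpha>"
  by (auto simp: sc_def fun_eq_iff algebra_simps)

lemma sum_in_cochains: "(\<And>i. i \<in> A \<Longrightarrow> f i \<in> cochains n) \<Longrightarrow> sum f A \<in> cochains n"
  by (induction A rule: infinite_finite_induct) (auto simp: zero_in_cochains add_in_cochains)

lemma coface_add: "coface n i (\<alpha> + \<beta>) F z = coface n i \<alpha> F z + coface n i \<beta> F z"
  by (simp add: coface_def)

lemma coface_sc: "coface n i (sc c \<alpha>) F z = c * coface n i \<alpha> F z"
  by (simp add: coface_def sc_def)

lemma coboundary_add: "coboundary n (\<alpha> + \<beta>) = coboundary n \<alpha> + coboundary n \<beta>"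
  by (intro ext) (simp add: coboundary_def coface_add algebra_simps sum.distrib del: sum.atMost_Suc)

lemma coboundary_sc: "coboundary n (sc c \<alpha>) = sc c (coboundary n \<alpha>)"
  by (intro ext, simp only: coboundary_def coface_sc)
    (simp add: sc_def coboundary_def sum_distrib_left mult.left_commute del: sum.atMost_Suc)

lemma coboundary_0: "coboundary n 0 = 0"
  using coboundary_sc[of n 0 0] by (simp add: sc_simps)

lemma coboundary_sum: "coboundary n (sum f A) = (\<Sum>i\<in>A. coboundary n (f i))"
  by (induction A rule: infinite_finite_induct) (simp_all only: sum.infinite sum.empty sum.insert coboundary_0 coboundary_add not_False_eq_True)

definition cupc :: "nat \<Rightarrow> ('v, 'k::field) coeff \<Rightarrow> ('v, 'k) coeff \<Rightarrow> ('v, 'k) coeff" where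
  "cupc p a b F g = a (take p F) (induced (ground (take p F)) g) * b (drop p F) (induced (ground (drop p F)) g)"

lemma cup_eq: "cup p q \<alpha> \<beta> = cochain_of (p + q) (cupc p (coef \<alpha>) (coef \<beta>))"
  by (simp add: cup_def cupc_def[abs_def] coef_def)

lemma cdom_append:
  assumes "(xs @ ys, g) \<in> cdom n"
  shows "(xs, induced (ground xs) g) \<in> cdom (length xs)" "(ys, induced (ground ys) g) \<in> cdom (length ys)"
  using assms by (auto simp: cdom_def disj_append intro: induced_graphs')

lemma cdom_take_drop:
  assumes "(F, g) \<in> cdom (p + q)"
  shows "(take p F, induced (ground (take p F)) g) \<in> cdom p" "(drop p F, induced (ground (drop p F)) g) \<in> cdom q"
proof -
  have "length F = p + q" using assms by (simp add: cdom_def)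
  then show "(take p F, induced (ground (take p F)) g) \<in> cdom p" "(drop p F, induced (ground (drop p F)) g) \<in> cdom q"
    using cdom_append[of "take p F" "drop p F" g "p + q"] assms by simp_all
qed

lemma Union_take_drop_subset: "ground (take p F) \<subseteq> ground F" "ground (drop p F) \<subseteq> ground F"
  by (auto dest: in_set_takeD in_set_dropD)

lemma cupc_natural:
  assumes "natural p a" "natural q b"
  shows "natural (p + q) (cupc p a b)"
  unfolding natural_def
proof (intro allI impI)
  fix F :: "'a set list" and g and \<sigma> :: "'a \<Rightarrow> 'a"
  assume F: "(F, g) \<in> cdom (p + q)" and inj: "inj_on \<sigma> (ground F)"
  have *: "induced (ground (map ((`) \<sigma>) G)) (relabel \<sigma> g) = relabel \<sigma> (induced (ground G) g)"
    if "ground G \<subseteq> ground F" for G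
    unfolding Union_map_image using F inj that
    by (intro induced_relabel[of _ "ground F"]) (auto simp: cdom_def)
  have "a (map ((`) \<sigma>) (take p F)) (relabel \<sigma> (induced (ground (take p F)) g)) = a (take p F) (induced (ground (take p F)) g)"
    by (rule naturalD[OF assms(1) cdom_take_drop(1)[OF F] inj_on_subset[OF inj Union_take_drop_subset(1)]])
  moreover have "b (map ((`) \<sigma>) (drop p F)) (relabel \<sigma> (induced (ground (drop p F)) g)) = b (drop p F) (induced (ground (drop p F)) g)"
    by (rule naturalD[OF assms(2) cdom_take_drop(2)[OF F] inj_on_subset[OF inj Union_take_drop_subset(2)]])
  ultimately show "cupc p a b (map ((`) \<sigma>) F) (relabel \<sigma> g) = cupc p a b F g"
    unfolding cupc_def take_map drop_map *[OF Union_take_drop_subset(1)] *[OF Union_take_drop_subset(2)] by simp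
qed

lemma cup_in_cochains: "\<alpha> \<in> cochains p \<Longrightarrow> \<beta> \<in> cochains q \<Longrightarrow> cup p q \<alpha> \<beta> \<in> cochains (p + q)"
  unfolding cup_eq by (intro cochain_of_in_cochains cupc_natural coef_natural)

lemma coef_cup: "(F, g) \<in> cdom (p + q) \<Longrightarrow> coef (cup p q \<alpha> \<beta>) F g = cupc p (coef \<alpha>) (coef \<beta>) F g"
  unfolding cup_eq by (rule coef_cochain_of)

lemma cup_add_left: "cup p q (\<alpha> + \<alpha>') \<beta> = cup p q \<alpha> \<beta> + cup p q \<alpha>' \<beta>"
  unfolding cup_eq cochain_of_add[symmetric] by (rule cochain_of_cong) (simp add: cupc_def coef_add algebra_simps)

lemma cup_add_right: "cup p q \<alpha> (\<beta> + \<beta>') = cup p q \<alpha> \<beta> + cup p q \<alpha> \<beta>'"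
  unfolding cup_eq cochain_of_add[symmetric] by (rule cochain_of_cong) (simp add: cupc_def coef_add algebra_simps)

lemma cup_sc_left: "cup p q (sc c \<alpha>) \<beta> = sc c (cup p q \<alpha> \<beta>)"
  unfolding cup_eq cochain_of_sc[symmetric] by (rule cochain_of_cong) (simp add: cupc_def coef_sc algebra_simps)

lemma cup_sc_right: "cup p q \<alpha> (sc c \<beta>) = sc c (cup p q \<alpha> \<beta>)"
  unfolding cup_eq cochain_of_sc[symmetric] by (rule cochain_of_cong) (simp add: cupc_def coef_sc algebra_simps)

lemma cup_0: "cup p q 0 \<beta> = 0" "cup p q \<alpha> 0 = 0"
  using cup_sc_left[of p q 0 0 \<beta>] cup_sc_right[of p q \<alpha> 0 0] by (simp_all add: sc_simps)

lemma cup_sum_left: "cup p q (sum f A) \<beta> = (\<Sum>i\<in>A. cup p q (f i) \<beta>)"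
  by (induction A rule: infinite_finite_induct) (simp_all only: sum.infinite sum.empty sum.insert cup_0 cup_add_left not_False_eq_True)

lemma cup_sum_right: "cup p q \<alpha> (sum f A) = (\<Sum>i\<in>A. cup p q \<alpha> (f i))"
  by (induction A rule: infinite_finite_induct) (simp_all only: sum.infinite sum.empty sum.insert cup_0 cup_add_right not_False_eq_True)

lemma cup_assoc: "cup (p + q) r (cup p q \<alpha> \<beta>) \<gamma> = cup p (q + r) \<alpha> (cup q r \<beta> \<gamma>)"
proof -
  have "cupc (p + q) (coef (cup p q \<alpha> \<beta>)) (coef \<gamma>) F g = cupc p (coef \<alpha>) (coef (cup q r \<beta> \<gamma>)) F g"
    if F: "(F, g) \<in> cdom (p + q + r)" for F g
  proof -
    have F': "(F, g) \<in> cdom (p + (q + r))" using F by (simp add: add.assoc)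
    have s1: "ground (take p F) \<subseteq> ground (take (p + q) F)"
      using Union_take_drop_subset(1)[of p "take (p + q) F"] by (simp add: min_def)
    have s2: "ground (take q (drop p F)) \<subseteq> ground (take (p + q) F)"
      using Union_take_drop_subset(2)[of p "take (p + q) F"] by (simp add: drop_take)
    have s3: "ground (take q (drop p F)) \<subseteq> ground (drop p F)"
      by (rule Union_take_drop_subset)
    have s4: "ground (drop (p + q) F) \<subseteq> ground (drop p F)"
      using Union_take_drop_subset(2)[of q "drop p F"] by (simp add: add.commute)
    show ?thesis
      unfolding cupc_def[of "p + q"] cupc_def[of p "coef \<alpha>" "coef (cup q r \<beta> \<gamma>)"]
        coef_cup[OF cdom_take_drop(1)[OF F]] coef_cup[OF cdom_take_drop(2)[OF F']]
      unfolding cupc_def using s1 s2 s3 s4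
      by (simp add: drop_take induced_induced mult.assoc min_def add.commute)
  qed
  then show ?thesis unfolding cup_eq[of "p + q"] cup_eq[of p "q + r"] add.assoc[symmetric]
    by (rule cochain_of_cong)
qed

lemma unit_natural: "natural 0 (\<lambda>F g. 1)"
  by (simp add: natural_def)

lemma cup_unit_in_cochains: "cup_unit \<in> cochains 0"
  unfolding cup_unit_def by (rule cochain_of_in_cochains[OF unit_natural])

lemma induced_empty: "g \<in> graphs I \<Longrightarrow> induced {} g = {}"
  by (auto simp: induced_def graphs_def)

lemma cdom_Nil: "([], {}) \<in> cdom 0"
  by (auto simp: cdom_def graphs_def)

lemma cup_unit_left:
  assumes "\<beta> \<in> cochains n"
  shows "cup 0 n cup_unit \<beta> = \<beta>"
proof -
  have "cup 0 n cup_unit \<beta> = cochain_of n (coef \<beta>)"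
    unfolding cup_eq add_0 by (rule cochain_of_cong)
      (auto simp: cupc_def cup_unit_def coef_cochain_of[OF cdom_Nil] cdom_def induced_id induced_empty)
  then show ?thesis using assms by (simp add: cochain_of_coef)
qed

lemma cup_unit_right:
  assumes "\<beta> \<in> cochains n"
  shows "cup n 0 \<beta> cup_unit = \<beta>"
proof -
  have "cup n 0 \<beta> cup_unit = cochain_of n (coef \<beta>)"
    unfolding cup_eq add_0_right by (rule cochain_of_cong)
      (auto simp: cupc_def cup_unit_def coef_cochain_of[OF cdom_Nil] cdom_def induced_id induced_empty)
  then show ?thesis using assms by (simp add: cochain_of_coef)
qed

text \<open>
  A merger in a list with a distinguished entry \<open>z\<close> takes place either up to \<open>z\<close> or from \<open>z\<close> on. In the
  Leibniz rule, \<open>z\<close> is the block that the first factor receives in one term and the second factor in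
  the other.
\<close>

lemma mid_append:
  "mid \<phi> (xs @ z # ys) = mid (\<lambda>l. \<phi> (l @ ys)) (xs @ [z]) + (-1) ^ length xs * mid (\<lambda>l. \<phi> (xs @ l)) (z # ys)"
proof (induction xs arbitrary: \<phi>)
  case (Cons x xs)
  show ?case
  proof (cases xs)
    case Nil
    then show ?thesis by simp
  next
    case (Cons x' xs')
    then show ?thesis using Cons.IH[of "\<lambda>l. \<phi> (x # l)"] by (simp add: algebra_simps)
  qed
qed auto

lemma cob_cupc:
  assumes "length xs = p" "length ys = q"
  shows "cob (cupc p a b) (xs @ z # ys) g
    = cob a (xs @ [z]) (induced (ground (xs @ [z])) g) * b ys (induced (ground ys) g)
    + (-1) ^ p * (a xs (induced (ground xs) g) * cob b (z # ys) (induced (ground (z # ys)) g))"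
proof -
  let ?A = "a xs (induced (ground xs) g)" and ?B = "b ys (induced (ground ys) g)"
  let ?U = "induced (ground (xs @ [z])) g" and ?V = "induced (ground (z # ys)) g"
  have t: "tl (xs @ z # ys) = tl (xs @ [z]) @ ys" "length (tl (xs @ [z])) = p"
    using assms by (cases xs; simp)+
  have b: "butlast (xs @ z # ys) = xs @ butlast (z # ys)"
    by (simp add: butlast_append)
  have st: "ground (tl (xs @ [z])) \<subseteq> ground (xs @ [z])"
    by (cases xs) auto
  have sb: "ground (butlast (z # ys)) \<subseteq> ground (z # ys)"
    by (auto dest: in_set_butlastD split: if_splits)
  have 1: "cupc p a b (tl (xs @ z # ys)) (induced (ground (tl (xs @ z # ys))) g)
      = a (tl (xs @ [z])) (induced (ground (tl (xs @ [z]))) ?U) * ?B"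
    using t(2) st unfolding t(1) by (simp add: cupc_def induced_induced)
  have 2: "cupc p a b (butlast (xs @ z # ys)) (induced (ground (butlast (xs @ z # ys))) g)
      = ?A * b (butlast (z # ys)) (induced (ground (butlast (z # ys))) ?V)"
    using assms(1) sb unfolding b by (simp add: cupc_def induced_induced)
  have "mid (\<lambda>l. cupc p a b (l @ ys) g) (xs @ [z]) = mid (\<lambda>l. ?B * a l ?U) (xs @ [z])"
    by (rule mid_cong) (use assms in \<open>simp add: cupc_def\<close>)
  then have 3: "mid (\<lambda>l. cupc p a b (l @ ys) g) (xs @ [z]) = mid (\<lambda>l. a l ?U) (xs @ [z]) * ?B"
    by (simp add: mid_scale)
  have "mid (\<lambda>l. cupc p a b (xs @ l) g) (z # ys) = mid (\<lambda>l. ?A * b l ?V) (z # ys)"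
    by (rule mid_cong) (use assms in \<open>simp add: cupc_def\<close>)
  then have 4: "mid (\<lambda>l. cupc p a b (xs @ l) g) (z # ys) = ?A * mid (\<lambda>l. b l ?V) (z # ys)"
    by (simp add: mid_scale)
  have 5: "induced (ground xs) ?U = induced (ground xs) g" "induced (ground ys) ?V = induced (ground ys) g"
    by (auto intro!: induced_induced)
  have ne: "(xs @ z # ys = []) = False" and len: "length (xs @ z # ys) = p + q + 1"
    and ne1: "(xs @ [z] = []) = False" and len1: "length (xs @ [z]) = p + 1"
    and len2: "length (z # ys) = q + 1"
    using assms by simp_all
  have L: "cob (cupc p a b) (xs @ z # ys) g = a (tl (xs @ [z])) (induced (ground (tl (xs @ [z]))) ?U) * ?B
     - (mid (\<lambda>l. a l ?U) (xs @ [z]) * ?B + (-1) ^ p * (?A * mid (\<lambda>l. b l ?V) (z # ys)))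
     + (-1) ^ (p + q + 1) * (?A * b (butlast (z # ys)) (induced (ground (butlast (z # ys))) ?V))"
    unfolding cob_def 1 2 mid_append[of "\<lambda>l. cupc p a b l g" xs z ys] 3 4 len assms(1) by (simp only: ne if_False)
  have R1: "cob a (xs @ [z]) ?U = a (tl (xs @ [z])) (induced (ground (tl (xs @ [z]))) ?U)
     - mid (\<lambda>l. a l ?U) (xs @ [z]) + (-1) ^ (p + 1) * ?A"
    unfolding cob_def butlast_snoc 5 len1 by (simp only: ne1 if_False)
  have R2: "cob b (z # ys) ?V = ?B - mid (\<lambda>l. b l ?V) (z # ys)
     + (-1) ^ (q + 1) * b (butlast (z # ys)) (induced (ground (butlast (z # ys))) ?V)"
    unfolding cob_def list.sel 5 len2 by (simp only: list.distinct if_False)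
  show ?thesis
    unfolding L R1 R2 by (simp only: algebra_simps power_add power_one_right) simp
qed

text \<open>
  The last coface of the first factor and the first coface of the second factor both delete the block
  between them; these two terms cancel and all others match.
\<close>

lemma Leibniz:
  assumes \<alpha>: "\<alpha> \<in> cochains p" and \<beta>: "\<beta> \<in> cochains q"
  shows "coboundary (p + q) (cup p q \<alpha> \<beta>)
    = cup (Suc p) q (coboundary p \<alpha>) \<beta> + sc ((-1) ^ p) (cup p (Suc q) \<alpha> (coboundary q \<beta>))"
    (is "_ = ?R")
proof (rule cochain_eqI[of _ "Suc (p + q)"])
  show "coboundary (p + q) (cup p q \<alpha> \<beta>) \<in> cochains (Suc (p + q))"
    by (intro coboundary_in_cochains cup_in_cochains assms)
  have "cup (Suc p) q (coboundary p \<alpha>) \<beta> \<in> cochains (Suc p + q)"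
    by (intro coboundary_in_cochains cup_in_cochains assms)
  moreover have "cup p (Suc q) \<alpha> (coboundary q \<beta>) \<in> cochains (p + Suc q)"
    by (intro coboundary_in_cochains cup_in_cochains assms)
  ultimately show "?R \<in> cochains (Suc (p + q))"
    by (simp add: add_in_cochains sc_in_cochains)
  fix F :: "'a set list" and g assume F: "(F, g) \<in> cdom (Suc (p + q))"
  have F1: "(F, g) \<in> cdom (Suc p + q)" and F2: "(F, g) \<in> cdom (p + Suc q)" using F by simp_all
  have lF: "length F = Suc (p + q)" using F by (simp add: cdom_def)
  obtain xs z ys where xyz: "F = xs @ z # ys" "length xs = p" "length ys = q"
  proof
    show "F = take p F @ F ! p # drop (Suc p) F" using lF by (intro id_take_nth_drop) auto
  qed (use lF in auto)
  have "coef (coboundary (p + q) (cup p q \<alpha> \<beta>)) F g = cob (coef (cup p q \<alpha> \<beta>)) F g"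
    by (intro coef_coboundary cup_in_cochains assms F)
  also have "\<dots> = cob (cupc p (coef \<alpha>) (coef \<beta>)) F g"
    by (rule cob_cong[OF coef_cup F])
  also have "\<dots> = cob (coef \<alpha>) (xs @ [z]) (induced (ground (xs @ [z])) g) * coef \<beta> ys (induced (ground ys) g)
    + (-1) ^ p * (coef \<alpha> xs (induced (ground xs) g) * cob (coef \<beta>) (z # ys) (induced (ground (z # ys)) g))"
    unfolding xyz(1) by (rule cob_cupc[OF xyz(2,3)])
  also have "\<dots> = cupc (Suc p) (coef (coboundary p \<alpha>)) (coef \<beta>) F g + (-1) ^ p * cupc p (coef \<alpha>) (coef (coboundary q \<beta>)) F g"
  proof -
    have tk: "take (Suc p) F = xs @ [z]" "drop (Suc p) F = ys" "take p F = xs" "drop p F = z # ys"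
      using xyz by auto
    have "coef (coboundary p \<alpha>) (xs @ [z]) (induced (ground (xs @ [z])) g) = cob (coef \<alpha>) (xs @ [z]) (induced (ground (xs @ [z])) g)"
      using cdom_take_drop(1)[OF F1] unfolding tk by (rule coef_coboundary[OF \<alpha>])
    moreover have "coef (coboundary q \<beta>) (z # ys) (induced (ground (z # ys)) g) = cob (coef \<beta>) (z # ys) (induced (ground (z # ys)) g)"
      using cdom_take_drop(2)[OF F2] unfolding tk by (rule coef_coboundary[OF \<beta>])
    ultimately show ?thesis unfolding cupc_def tk by (simp only:)
  qed
  also have "\<dots> = coef ?R F g"
    unfolding coef_add coef_sc coef_cup[OF F1] coef_cup[OF F2] ..
  finally show "coef (coboundary (p + q) (cup p q \<alpha> \<beta>)) F g = coef ?R F g" .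
qed

section \<open>The ring of cocycles and its ideal of coboundaries\<close>

definition seq_cup :: "(nat \<Rightarrow> ('v, 'k::field) cochain) \<Rightarrow> (nat \<Rightarrow> ('v, 'k) cochain) \<Rightarrow> nat \<Rightarrow> ('v, 'k) cochain" where
  "seq_cup a b n = (\<Sum>p\<le>n. cup p (n - p) (a p) (b (n - p)))"

lemma CA_simps:
  "carrier cochain_algebra = {a. (\<forall>n. a n \<in> cochains n) \<and> finite {n. a n \<noteq> 0}}"
  "mult cochain_algebra = seq_cup"
  "one cochain_algebra = homogeneous 0 cup_unit"
  "zero cochain_algebra = 0"
  "add cochain_algebra = (+)"
  by (simp_all add: cochain_algebra_def seq_cup_def[abs_def])

lemma CA_carrierI:
  "(\<And>n. a n \<in> cochains n) \<Longrightarrow> finite {n. a n \<noteq> 0} \<Longrightarrow> a \<in> carrier cochain_algebra"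
  by (simp add: CA_simps)

lemma CA_carrierD:
  assumes "a \<in> carrier cochain_algebra"
  shows "a n \<in> cochains n" "finite {n. a n \<noteq> 0}"
  using assms by (simp_all add: CA_simps)

lemma CA_add:
  assumes "a \<in> carrier cochain_algebra" "b \<in> carrier cochain_algebra"
  shows "a + b \<in> carrier cochain_algebra"
proof (rule CA_carrierI)
  show "(a + b) n \<in> cochains n" for n
    using add_in_cochains[OF CA_carrierD(1)[OF assms(1)] CA_carrierD(1)[OF assms(2)]] by simp
  have "{n. (a + b) n \<noteq> 0} \<subseteq> {n. a n \<noteq> 0} \<union> {n. b n \<noteq> 0}"
  proof
    fix n assume "n \<in> {n. (a + b) n \<noteq> 0}"
    then have "a n + b n \<noteq> 0" by (simp only: mem_Collect_eq plus_fun_apply) simp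
    then have "a n \<noteq> 0 \<or> b n \<noteq> 0" by (cases "a n = 0") (simp_all only: add_0 simp_thms)
    then show "n \<in> {n. a n \<noteq> 0} \<union> {n. b n \<noteq> 0}" by blast
  qed
  then show "finite {n. (a + b) n \<noteq> 0}"
    by (rule finite_subset) (use CA_carrierD(2)[OF assms(1)] CA_carrierD(2)[OF assms(2)] in blast)
qed

lemma CA_map:
  assumes "a \<in> carrier cochain_algebra" "\<And>n \<alpha>. \<alpha> \<in> cochains n \<Longrightarrow> f n \<alpha> \<in> cochains n" "\<And>n. f n 0 = 0"
  shows "(\<lambda>n. f n (a n)) \<in> carrier cochain_algebra"
proof (rule CA_carrierI)
  show "f n (a n) \<in> cochains n" for n using assms(2)[OF CA_carrierD(1)[OF assms(1)]] .
  have "{n. f n (a n) \<noteq> 0} \<subseteq> {n. a n \<noteq> 0}"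
  proof
    fix n assume "n \<in> {n. f n (a n) \<noteq> 0}"
    then have "f n (a n) \<noteq> 0" by (rule CollectD)
    then have "a n \<noteq> 0" using assms(3)[of n] by metis
    then show "n \<in> {n. a n \<noteq> 0}" by (rule CollectI)
  qed
  then show "finite {n. f n (a n) \<noteq> 0}"
    by (rule finite_subset) (rule CA_carrierD(2)[OF assms(1)])
qed

lemma scale_eq: "scale c a = (\<lambda>n. sc c (a n))"
  by (simp add: scale_def sc_def)

lemma CA_scale: "a \<in> carrier cochain_algebra \<Longrightarrow> scale c a \<in> carrier cochain_algebra"
  unfolding scale_eq by (rule CA_map) (simp_all only: sc_in_cochains sc_simps)

lemma CA_uminus: "a \<in> carrier cochain_algebra \<Longrightarrow> - a \<in> carrier cochain_algebra"
proof -
  assume "a \<in> carrier cochain_algebra"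
  then have "scale (-1) a \<in> carrier cochain_algebra" by (rule CA_scale)
  moreover have "scale (-1) a = - a" by (intro ext) (simp add: scale_def)
  ultimately show ?thesis by simp
qed

lemma CA_zero: "0 \<in> carrier cochain_algebra"
  by (rule CA_carrierI) (simp_all only: zero_fun_apply zero_in_cochains simp_thms Collect_empty_eq finite.emptyI empty_def[symmetric])

lemma homogeneous_simps: "homogeneous n \<alpha> n = \<alpha>" "m \<noteq> n \<Longrightarrow> homogeneous n \<alpha> m = 0"
  by (simp_all add: homogeneous_def)

lemma CA_homogeneous:
  assumes "\<alpha> \<in> cochains n"
  shows "homogeneous n \<alpha> \<in> carrier cochain_algebra"
proof (rule CA_carrierI)
  show "homogeneous n \<alpha> m \<in> cochains m" for m
    using assms zero_in_cochains by (cases "m = n") (simp_all only: homogeneous_simps not_False_eq_True)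
  have "{m. homogeneous n \<alpha> m \<noteq> 0} \<subseteq> {n}"
    using homogeneous_simps(2) by blast
  then show "finite {m. homogeneous n \<alpha> m \<noteq> 0}" by (rule finite_subset) simp
qed

lemma CA_seq_cup:
  assumes "a \<in> carrier cochain_algebra" "b \<in> carrier cochain_algebra"
  shows "seq_cup a b \<in> carrier cochain_algebra"
proof (rule CA_carrierI)
  fix n
  have "cup p (n - p) (a p) (b (n - p)) \<in> cochains n" if "p \<le> n" for p
    using cup_in_cochains[OF CA_carrierD(1)[OF assms(1), of p] CA_carrierD(1)[OF assms(2), of "n - p"]] that by simp
  then show "seq_cup a b n \<in> cochains n"
    unfolding seq_cup_def by (intro sum_in_cochains) simp
next
  have "{n. seq_cup a b n \<noteq> 0} \<subseteq> (\<lambda>(p, q). p + q) ` ({n. a n \<noteq> 0} \<times> {n. b n \<noteq> 0})"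
  proof
    fix n assume "n \<in> {n. seq_cup a b n \<noteq> 0}"
    then have "seq_cup a b n \<noteq> 0" by (rule CollectD)
    then obtain p where p: "p \<le> n" "cup p (n - p) (a p) (b (n - p)) \<noteq> 0"
      unfolding seq_cup_def by (metis (no_types, lifting) sum.neutral atMost_iff)
    then have "a p \<noteq> 0" "b (n - p) \<noteq> 0" using cup_0 by metis+
    then show "n \<in> (\<lambda>(p, q). p + q) ` ({n. a n \<noteq> 0} \<times> {n. b n \<noteq> 0})"
      using p(1) by (intro image_eqI[of _ _ "(p, n - p)"]) auto
  qed
  then show "finite {n. seq_cup a b n \<noteq> 0}"
    by (rule finite_subset)
      (intro finite_imageI finite_cartesian_product CA_carrierD(2)[OF assms(1)] CA_carrierD(2)[OF assms(2)])
qed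

lemma seq_cup_add_left: "seq_cup (a + a') b = seq_cup a b + seq_cup a' b"
  by (rule ext) (simp only: seq_cup_def plus_fun_apply cup_add_left sum.distrib)

lemma seq_cup_add_right: "seq_cup a (b + b') = seq_cup a b + seq_cup a b'"
  by (rule ext) (simp only: seq_cup_def plus_fun_apply cup_add_right sum.distrib)

lemma seq_cup_assoc: "seq_cup (seq_cup a b) c = seq_cup a (seq_cup b c)"
proof (rule ext)
  fix n
  let ?f = "\<lambda>i k m. cup (i + k) m (cup i k (a i) (b k)) (c m)"
  have "seq_cup (seq_cup a b) c n = (\<Sum>j\<le>n. \<Sum>i\<le>j. cup j (n - j) (cup i (j - i) (a i) (b (j - i))) (c (n - j)))"
    unfolding seq_cup_def cup_sum_left ..
  also have "\<dots> = (\<Sum>j=0..n. \<Sum>i=0..j. ?f i (j - i) (n - j))"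
    unfolding atLeast0AtMost by (intro sum.cong) auto
  also have "\<dots> = (\<Sum>j=0..n. \<Sum>i=0..n - j. ?f j i (n - j - i))"
    by (rule fps_mult_assoc_lemma)
  also have "\<dots> = (\<Sum>j\<le>n. \<Sum>i\<le>n - j. cup j (n - j) (a j) (cup i (n - j - i) (b i) (c (n - j - i))))"
    unfolding atLeast0AtMost cup_assoc by (intro sum.cong) auto
  also have "\<dots> = seq_cup a (seq_cup b c) n"
    unfolding seq_cup_def cup_sum_right ..
  finally show "seq_cup (seq_cup a b) c n = seq_cup a (seq_cup b c) n" .
qed

lemma seq_cup_unit_left:
  assumes "a \<in> carrier cochain_algebra"
  shows "seq_cup (homogeneous 0 cup_unit) a = a"
proof (rule ext)
  fix n
  have "seq_cup (homogeneous 0 cup_unit) a n = (\<Sum>p\<in>{0}. cup p (n - p) (homogeneous 0 cup_unit p) (a (n - p)))"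
    unfolding seq_cup_def by (rule sum.mono_neutral_right) (simp_all add: homogeneous_simps cup_0 del: zero_fun_apply)
  also have "\<dots> = a n"
    using cup_unit_left[OF CA_carrierD(1)[OF assms, of n]] by (simp add: homogeneous_simps)
  finally show "seq_cup (homogeneous 0 cup_unit) a n = a n" .
qed

lemma seq_cup_unit_right:
  assumes "a \<in> carrier cochain_algebra"
  shows "seq_cup a (homogeneous 0 cup_unit) = a"
proof (rule ext)
  fix n
  have "seq_cup a (homogeneous 0 cup_unit) n = (\<Sum>p\<in>{n}. cup p (n - p) (a p) (homogeneous 0 cup_unit (n - p)))"
    unfolding seq_cup_def by (rule sum.mono_neutral_right) (simp_all add: homogeneous_simps cup_0 del: zero_fun_apply)
  also have "\<dots> = a n"
    using cup_unit_right[OF CA_carrierD(1)[OF assms, of n]] by (simp add: homogeneous_simps)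
  finally show "seq_cup a (homogeneous 0 cup_unit) n = a n" .
qed

lemma ring_cochain_algebra: "ring (cochain_algebra :: ('k::field, nat \<Rightarrow> ('v, 'k) cochain) module)"
proof (rule ringI)
  show "abelian_group (cochain_algebra :: ('k, nat \<Rightarrow> ('v, 'k) cochain) module)"
  proof (rule abelian_groupI, goal_cases)
    case (4 x y)
    then show ?case unfolding CA_simps(5) by (intro add.commute)
  next
    case (6 x)
    then show ?case unfolding CA_simps(4,5) by (intro bexI[of _ "- x"] CA_uminus) simp_all
  qed (simp_all only: CA_simps(4,5) CA_add CA_zero add.assoc add_0)
  show "monoid (cochain_algebra :: ('k, nat \<Rightarrow> ('v, 'k) cochain) module)"
    by (rule monoidI)
      (simp_all only: CA_simps(2,3) CA_seq_cup CA_homogeneous cup_unit_in_cochains seq_cup_assoc seq_cup_unit_left seq_cup_unit_right)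
qed (simp_all only: CA_simps(2,5) seq_cup_add_left seq_cup_add_right)

lemma differential_simps:
  "differential a 0 = 0" "differential a (Suc m) = coboundary m (a m)"
  by (simp_all add: differential_def)

lemma differential_add: "differential (a + b) = differential a + differential b"
proof
  fix n show "differential (a + b) n = (differential a + differential b) n"
    by (cases n) (simp_all only: differential_simps plus_fun_apply coboundary_add add_0)
qed

lemma differential_scale: "differential (scale c a) = scale c (differential a)"
proof
  fix n show "differential (scale c a) n = scale c (differential a) n"
    by (cases n) (simp_all only: differential_simps scale_eq coboundary_sc sc_simps)
qed

lemma differential_carrier:
  assumes "a \<in> carrier cochain_algebra"
  shows "differential a \<in> carrier cochain_algebra"
proof (rule CA_carrierI)
  show "differential a n \<in> cochains n" for n
    by (cases n) (simp_all only: differential_simps zero_in_cochains coboundary_in_cochains CA_carrierD(1)[OF assms])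
  have "{n. differential a n \<noteq> 0} \<subseteq> Suc ` {n. a n \<noteq> 0}"
  proof
    fix n assume "n \<in> {n. differential a n \<noteq> 0}"
    then have n: "differential a n \<noteq> 0" by (rule CollectD)
    then obtain m where m: "n = Suc m" using differential_simps(1) by (cases n) auto
    then have "a m \<noteq> 0" using n coboundary_0 differential_simps(2) by metis
    then show "n \<in> Suc ` {n. a n \<noteq> 0}" using m by blast
  qed
  then show "finite {n. differential a n \<noteq> 0}"
    by (rule finite_subset) (intro finite_imageI CA_carrierD(2)[OF assms])
qed

lemma differential_differential:
  assumes "a \<in> carrier cochain_algebra"
  shows "differential (differential a) = 0"
proof
  fix n
  show "differential (differential a) n = 0 n"
  proof (cases n)
    case (Suc m)
    then show ?thesis
      by (cases m) (simp_all only: differential_simps coboundary_0 zero_fun_apply coboundary_coboundary[OF CA_carrierD(1)[OF assms]])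
  qed (simp only: differential_simps zero_fun_apply)
qed

text \<open>
  The Koszul sign of the Leibniz rule, applied to sequences of cochains of all degrees.
\<close>

definition sign_twist :: "(nat \<Rightarrow> ('v, 'k::field) cochain) \<Rightarrow> nat \<Rightarrow> ('v, 'k) cochain" where
  "sign_twist a = (\<lambda>p. sc ((-1) ^ p) (a p))"

lemma sign_twist_carrier: "a \<in> carrier cochain_algebra \<Longrightarrow> sign_twist a \<in> carrier cochain_algebra"
  unfolding sign_twist_def by (rule CA_map) (simp_all only: sc_in_cochains sc_simps)

lemma sign_twist_twist: "sign_twist (sign_twist a) = a"
  unfolding sign_twist_def by (rule ext) (simp add: sc_simps(5) sc_simps(2) flip: power_add mult_2)

lemma differential_sign_twist: "differential a = 0 \<Longrightarrow> differential (sign_twist a) = 0"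
proof
  fix n assume d: "differential a = 0"
  show "differential (sign_twist a) n = 0 n"
  proof (cases n)
    case (Suc m)
    have "coboundary m (a m) = 0" using fun_cong[OF d, of "Suc m"] by (simp only: differential_simps zero_fun_apply)
    then show ?thesis unfolding Suc differential_simps sign_twist_def coboundary_sc by (simp only: sc_simps zero_fun_apply)
  qed (simp only: differential_simps zero_fun_apply)
qed

lemma differential_seq_cup:
  assumes "a \<in> carrier cochain_algebra" "b \<in> carrier cochain_algebra"
  shows "differential (seq_cup a b) = seq_cup (differential a) b + seq_cup (sign_twist a) (differential b)"
proof
  fix n
  show "differential (seq_cup a b) n = (seq_cup (differential a) b + seq_cup (sign_twist a) (differential b)) n"
  proof (cases n)
    case 0
    then show ?thesis
      by (simp only: differential_simps plus_fun_apply seq_cup_def atMost_0 sum.insert finite.emptyI empty_iff not_False_eq_True sum.empty cup_0 add_0 diff_0_eq_0)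
  next
    case (Suc m)
    have "differential (seq_cup a b) n = (\<Sum>p\<le>m. coboundary m (cup p (m - p) (a p) (b (m - p))))"
      unfolding Suc differential_simps seq_cup_def coboundary_sum ..
    also have "\<dots> = (\<Sum>p\<le>m. cup (Suc p) (m - p) (coboundary p (a p)) (b (m - p))
        + cup p (Suc (m - p)) (sign_twist a p) (coboundary (m - p) (b (m - p))))"
    proof (rule sum.cong[OF refl])
      fix p assume "p \<in> {..m}"
      then show "coboundary m (cup p (m - p) (a p) (b (m - p))) = cup (Suc p) (m - p) (coboundary p (a p)) (b (m - p))
        + cup p (Suc (m - p)) (sign_twist a p) (coboundary (m - p) (b (m - p)))"
        using Leibniz[OF CA_carrierD(1)[OF assms(1), of p] CA_carrierD(1)[OF assms(2), of "m - p"]]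
        unfolding sign_twist_def cup_sc_left by (simp only: le_add_diff_inverse atMost_iff)
    qed
    also have "\<dots> = (\<Sum>p\<le>m. cup (Suc p) (m - p) (coboundary p (a p)) (b (m - p)))
        + (\<Sum>p\<le>m. cup p (Suc (m - p)) (sign_twist a p) (coboundary (m - p) (b (m - p))))"
      by (rule sum.distrib)
    also have "(\<Sum>p\<le>m. cup (Suc p) (m - p) (coboundary p (a p)) (b (m - p))) = seq_cup (differential a) b n"
      unfolding Suc seq_cup_def sum.atMost_Suc_shift by (simp only: differential_simps cup_0 add_0 diff_Suc_Suc)
    also have "(\<Sum>p\<le>m. cup p (Suc (m - p)) (sign_twist a p) (coboundary (m - p) (b (m - p))))
        = (\<Sum>p\<le>m. cup p (Suc m - p) (sign_twist a p) (differential b (Suc m - p)))"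
      by (rule sum.cong) (simp_all only: Suc_diff_le atMost_iff differential_simps)
    also have "\<dots> = seq_cup (sign_twist a) (differential b) n"
      unfolding Suc seq_cup_def sum.atMost_Suc by (simp only: differential_simps cup_0 add_0_right diff_self_eq_0)
    finally show ?thesis by (rule trans[OF _ plus_fun_apply[symmetric]])
  qed
qed

lemma ZA_simps:
  "carrier cocycle_algebra = {a \<in> carrier cochain_algebra. differential a = 0}"
  "mult cocycle_algebra = seq_cup"
  "one cocycle_algebra = homogeneous 0 cup_unit"
  "zero cocycle_algebra = 0"
  "add cocycle_algebra = (+)"
  by (simp_all add: cocycle_algebra_def CA_simps(2-5))

lemma differential_homogeneous:
  assumes "\<alpha> \<in> cochains n"
  shows "differential (homogeneous n \<alpha>) = homogeneous (Suc n) (coboundary n \<alpha>)"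
proof
  fix m
  show "differential (homogeneous n \<alpha>) m = homogeneous (Suc n) (coboundary n \<alpha>) m"
  proof (cases m)
    case 0
    then show ?thesis by (simp only: differential_simps homogeneous_simps nat.distinct not_False_eq_True)
  next
    case (Suc l)
    then show ?thesis
      by (cases "l = n") (simp_all only: differential_simps homogeneous_simps coboundary_0 nat.inject not_False_eq_True)
  qed
qed

lemma homogeneous_0: "homogeneous n 0 = 0"
  by (rule ext) (simp add: homogeneous_def)

lemma coboundary_unit: "coboundary 0 cup_unit = 0"
proof (rule cochain_eqI[OF coboundary_in_cochains[OF cup_unit_in_cochains] zero_in_cochains])
  fix F :: "'a set list" and g assume F: "(F, g) \<in> cdom (Suc 0)"
  then obtain x where x: "F = [x]" by (auto simp: cdom_def length_Suc_conv)
  have i: "induced {} g = {}" using F induced_empty by (auto simp: cdom_def)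
  show "coef (coboundary 0 cup_unit) F g = coef 0 F g"
    by (subst coef_coboundary[OF cup_unit_in_cochains F]) (simp add: x cob_def coef_zero i)
qed

lemma ZA_homogeneous:
  assumes "\<alpha> \<in> cocycles n"
  shows "homogeneous n \<alpha> \<in> carrier cocycle_algebra"
  using assms CA_homogeneous[of \<alpha> n] differential_homogeneous[of \<alpha> n]
  by (simp only: ZA_simps cocycles_def mem_Collect_eq homogeneous_0 simp_thms)

lemma unit_cocycle: "cup_unit \<in> cocycles 0"
  unfolding cocycles_def using cup_unit_in_cochains coboundary_unit by blast

lemma seq_cup_0: "seq_cup 0 b = 0" "seq_cup a 0 = 0"
  by (rule ext, simp only: seq_cup_def zero_fun_apply cup_0 sum.neutral_const)+

lemma ring_cocycle_algebra: "ring (cocycle_algebra :: ('k::field, nat \<Rightarrow> ('v, 'k) cochain) module)"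
proof -
  interpret C: ring "cochain_algebra :: ('k, nat \<Rightarrow> ('v, 'k) cochain) module"
    by (rule ring_cochain_algebra)
  have minus: "\<ominus>\<^bsub>cochain_algebra\<^esub> h = - h" if "h \<in> carrier cochain_algebra" for h :: "nat \<Rightarrow> ('v, 'k) cochain"
    by (rule C.minus_equality) (use that CA_uminus in \<open>simp_all only: CA_simps(4,5) left_minus\<close>)
  have "subring {a \<in> carrier cochain_algebra. differential a = 0}
      (cochain_algebra :: ('k, nat \<Rightarrow> ('v, 'k) cochain) module)"
  proof (rule C.subringI)
    show "\<one>\<^bsub>cochain_algebra\<^esub> \<in> {a \<in> carrier cochain_algebra. differential a = 0}"
      using ZA_homogeneous[OF unit_cocycle] by (simp only: CA_simps(3) ZA_simps(1))
    show "\<ominus>\<^bsub>cochain_algebra\<^esub> h \<in> {a \<in> carrier cochain_algebra. differential a = 0}"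
      if h: "h \<in> {a \<in> carrier cochain_algebra. differential a = 0}" for h :: "nat \<Rightarrow> ('v, 'k) cochain"
    proof -
      have "differential h + differential (- h) = 0"
        unfolding differential_add[symmetric]
        by (rule ext) (simp add: differential_def coboundary_0[unfolded zero_fun_def] zero_fun_def split: nat.splits)
      then have "differential (- h) = 0" using h by simp
      then show ?thesis using h minus CA_uminus by auto
    qed
    show "h1 \<otimes>\<^bsub>cochain_algebra\<^esub> h2 \<in> {a \<in> carrier cochain_algebra. differential a = 0}"
      if h: "h1 \<in> {a \<in> carrier cochain_algebra. differential a = 0}" "h2 \<in> {a \<in> carrier cochain_algebra. differential a = 0}"
      for h1 h2 :: "nat \<Rightarrow> ('v, 'k) cochain"
      using h CA_seq_cup[of h1 h2] differential_seq_cup[of h1 h2]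
      by (simp only: CA_simps(2) mem_Collect_eq seq_cup_0 add_0 simp_thms)
    show "h1 \<oplus>\<^bsub>cochain_algebra\<^esub> h2 \<in> {a \<in> carrier cochain_algebra. differential a = 0}"
      if h: "h1 \<in> {a \<in> carrier cochain_algebra. differential a = 0}" "h2 \<in> {a \<in> carrier cochain_algebra. differential a = 0}"
      for h1 h2 :: "nat \<Rightarrow> ('v, 'k) cochain"
      using h CA_add[of h1 h2] differential_add[of h1 h2] by (simp only: CA_simps(5) mem_Collect_eq add_0 simp_thms)
  qed blast
  from C.subring_is_ring[OF this] show ?thesis by (simp add: cocycle_algebra_def)
qed

lemma coboundary_idealI: "c \<in> carrier cochain_algebra \<Longrightarrow> a = differential c \<Longrightarrow> a \<in> coboundary_ideal"
  unfolding coboundary_ideal_def by (rule image_eqI)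

lemma coboundary_idealE:
  assumes "a \<in> coboundary_ideal"
  obtains c where "c \<in> carrier cochain_algebra" "a = differential c"
  using assms unfolding coboundary_ideal_def by (rule imageE)

lemma ideal_coboundaries:
  "ideal coboundary_ideal (cocycle_algebra :: ('k::field, nat \<Rightarrow> ('v, 'k) cochain) module)"
proof (rule idealI[OF ring_cocycle_algebra])
  interpret Z: ring "cocycle_algebra :: ('k, nat \<Rightarrow> ('v, 'k) cochain) module"
    by (rule ring_cocycle_algebra)
  have sub: "(coboundary_ideal :: (nat \<Rightarrow> ('v, 'k) cochain) set) \<subseteq> carrier cocycle_algebra"
  proof
    fix a :: "nat \<Rightarrow> ('v, 'k) cochain" assume "a \<in> coboundary_ideal"
    then obtain c where c: "c \<in> carrier cochain_algebra" "a = differential c" by (rule coboundary_idealE)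
    show "a \<in> carrier cocycle_algebra"
      unfolding ZA_simps(1) c(2) using differential_carrier[OF c(1)] differential_differential[OF c(1)] by (intro CollectI conjI)
  qed
  have d0: "differential 0 = (0 :: nat \<Rightarrow> ('v, 'k) cochain)"
    using differential_scale[of 0 0] by (simp add: scale_def zero_fun_def)
  show "subgroup coboundary_ideal (add_monoid (cocycle_algebra :: ('k, nat \<Rightarrow> ('v, 'k) cochain) module))"
  proof (rule Z.add.subgroupI)
    show "(coboundary_ideal :: (nat \<Rightarrow> ('v, 'k) cochain) set) \<subseteq> carrier cocycle_algebra" by (rule sub)
    show "(coboundary_ideal :: (nat \<Rightarrow> ('v, 'k) cochain) set) \<noteq> {}"
      using coboundary_idealI[OF CA_zero refl] by blast
    show "\<ominus>\<^bsub>cocycle_algebra\<^esub> a \<in> coboundary_ideal" if a: "a \<in> coboundary_ideal" for a :: "nat \<Rightarrow> ('v, 'k) cochain"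
    proof -
      obtain b where b: "b \<in> carrier cochain_algebra" "a = differential b"
        using a by (rule coboundary_idealE)
      have m: "differential (scale (-1) b) + a = 0"
        unfolding b(2) differential_scale by (intro ext) (simp add: scale_def)
      have d: "differential (scale (-1) b) \<in> coboundary_ideal"
        by (rule coboundary_idealI[OF CA_scale[OF b(1)] refl])
      have "\<ominus>\<^bsub>cocycle_algebra\<^esub> a = differential (scale (-1) b)"
        by (rule Z.minus_equality) (use a d m sub in \<open>auto simp only: ZA_simps(4,5)\<close>)
      then show ?thesis using d by simp
    qed
    show "a \<oplus>\<^bsub>cocycle_algebra\<^esub> b \<in> coboundary_ideal" if ab: "a \<in> coboundary_ideal" "b \<in> coboundary_ideal" for a b :: "nat \<Rightarrow> ('v, 'k) cochain"
    proof -
      obtain c where c: "c \<in> carrier cochain_algebra" "a = differential c"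
        using ab(1) by (rule coboundary_idealE)
      obtain d where d: "d \<in> carrier cochain_algebra" "b = differential d"
        using ab(2) by (rule coboundary_idealE)
      have "a + b = differential (c + d)" unfolding c(2) d(2) differential_add ..
      then show ?thesis
        unfolding ZA_simps(5) by (rule coboundary_idealI[OF CA_add[OF c(1) d(1)]])
    qed
  qed
  fix a x :: "nat \<Rightarrow> ('v, 'k) cochain"
  assume a: "a \<in> coboundary_ideal" and "x \<in> carrier cocycle_algebra"
  then have x: "x \<in> carrier cochain_algebra" "differential x = 0" by (simp_all only: ZA_simps(1) mem_Collect_eq)
  obtain b where b: "b \<in> carrier cochain_algebra" "a = differential b"
    using a by (rule coboundary_idealE)
  have l: "differential (seq_cup (sign_twist x) b) = seq_cup x a"
    unfolding differential_seq_cup[OF sign_twist_carrier[OF x(1)] b(1)] differential_sign_twist[OF x(2)] sign_twist_twist b(2)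
    by (simp only: seq_cup_0 add_0)
  show "x \<otimes>\<^bsub>cocycle_algebra\<^esub> a \<in> coboundary_ideal"
    unfolding ZA_simps(2) by (rule coboundary_idealI[OF CA_seq_cup[OF sign_twist_carrier[OF x(1)] b(1)] l[symmetric]])
  have r: "differential (seq_cup b x) = seq_cup a x"
    unfolding differential_seq_cup[OF b(1) x(1)] x(2) b(2) by (simp only: seq_cup_0 add_0_right)
  show "a \<otimes>\<^bsub>cocycle_algebra\<^esub> x \<in> coboundary_ideal"
    unfolding ZA_simps(2) by (rule coboundary_idealI[OF CA_seq_cup[OF b(1) x(1)] r[symmetric]])
qed

section \<open>The cohomology ring\<close>

definition cls :: "(nat \<Rightarrow> ('v, 'k::field) cochain) \<Rightarrow> (nat \<Rightarrow> ('v, 'k) cochain) set" where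
  "cls a = coboundary_ideal +>\<^bsub>cocycle_algebra\<^esub> a"

text \<open>
  From here on cosets are handled through the relation of differing by a coboundary.
\<close>

lemma cls_eq_image: "cls a = (\<lambda>c. differential c + a) ` carrier cochain_algebra"
  unfolding cls_def a_r_coset_def' coboundary_ideal_def ZA_simps(5) by blast

lemma cohomology_class_cls: "cohomology_class n \<alpha> = cls (homogeneous n \<alpha>)"
  by (simp add: cohomology_class_def cls_def)

lemma differential_0: "differential 0 = 0"
  using differential_scale[of 0 0] by (simp add: scale_def zero_fun_def)

lemma scale_add: "scale c (a + b) = scale c a + scale c b"
  by (intro ext) (simp add: scale_def algebra_simps)

lemma scale_0: "scale c 0 = 0"
  by (intro ext) (simp add: scale_def)

lemma ZA_scale: "a \<in> carrier cocycle_algebra \<Longrightarrow> scale c a \<in> carrier cocycle_algebra"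
proof -
  assume "a \<in> carrier cocycle_algebra"
  then have "scale c a \<in> carrier cochain_algebra" "differential (scale c a) = scale c 0"
    using CA_scale differential_scale[of c a] by (auto simp only: ZA_simps(1) mem_Collect_eq)
  then show ?thesis unfolding scale_0 by (simp only: ZA_simps(1) mem_Collect_eq simp_thms)
qed

lemma ZA_add: "a \<in> carrier cocycle_algebra \<Longrightarrow> b \<in> carrier cocycle_algebra \<Longrightarrow> a + b \<in> carrier cocycle_algebra"
  using ring.ring_simprules(1)[OF ring_cocycle_algebra, of a b] by (simp only: ZA_simps(5))

lemma ZA_seq_cup: "a \<in> carrier cocycle_algebra \<Longrightarrow> b \<in> carrier cocycle_algebra \<Longrightarrow> seq_cup a b \<in> carrier cocycle_algebra"
  using ring.ring_simprules(5)[OF ring_cocycle_algebra, of a b] by (simp only: ZA_simps(2))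

lemma cls_eq_iff:
  assumes "a \<in> carrier cocycle_algebra" "b \<in> carrier cocycle_algebra"
  shows "cls a = cls b \<longleftrightarrow> (\<exists>c\<in>carrier cochain_algebra. a = differential c + b)"
proof -
  interpret ideal coboundary_ideal "cocycle_algebra :: ('b, nat \<Rightarrow> ('a, 'b) cochain) module"
    by (rule ideal_coboundaries)
  have "a \<in> cls a" unfolding cls_def by (rule a_rcos_self[OF assms(1)])
  then have "cls a = cls b \<Longrightarrow> a \<in> cls b" by simp
  moreover have "a \<in> cls b \<Longrightarrow> cls a = cls b"
    unfolding cls_def using a_repr_independence'[OF _ assms(2)] by blast
  ultimately show ?thesis unfolding cls_eq_image[of b] by blast
qed

lemma H_simps:
  "carrier cohomology = carrier (cocycle_algebra Quot coboundary_ideal)"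
  "mult cohomology = mult (cocycle_algebra Quot coboundary_ideal)"
  "one cohomology = one (cocycle_algebra Quot coboundary_ideal)"
  "zero cohomology = zero (cocycle_algebra Quot coboundary_ideal)"
  "add cohomology = add (cocycle_algebra Quot coboundary_ideal)"
  by (simp_all add: cohomology_def ring.extend_def)

lemma cls_hom: "cls \<in> ring_hom cocycle_algebra (cocycle_algebra Quot coboundary_ideal)"
  using ideal.rcos_ring_hom[OF ideal_coboundaries] by (simp add: cls_def[abs_def])

lemma H_cls:
  assumes "a \<in> carrier cocycle_algebra" "b \<in> carrier cocycle_algebra"
  shows "cls a \<in> carrier cohomology"
    "cls a \<otimes>\<^bsub>cohomology\<^esub> cls b = cls (seq_cup a b)"
    "cls a \<oplus>\<^bsub>cohomology\<^esub> cls b = cls (a + b)"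
  using ring_hom_closed[OF cls_hom assms(1)] ring_hom_mult[OF cls_hom assms] ring_hom_add[OF cls_hom assms]
  by (simp_all only: H_simps ZA_simps(2,5))

lemma H_one: "\<one>\<^bsub>cohomology\<^esub> = cls (homogeneous 0 cup_unit)"
  using ring_hom_one[OF cls_hom, symmetric] by (simp only: H_simps ZA_simps(3))

lemma H_zero:
  "\<zero>\<^bsub>cohomology\<^esub> = cls (0 :: nat \<Rightarrow> ('v, 'k::field) cochain)"
proof -
  interpret ideal coboundary_ideal "cocycle_algebra :: ('k, nat \<Rightarrow> ('v, 'k) cochain) module"
    by (rule ideal_coboundaries)
  have "0 \<in> (coboundary_ideal :: (nat \<Rightarrow> ('v, 'k) cochain) set)"
    unfolding coboundary_ideal_def using differential_0 CA_zero by (metis image_eqI)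
  then have "cls 0 = (coboundary_ideal :: (nat \<Rightarrow> ('v, 'k) cochain) set)"
    unfolding cls_def by (rule a_rcos_const)
  then show ?thesis by (simp add: H_simps FactRing_def)
qed

lemma H_scale:
  assumes "a \<in> carrier cocycle_algebra"
  shows "c \<odot>\<^bsub>cohomology\<^esub> cls a = cls (scale c a)"
proof -
  have "c \<odot>\<^bsub>cohomology\<^esub> cls a = (\<Union>x\<in>cls a. cls (scale c x))"
    by (simp add: cohomology_def ring.extend_def module.fields_def cls_def)
  moreover have "cls (scale c x) = cls (scale c a)" if x: "x \<in> cls a" for x
  proof -
    obtain d where d: "d \<in> carrier cochain_algebra" "x = differential d + a"
      using x unfolding cls_eq_image by blast
    have dd: "differential d \<in> carrier cocycle_algebra"
      using differential_carrier[OF d(1)] differential_differential[OF d(1)] by (simp only: ZA_simps(1) mem_Collect_eq simp_thms)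
    have xZ: "x \<in> carrier cocycle_algebra" unfolding d(2) by (rule ZA_add[OF dd assms])
    have "scale c x = differential (scale c d) + scale c a"
      unfolding d(2) scale_add differential_scale ..
    then show ?thesis
      using cls_eq_iff[OF ZA_scale[OF xZ] ZA_scale[OF assms]] CA_scale[OF d(1)] by blast
  qed
  moreover have "cls a \<noteq> {}"
    unfolding cls_eq_image using CA_zero by blast
  ultimately show ?thesis by auto
qed

text \<open>
  A map on the level of cocycles need only be multiplicative up to coboundaries; for the
  exterior algebra this freedom is needed since the square of \<open>kappa\<close> is not zero as a cochain.
\<close>

lemma class_hom:
  assumes carrier: "\<And>x. x \<in> carrier P \<Longrightarrow> \<Theta> x \<in> carrier cocycle_algebra"
    and add: "\<And>x y. x \<in> carrier P \<Longrightarrow> y \<in> carrier P \<Longrightarrow> \<Theta> (x \<oplus>\<^bsub>P\<^esub> y) = \<Theta> x + \<Theta> y"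
    and one: "\<Theta> \<one>\<^bsub>P\<^esub> = homogeneous 0 cup_unit"
    and mult: "\<And>x y. x \<in> carrier P \<Longrightarrow> y \<in> carrier P \<Longrightarrow> x \<otimes>\<^bsub>P\<^esub> y \<in> carrier P \<and>
       (\<exists>c\<in>carrier cochain_algebra. \<Theta> (x \<otimes>\<^bsub>P\<^esub> y) = differential c + seq_cup (\<Theta> x) (\<Theta> y))"
    and scale: "\<And>c x. x \<in> carrier P \<Longrightarrow> \<Theta> (c \<odot>\<^bsub>P\<^esub> x) = scale c (\<Theta> x)"
  shows "(\<lambda>x. cls (\<Theta> x)) \<in> algebra_hom P cohomology"
  unfolding algebra_hom_def mem_Collect_eq
proof (intro conjI allI ballI ring_hom_memI)
  fix x assume x: "x \<in> carrier P"
  show "cls (\<Theta> x) \<in> carrier cohomology" by (rule H_cls(1)[OF carrier[OF x] carrier[OF x]])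
  show "cls (\<Theta> (c \<odot>\<^bsub>P\<^esub> x)) = c \<odot>\<^bsub>cohomology\<^esub> cls (\<Theta> x)" for c
    unfolding scale[OF x] H_scale[OF carrier[OF x]] ..
  fix y assume y: "y \<in> carrier P"
  show "cls (\<Theta> (x \<oplus>\<^bsub>P\<^esub> y)) = cls (\<Theta> x) \<oplus>\<^bsub>cohomology\<^esub> cls (\<Theta> y)"
    unfolding add[OF x y] H_cls(3)[OF carrier[OF x] carrier[OF y]] ..
  show "cls (\<Theta> (x \<otimes>\<^bsub>P\<^esub> y)) = cls (\<Theta> x) \<otimes>\<^bsub>cohomology\<^esub> cls (\<Theta> y)"
    unfolding H_cls(2)[OF carrier[OF x] carrier[OF y]]
    using mult[OF x y] cls_eq_iff[OF carrier ZA_seq_cup[OF carrier[OF x] carrier[OF y]]] by blast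
qed (simp only: one H_one)

lemma seq_cup_homogeneous:
  "seq_cup (homogeneous p \<alpha>) (homogeneous q \<beta>) = homogeneous (p + q) (cup p q \<alpha> \<beta>)"
proof
  fix n
  have z: "cup i (n - i) (homogeneous p \<alpha> i) (homogeneous q \<beta> (n - i)) = 0" if "i \<noteq> p" for i
    using that by (simp only: homogeneous_simps cup_0 not_False_eq_True)
  show "seq_cup (homogeneous p \<alpha>) (homogeneous q \<beta>) n = homogeneous (p + q) (cup p q \<alpha> \<beta>) n"
  proof (cases "n = p + q")
    case True
    have "seq_cup (homogeneous p \<alpha>) (homogeneous q \<beta>) n
        = (\<Sum>i\<in>{p}. cup i (n - i) (homogeneous p \<alpha> i) (homogeneous q \<beta> (n - i)))"
      unfolding seq_cup_def by (rule sum.mono_neutral_right) (use True in simp, use True in simp, use z in blast)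
    also have "\<dots> = cup p q \<alpha> \<beta>"
      unfolding True by (simp add: homogeneous_simps)
    finally show ?thesis unfolding True homogeneous_simps .
  next
    case False
    have "cup i (n - i) (homogeneous p \<alpha> i) (homogeneous q \<beta> (n - i)) = 0" if "i \<le> n" for i
    proof (cases "i = p")
      case True
      then have "n - i \<noteq> q" using False that by auto
      then show ?thesis by (simp only: homogeneous_simps cup_0 not_False_eq_True)
    qed (rule z)
    then show ?thesis
      unfolding seq_cup_def homogeneous_simps(2)[OF False] by (intro sum.neutral) simp
  qed
qed

lemma scale_homogeneous: "scale c (homogeneous n \<alpha>) = homogeneous n (sc c \<alpha>)"
  by (intro ext) (simp add: scale_def homogeneous_def sc_def)

lemma cocycles_add: "\<alpha> \<in> cocycles n \<Longrightarrow> \<beta> \<in> cocycles n \<Longrightarrow> \<alpha> + \<beta> \<in> cocycles n"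
  unfolding cocycles_def mem_Collect_eq by (simp only: add_in_cochains coboundary_add add_0 simp_thms)

lemma cocycles_sc: "\<alpha> \<in> cocycles n \<Longrightarrow> sc c \<alpha> \<in> cocycles n"
  unfolding cocycles_def mem_Collect_eq by (simp only: sc_in_cochains coboundary_sc sc_simps simp_thms)

lemma cocycles_cup:
  assumes "\<alpha> \<in> cocycles p" "\<beta> \<in> cocycles q"
  shows "cup p q \<alpha> \<beta> \<in> cocycles (p + q)"
  using assms cup_in_cochains[of \<alpha> p \<beta> q] Leibniz[of \<alpha> p \<beta> q]
  unfolding cocycles_def mem_Collect_eq by (simp only: cup_0 sc_simps add_0 simp_thms)

lemma cls_homogeneous_eqI:
  assumes "\<alpha> \<in> cocycles (Suc n)" "\<beta> \<in> cocycles (Suc n)" "\<gamma> \<in> cochains n" "\<alpha> = coboundary n \<gamma> + \<beta>"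
  shows "cls (homogeneous (Suc n) \<alpha>) = cls (homogeneous (Suc n) \<beta>)"
proof -
  have "homogeneous (Suc n) \<alpha> = differential (homogeneous n \<gamma>) + homogeneous (Suc n) \<beta>"
    unfolding differential_homogeneous[OF assms(3)] assms(4)
    by (intro ext) (simp add: homogeneous_def)
  then show ?thesis
    using cls_eq_iff[OF ZA_homogeneous[OF assms(1)] ZA_homogeneous[OF assms(2)]] CA_homogeneous[OF assms(3)] by blast
qed

lemma test_add: "test vs g (\<alpha> + \<beta>) = test vs g \<alpha> + test vs g \<beta>"
proof -
  have "(\<lambda>F. moebius (coef (\<alpha> + \<beta>)) F g) = (\<lambda>F. moebius (coef \<alpha>) F g - (- moebius (coef \<beta>) F g))"
    by (rule ext) (simp add: wsum_def coef_add algebra_simps sum.distrib)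
  then show ?thesis unfolding test_def by (simp only: alt_diff alt_minus) simp
qed

lemma test_sc: "test vs g (sc c \<alpha>) = c * test vs g \<alpha>"
proof -
  have "(\<lambda>F. moebius (coef (sc c \<alpha>)) F g) = (\<lambda>F. c * moebius (coef \<alpha>) F g)"
    by (rule ext) (simp add: wsum_def coef_sc algebra_simps sum_distrib_left)
  then show ?thesis unfolding test_def by (simp only: alt_scale)
qed

lemma test_zero: "test vs g 0 = 0"
  using test_sc[of vs g 0 0] by (simp add: sc_simps(1)[unfolded zero_fun_def] zero_fun_def)

text \<open>
  The functionals descend to cohomology: all statements about nonzero or distinct classes rest on this.
\<close>

lemma test_class:
  assumes "a \<in> carrier cocycle_algebra" "b \<in> carrier cocycle_algebra" "cls a = cls b"
    and "distinct vs" "g \<in> graphs (set vs)"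
  shows "test vs g (a (length vs)) = test vs g (b (length vs))"
proof -
  obtain c where c: "c \<in> carrier cochain_algebra" "a = differential c + b"
    using assms cls_eq_iff by blast
  have "test vs g (differential c (length vs)) = 0"
  proof (cases "length vs")
    case 0
    then show ?thesis by (simp only: differential_simps test_zero)
  next
    case (Suc m)
    then show ?thesis
      using test_coboundary[OF CA_carrierD(1)[OF c(1)] Suc assms(4,5)] by (simp only: differential_simps)
  qed
  then show ?thesis unfolding c(2) plus_fun_apply test_add by (simp only: add_0)
qed

section \<open>The cocycles kappa and p4\<close>

lemma relabel_mem:
  assumes "g \<in> graphs I" "inj_on \<sigma> I" "e \<subseteq> I"
  shows "\<sigma> ` e \<in> relabel \<sigma> g \<longleftrightarrow> e \<in> g"
proof
  assume "\<sigma> ` e \<in> relabel \<sigma> g"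
  then obtain e' where e': "e' \<in> g" "\<sigma> ` e = \<sigma> ` e'" by (auto simp: relabel_def)
  then have "e = e'" using assms by (auto simp: graphs_def inj_on_image_eq_iff)
  then show "e \<in> g" using e' by simp
qed (auto simp: relabel_def)

definition kappa_coef :: "('v, 'k::field) coeff" where
  "kappa_coef F g = of_nat (card (hd F))"

lemma kappa_eq: "kappa = cochain_of 1 kappa_coef"
  by (simp add: kappa_def kappa_coef_def[abs_def])

lemma length_1: "length F = Suc 0 \<longleftrightarrow> (\<exists>A. F = [A])"
  by (auto simp: length_Suc_conv)

lemma kappa_coef_natural: "natural (Suc 0) kappa_coef"
  by (auto simp: natural_def cdom_def length_1 kappa_coef_def card_image)

lemma cocycleI:
  assumes "natural n a" "\<And>F g. (F, g) \<in> cdom (Suc n) \<Longrightarrow> cob a F g = 0"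
  shows "cochain_of n a \<in> cocycles n"
proof -
  have c: "cochain_of n a \<in> cochains n" by (rule cochain_of_in_cochains[OF assms(1)])
  have "coboundary n (cochain_of n a) = 0"
  proof (rule cochain_eqI[OF coboundary_in_cochains[OF c] zero_in_cochains])
    fix F :: "'a set list" and g assume F: "(F, g) \<in> cdom (Suc n)"
    have "coef (coboundary n (cochain_of n a)) F g = cob (coef (cochain_of n a)) F g"
      by (rule coef_coboundary[OF c F])
    also have "\<dots> = cob a F g" by (rule cob_cong[OF coef_cochain_of F])
    finally show "coef (coboundary n (cochain_of n a)) F g = coef 0 F g"
      using assms(2)[OF F] by (simp add: coef_zero)
  qed
  then show ?thesis using c unfolding cocycles_def by blast
qed

lemma kappa_cocycle: "kappa \<in> cocycles 1"
  unfolding kappa_eq One_nat_def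
proof (rule cocycleI[OF kappa_coef_natural])
  fix F :: "'a set list" and g assume F: "(F, g) \<in> cdom (Suc (Suc 0))"
  then obtain A B where "F = [A, B]" by (auto simp: cdom_def length_Suc_conv)
  with F show "cob kappa_coef F g = (0 :: 'b)"
    by (auto simp: cob_def kappa_coef_def cdom_def card_Un_disjoint)
qed

text \<open>
  The square of the number of vertices. The defect of its additivity is twice the product of the numbers of vertices,
  so that it bounds a multiple of the square of \<open>kappa\<close>.
\<close>

definition square_coef :: "('v, 'k::field) coeff" where
  "square_coef F g = of_nat (card (hd F)) * of_nat (card (hd F))"

lemma square_coef_natural: "natural (Suc 0) square_coef"
  by (auto simp: natural_def cdom_def length_1 square_coef_def card_image)

lemma coef_kappa: "(F, g) \<in> cdom 1 \<Longrightarrow> coef kappa F g = of_nat (card (hd F))"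
  unfolding kappa_eq by (simp add: coef_cochain_of kappa_coef_def)

lemma coboundary_square_coef:
  "coboundary 1 (cochain_of 1 square_coef) = sc (- 2) (cup 1 1 (kappa :: ('v, 'k::field) cochain) kappa)"
proof (rule cochain_eqI[of _ 2])
  have c: "(cochain_of 1 square_coef :: ('v, 'k) cochain) \<in> cochains 1"
    using cochain_of_in_cochains[OF square_coef_natural] by simp
  then show "coboundary 1 (cochain_of 1 square_coef :: ('v, 'k) cochain) \<in> cochains 2"
    using coboundary_in_cochains[of "cochain_of 1 square_coef :: ('v, 'k) cochain" 1] by (simp add: numeral_2_eq_2)
  have "(kappa :: ('v, 'k) cochain) \<in> cochains 1" using kappa_cocycle by (auto simp: cocycles_def)
  then show "sc (- 2) (cup 1 1 (kappa :: ('v, 'k) cochain) kappa) \<in> cochains 2"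
    using cup_in_cochains[of "kappa :: ('v, 'k) cochain" 1 kappa 1] by (simp add: sc_in_cochains numeral_2_eq_2)
  fix F :: "'v set list" and g assume F: "(F, g) \<in> cdom 2"
  then have F': "(F, g) \<in> cdom (Suc 1)" "(F, g) \<in> cdom (1 + 1)" by (simp_all add: numeral_2_eq_2)
  obtain A B where AB: "F = [A, B]" using F by (auto simp: cdom_def length_Suc_conv numeral_2_eq_2)
  have "coef (coboundary 1 (cochain_of 1 square_coef)) F g = cob (coef (cochain_of 1 square_coef :: ('v, 'k) cochain)) F g"
    by (rule coef_coboundary[OF c F'(1)])
  also have "\<dots> = cob square_coef F g" by (rule cob_cong[OF coef_cochain_of F'(1)])
  also have "\<dots> = - 2 * (of_nat (card A) * of_nat (card B))"
    using F by (auto simp: AB cob_def square_coef_def cdom_def card_Un_disjoint algebra_simps)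
  also have "\<dots> = - 2 * cupc 1 (coef kappa) (coef kappa) F g"
    unfolding cupc_def coef_kappa[OF cdom_take_drop(1)[OF F'(2)]] coef_kappa[OF cdom_take_drop(2)[OF F'(2)]]
    by (simp add: AB)
  also have "\<dots> = coef (sc (- 2) (cup 1 1 kappa kappa)) F g"
    unfolding coef_sc coef_cup[OF F'(2)] ..
  finally show "coef (coboundary 1 (cochain_of 1 square_coef)) F g = coef (sc (- 2) (cup 1 1 (kappa :: ('v, 'k) cochain) kappa)) F g" .
qed

text \<open>
  The blocks being disjoint, injectivity of an inclusion is automatic, and counting inclusions becomes an
  iterated sum that is additive in each block. That additivity makes \<open>p4\<close> a cocycle: in the
  coboundary each merger splits into two terms and the sum telescopes.
\<close>

definition paths :: "'v set \<Rightarrow> 'v set \<Rightarrow> 'v set \<Rightarrow> 'v set \<Rightarrow> 'v set set \<Rightarrow> nat" where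
  "paths A B C D g = (\<Sum>a\<in>A. \<Sum>b\<in>B. \<Sum>c\<in>C. \<Sum>d\<in>D. if {a, b} \<in> g \<and> {b, c} \<in> g \<and> {c, d} \<in> g then 1 else 0)"

lemma card_path4_inclusions:
  assumes F: "([A, B, C, D], g) \<in> cdom 4"
  shows "card (path4_inclusions [A, B, C, D] g) = paths A B C D g"
proof -
  have disj: "A \<inter> B = {}" "A \<inter> C = {}" "A \<inter> D = {}" "B \<inter> C = {}" "B \<inter> D = {}" "C \<inter> D = {}"
    and fin: "finite A" "finite B" "finite C" "finite D"
    using F by (auto simp: cdom_def)
  let ?Q = "{(a, b, c, d). a \<in> A \<and> b \<in> B \<and> c \<in> C \<and> d \<in> D \<and> {a, b} \<in> g \<and> {b, c} \<in> g \<and> {c, d} \<in> g}"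
  let ?to = "\<lambda>(a, b, c, d). \<lambda>i\<in>path4_vertices. if i = 1 then a else if i = 2 then b else if i = 3 then c else d"
  let ?from = "\<lambda>\<zeta>. (\<zeta> 1, \<zeta> 2, \<zeta> 3, \<zeta> (4::nat))"
  have "bij_betw ?from (path4_inclusions [A, B, C, D] g) ?Q"
  proof (rule bij_betwI[where g = ?to])
    show "?from \<in> path4_inclusions [A, B, C, D] g \<rightarrow> ?Q"
      by (auto simp: path4_inclusions_def path4_vertices_def path4_def)
    show "?to \<in> ?Q \<rightarrow> path4_inclusions [A, B, C, D] g"
    proof
      fix q assume "q \<in> ?Q"
      then obtain a b c d where q: "q = (a, b, c, d)" "a \<in> A" "b \<in> B" "c \<in> C" "d \<in> D"
        "{a, b} \<in> g" "{b, c} \<in> g" "{c, d} \<in> g" by auto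
      then have "a \<noteq> b" "a \<noteq> c" "a \<noteq> d" "b \<noteq> c" "b \<noteq> d" "c \<noteq> d" using disj by auto
      then show "?to q \<in> path4_inclusions [A, B, C, D] g"
        using q by (auto simp: path4_inclusions_def path4_vertices_def path4_def inj_on_def)
    qed
    show "?to (?from \<zeta>) = \<zeta>" if "\<zeta> \<in> path4_inclusions [A, B, C, D] g" for \<zeta>
    proof
      fix i
      show "?to (?from \<zeta>) i = \<zeta> i"
      proof (cases "i \<in> path4_vertices")
        case True
        then show ?thesis by (auto simp: path4_vertices_def)
      next
        case False
        then show ?thesis using that by (auto simp: path4_inclusions_def PiE_def extensional_def)
      qed
    qed
    show "?from (?to q) = q" if "q \<in> ?Q" for q
      by (cases q) (simp add: path4_vertices_def)
  qed
  then have "card (path4_inclusions [A, B, C, D] g) = card ?Q" by (rule bij_betw_same_card)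
  also have "?Q = {q \<in> A \<times> B \<times> C \<times> D. case q of (a, b, c, d) \<Rightarrow> {a, b} \<in> g \<and> {b, c} \<in> g \<and> {c, d} \<in> g}"
    by auto
  also have "card \<dots> = (\<Sum>q\<in>A \<times> B \<times> C \<times> D. if (case q of (a, b, c, d) \<Rightarrow> {a, b} \<in> g \<and> {b, c} \<in> g \<and> {c, d} \<in> g) then 1 else 0)"
    using fin by (simp add: sum.If_cases Int_def)
  also have "\<dots> = paths A B C D g"
    unfolding paths_def by (simp add: sum.cartesian_product case_prod_unfold)
  finally show ?thesis .
qed

definition p4_coef :: "('v, 'k::field) coeff" where
  "p4_coef F g = of_nat (paths (F ! 0) (F ! 1) (F ! 2) (F ! 3) g)"

lemma length_4: "length F = 4 \<longleftrightarrow> (\<exists>A B C D. F = [A, B, C, D])"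
  by (auto simp: length_Suc_conv numeral_eq_Suc)

lemma p4_eq: "p4 = cochain_of 4 p4_coef"
  unfolding p4_def
proof (rule cochain_of_cong)
  fix F :: "'a set list" and g assume F: "(F, g) \<in> cdom 4"
  then obtain A B C D where "F = [A, B, C, D]" by (auto simp: cdom_def length_4)
  then show "of_nat (card (path4_inclusions F g)) = p4_coef F g"
    using F by (simp add: card_path4_inclusions p4_coef_def numeral_3_eq_3)
qed

lemma paths_relabel:
  assumes "g \<in> graphs I" "inj_on \<sigma> I" "A \<subseteq> I" "B \<subseteq> I" "C \<subseteq> I" "D \<subseteq> I"
  shows "paths (\<sigma> ` A) (\<sigma> ` B) (\<sigma> ` C) (\<sigma> ` D) (relabel \<sigma> g) = paths A B C D g"
proof -
  have inj: "inj_on \<sigma> A" "inj_on \<sigma> B" "inj_on \<sigma> C" "inj_on \<sigma> D"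
    using assms inj_on_subset by blast+
  have e: "{\<sigma> x, \<sigma> y} \<in> relabel \<sigma> g \<longleftrightarrow> {x, y} \<in> g" if "x \<in> I" "y \<in> I" for x y
    using relabel_mem[OF assms(1,2), of "{x, y}"] that by simp
  show ?thesis
    unfolding paths_def by (simp only: sum.reindex[OF inj(1)] sum.reindex[OF inj(2)] sum.reindex[OF inj(3)] sum.reindex[OF inj(4)] o_def)
      (intro sum.cong refl, use e assms in \<open>auto simp: subset_iff\<close>)
qed

lemma paths_induced:
  assumes "A \<subseteq> J" "B \<subseteq> J" "C \<subseteq> J" "D \<subseteq> J"
  shows "paths A B C D (induced J g) = paths A B C D g"
  unfolding paths_def induced_def using assms by (intro sum.cong refl) (auto simp: subset_iff)

lemma p4_coef_natural: "natural 4 p4_coef"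
  unfolding natural_def
proof (intro allI impI)
  fix F :: "'a set list" and g and \<sigma> :: "'a \<Rightarrow> 'a"
  assume F: "(F, g) \<in> cdom 4" and inj: "inj_on \<sigma> (ground F)"
  then obtain A B C D where eq: "F = [A, B, C, D]" by (auto simp: cdom_def length_4)
  have "g \<in> graphs (ground F)" using F by (simp add: cdom_def)
  from paths_relabel[OF this inj, of A B C D]
  show "p4_coef (map ((`) \<sigma>) F) (relabel \<sigma> g) = (p4_coef F g :: 'b)"
    by (simp add: p4_coef_def eq numeral_3_eq_3 Un_assoc subset_iff)
qed

lemma paths_Un:
  assumes "finite A" "finite B" "finite C" "finite D" "finite E"
  shows "A \<inter> B = {} \<Longrightarrow> paths (A \<union> B) C D E g = paths A C D E g + paths B C D E g"
    and "B \<inter> C = {} \<Longrightarrow> paths A (B \<union> C) D E g = paths A B D E g + paths A C D E g"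
    and "C \<inter> D = {} \<Longrightarrow> paths A B (C \<union> D) E g = paths A B C E g + paths A B D E g"
    and "D \<inter> E = {} \<Longrightarrow> paths A B C (D \<union> E) g = paths A B C D g + paths A B C E g"
  using assms by (simp_all add: paths_def sum.union_disjoint sum.distrib)

lemma p4_cocycle: "p4 \<in> cocycles 4"
  unfolding p4_eq
proof (rule cocycleI[OF p4_coef_natural])
  fix F :: "'a set list" and g assume F: "(F, g) \<in> cdom (Suc 4)"
  then obtain A B C D E where eq: "F = [A, B, C, D, E]"
    by (auto simp: cdom_def length_Suc_conv numeral_eq_Suc)
  have fin: "finite A" "finite B" "finite C" "finite D" "finite E"
    and disj: "A \<inter> B = {}" "B \<inter> C = {}" "C \<inter> D = {}" "D \<inter> E = {}"
    using F by (auto simp: cdom_def eq)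
  have 1: "paths B C D E (induced (B \<union> (C \<union> (D \<union> E))) g) = paths B C D E g"
    by (rule paths_induced) auto
  have 2: "paths A B C D (induced (A \<union> (B \<union> (C \<union> D))) g) = paths A B C D g"
    by (rule paths_induced) auto
  show "cob p4_coef F g = (0 :: 'b)"
    unfolding eq cob_def p4_coef_def
    by (simp add: numeral_3_eq_3 1 2 paths_Un[OF fin] disj)
qed

lemma coef_p4: "([A, B, C, D], g) \<in> cdom 4 \<Longrightarrow> coef p4 [A, B, C, D] g = of_nat (paths A B C D g)"
  unfolding p4_eq by (simp add: coef_cochain_of p4_coef_def numeral_3_eq_3)

section \<open>Powers of p4 on disjoint unions of paths\<close>

fun p4_cup_power :: "nat \<Rightarrow> ('v, 'k::field) cochain" where
  "p4_cup_power 0 = cup_unit"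
| "p4_cup_power (Suc n) = cup (4 * n) 4 (p4_cup_power n) p4"

lemma p4_cup_power_cocycle: "p4_cup_power n \<in> cocycles (4 * n)"
proof (induction n)
  case 0
  then show ?case using unit_cocycle by simp
next
  case (Suc n)
  then show ?case using cocycles_cup[OF Suc p4_cocycle] by (simp add: add.commute)
qed

lemma p4_cup_power_cochain: "p4_cup_power n \<in> cochains (4 * n)"
  using p4_cup_power_cocycle[of n] unfolding cocycles_def by blast

lemma cup_p4_cup_power:
  "cup (4 * i) (4 * j) (p4_cup_power i) (p4_cup_power j) = (p4_cup_power (i + j) :: ('v, 'k::field) cochain)"
proof (induction j)
  case 0
  then show ?case using cup_unit_right[OF p4_cup_power_cochain[of i]] by simp
next
  case (Suc j)
  have "cup (4 * i) (4 * Suc j) (p4_cup_power i) (p4_cup_power (Suc j)) = cup (4 * i) (4 * j + 4) (p4_cup_power i) (cup (4 * j) 4 (p4_cup_power j) p4 :: ('v, 'k) cochain)"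
    by (simp add: add.commute)
  also have "\<dots> = cup (4 * i + 4 * j) 4 (cup (4 * i) (4 * j) (p4_cup_power i) (p4_cup_power j)) p4"
    by (rule cup_assoc[symmetric])
  also have "\<dots> = p4_cup_power (i + Suc j)"
    unfolding Suc by (simp add: distrib_left)
  finally show ?case .
qed

lemma coef_p4_cup_power_Suc:
  fixes F :: "'v set list"
  assumes "(F @ [A, B, C, D], g) \<in> cdom (4 * Suc n)"
  shows "coef (p4_cup_power (Suc n) :: ('v, 'k::field) cochain) (F @ [A, B, C, D]) g
    = coef (p4_cup_power n) F (induced (ground F) g) * of_nat (paths A B C D g)"
proof -
  have d: "(F @ [A, B, C, D], g) \<in> cdom (4 * n + 4)" using assms by (simp add: add.commute)
  have l: "length F = 4 * n" using assms by (simp add: cdom_def)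
  have c: "([A, B, C, D], induced (ground [A, B, C, D]) g) \<in> cdom 4"
    using cdom_append(2)[OF assms] by (simp add: numeral_eq_Suc)
  have p: "paths A B C D (induced (ground [A, B, C, D]) g) = paths A B C D g"
    by (rule paths_induced) auto
  have "take (4 * n) (F @ [A, B, C, D]) = F" "drop (4 * n) (F @ [A, B, C, D]) = [A, B, C, D]"
    using l by simp_all
  then show ?thesis
    unfolding p4_cup_power.simps coef_cup[OF d] cupc_def by (simp only: coef_p4[OF c] p)
qed

lemma split_last4: "length F = 4 * Suc n \<Longrightarrow> \<exists>G A B C D. F = G @ [A, B, C, D] \<and> length G = 4 * n"
proof -
  assume l: "length F = 4 * Suc n"
  then have "length (drop (4 * n) F) = 4" by simp
  then obtain A B C D where "drop (4 * n) F = [A, B, C, D]" unfolding length_4 by blast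
  then have "F = take (4 * n) F @ [A, B, C, D]" by (metis append_take_drop_id)
  moreover have "length (take (4 * n) F) = 4 * n" using l by simp
  ultimately show ?thesis by blast
qed

lemma p4_cup_power_empty:
  "(F, g) \<in> cdom (4 * n) \<Longrightarrow> {} \<in> set F \<Longrightarrow> coef (p4_cup_power n :: ('v, 'k::field) cochain) F g = 0"
proof (induction n arbitrary: F g)
  case 0
  then show ?case by (simp add: cdom_def)
next
  case (Suc n)
  obtain G A B C D where G: "F = G @ [A, B, C, D]" "length G = 4 * n"
    using split_last4[of F n] Suc.prems by (auto simp: cdom_def)
  have "coef (p4_cup_power n :: ('v, 'k) cochain) G (induced (ground G) g) = 0 \<or> paths A B C D g = 0"
  proof (cases "{} \<in> set G")
    case True
    have "(G, induced (ground G) g) \<in> cdom (4 * n)"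
      using cdom_append(1)[of G "[A, B, C, D]" g] Suc.prems(1) G by simp
    from Suc.IH[OF this True] show ?thesis ..
  next
    case False
    then have "A = {} \<or> B = {} \<or> C = {} \<or> D = {}" using Suc.prems(2) G by auto
    then show ?thesis by (auto simp: paths_def)
  qed
  then show ?case using coef_p4_cup_power_Suc[of G A B C D g n, where 'k = 'k] Suc.prems(1) G(1) by auto
qed

text \<open>
  On a decomposition into single vertices every proper subset produces an empty block.
\<close>

lemma moebius_singletons:
  assumes "\<And>F g. (F, g) \<in> cdom n \<Longrightarrow> {} \<in> set F \<Longrightarrow> a F g = 0"
    and F: "(F, g) \<in> cdom n" and sing: "\<And>S. S \<in> set F \<Longrightarrow> \<exists>x. S = {x}"
  shows "moebius a F g = a F g"
proof -
  let ?I = "ground F"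
  have "moebius a F g = (\<Sum>J\<in>{?I}. (-1) ^ card (?I - J) * a (restr J F) (induced J g))"
    unfolding wsum_def
  proof (rule sum.mono_neutral_right)
    show "finite (Pow ?I)" using F by (simp add: cdom_def)
    show "\<forall>J\<in>Pow ?I - {?I}. (-1) ^ card (?I - J) * a (restr J F) (induced J g) = 0"
    proof
      fix J assume J: "J \<in> Pow ?I - {?I}"
      then obtain x S where x: "x \<in> S" "S \<in> set F" "x \<notin> J" by blast
      with sing have "S \<inter> J = {}" by fastforce
      then have "{} \<in> set (restr J F)"
        unfolding restr_def set_map using x(2) by (intro image_eqI[of _ _ S]) simp_all
      then show "(-1) ^ card (?I - J) * a (restr J F) (induced J g) = 0"
        using assms(1)[OF cdom_restr[OF F]] J by simp
    qed
  qed simp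
  moreover have "induced ?I g = g" using F by (intro induced_id[of _ ?I]) (simp_all add: cdom_def)
  ultimately show ?thesis by (simp add: restr_Union)
qed

lemma inv_sign_append:
  "inv_sign (xs @ ys) = inv_sign xs * inv_sign ys * (\<Prod>x\<leftarrow>xs. \<Prod>y\<leftarrow>ys. if x < y then 1 else -1)"
  by (induction xs) (auto simp: algebra_simps)

text \<open>
  Infinitely many disjoint paths on four vertices each, the vertices numbered along the paths.
\<close>

definition disjoint_paths :: "(nat \<Rightarrow> 'v) \<Rightarrow> 'v set set" where
  "disjoint_paths e = {{e k, e (Suc k)} | k. k mod 4 \<noteq> 3}"

lemma disjoint_paths_iff:
  assumes "inj e"
  shows "{e a, e b} \<in> disjoint_paths e \<longleftrightarrow> (b = Suc a \<and> a mod 4 \<noteq> 3) \<or> (a = Suc b \<and> b mod 4 \<noteq> 3)"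
  using assms unfolding disjoint_paths_def by (auto simp: doubleton_eq_iff inj_eq)

lemma block_start:
  "(a::nat) mod 4 \<noteq> 3 \<Longrightarrow> Suc a mod 4 \<noteq> 3 \<Longrightarrow> Suc (Suc a) mod 4 \<noteq> 3 \<Longrightarrow> \<exists>m. a = 4 * m"
  by presburger

lemma path_block:
  assumes "inj e" "distinct [a, b, c, d]"
    "{e a, e b} \<in> disjoint_paths e" "{e b, e c} \<in> disjoint_paths e" "{e c, e d} \<in> disjoint_paths e"
  shows "\<exists>m. (a = 4 * m \<and> b = 4 * m + 1 \<and> c = 4 * m + 2 \<and> d = 4 * m + 3)
    \<or> (d = 4 * m \<and> c = 4 * m + 1 \<and> b = 4 * m + 2 \<and> a = 4 * m + 3)"
proof -
  note e = assms(3-5)[unfolded disjoint_paths_iff[OF assms(1)]]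
  show ?thesis
  proof (cases "b = Suc a")
    case True
    then have c: "c = Suc b" using e assms(2) by auto
    then have d: "d = Suc c" using e assms(2) True by auto
    have "a mod 4 \<noteq> 3" "Suc a mod 4 \<noteq> 3" "Suc (Suc a) mod 4 \<noteq> 3"
      using e True c d by auto
    from block_start[OF this] obtain m where "a = 4 * m" ..
    then show ?thesis using True c d by (intro exI[of _ m]) simp
  next
    case False
    then have a: "a = Suc b" using e by auto
    then have b: "b = Suc c" using e assms(2) by auto
    then have c: "c = Suc d" using e assms(2) a by auto
    have "d mod 4 \<noteq> 3" "Suc d mod 4 \<noteq> 3" "Suc (Suc d) mod 4 \<noteq> 3"
      using e a b c by auto
    from block_start[OF this] obtain m where "d = 4 * m" ..
    then show ?thesis using a b c by (intro exI[of _ m]) simp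
  qed
qed

text \<open>
  A path on four vertices is even when read in either direction (no inversions or six), and it has an
  even number of inversions with every other vertex, being an interval of length four.
\<close>

lemma inv_sign_block:
  assumes "(a = 4 * m \<and> b = 4 * m + 1 \<and> c = 4 * m + 2 \<and> d = 4 * m + 3)
    \<or> (d = 4 * m \<and> c = 4 * m + 1 \<and> b = 4 * m + 2 \<and> a = 4 * m + 3)"
    and "distinct (zs @ [a, b, c, d])"
  shows "inv_sign (zs @ [a, b, c, d]) = inv_sign zs"
proof -
  have "inv_sign [a, b, c, d] = (1 :: 'a)" using assms(1) by auto
  moreover have "(\<Prod>x\<leftarrow>zs. \<Prod>y\<leftarrow>[a, b, c, d]. if x < y then 1 else -1 :: 'a) = 1"
  proof -
    have "(\<Prod>y\<leftarrow>[a, b, c, d]. if x < y then 1 else -1 :: 'a) = 1" if "x \<in> set zs" for x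
    proof -
      have "x \<noteq> a" "x \<noteq> b" "x \<noteq> c" "x \<noteq> d" using that assms(2) by auto
      then have "x < 4 * m \<or> x > 4 * m + 3" using assms(1) by arith
      then show ?thesis using assms(1) by auto
    qed
    then show ?thesis by (induction zs) auto
  qed
  ultimately show ?thesis by (simp add: inv_sign_append)
qed

lemma paths_singletons:
  "paths {a} {b} {c} {d} g = (if {a, b} \<in> g \<and> {b, c} \<in> g \<and> {c, d} \<in> g then 1 else 0)"
  by (simp add: paths_def)

text \<open>
  An ordering on which the power of \<open>p4\<close> does not vanish runs through the paths one after the other.
  By \<open>inv_sign_block\<close> such an ordering is even.
\<close>

lemma coef_p4_cup_power_sign:
  fixes e :: "nat \<Rightarrow> 'v"
  assumes "inj e"
  shows "distinct ys \<Longrightarrow> g \<subseteq> disjoint_paths e \<Longrightarrow> (map (\<lambda>i. {e i}) ys, g) \<in> cdom (4 * n) \<Longrightarrow>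
    coef (p4_cup_power n :: ('v, 'k::field) cochain) (map (\<lambda>i. {e i}) ys) g = 0 \<or>
    coef (p4_cup_power n :: ('v, 'k) cochain) (map (\<lambda>i. {e i}) ys) g = 1 \<and> inv_sign ys = (1 :: 'k)"
proof (induction n arbitrary: ys g)
  case 0
  then have "ys = []" "g = {}" by (auto simp: cdom_def graphs_def)
  then show ?case by (simp add: cup_unit_def coef_cochain_of[OF cdom_Nil])
next
  case (Suc n)
  have "length ys = 4 * Suc n" using Suc.prems(3) by (simp add: cdom_def)
  then obtain zs a b c d where ys: "ys = zs @ [a, b, c, d]" "length zs = 4 * n"
    using split_last4[of ys n] by blast
  let ?G = "map (\<lambda>i. {e i}) zs"
  have split: "map (\<lambda>i. {e i}) ys = ?G @ [{e a}, {e b}, {e c}, {e d}]" by (simp add: ys)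
  have v: "coef (p4_cup_power (Suc n)) (map (\<lambda>i. {e i}) ys) g
      = coef (p4_cup_power n) ?G (induced (ground ?G) g) * (of_nat (paths {e a} {e b} {e c} {e d} g) :: 'k)"
    using coef_p4_cup_power_Suc[of ?G] Suc.prems(3) unfolding split by blast
  have "(?G, induced (ground ?G) g) \<in> cdom (4 * n)"
    using cdom_append(1)[of ?G] Suc.prems(3) ys(2) unfolding split by fastforce
  moreover have "induced (ground ?G) g \<subseteq> disjoint_paths e"
    using Suc.prems(2) by (auto simp: induced_def)
  ultimately have IH: "coef (p4_cup_power n :: ('v, 'k) cochain) ?G (induced (ground ?G) g) = 0 \<or>
    coef (p4_cup_power n :: ('v, 'k) cochain) ?G (induced (ground ?G) g) = 1 \<and> inv_sign zs = (1 :: 'k)"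
    using Suc.IH[of zs "induced (ground ?G) g"] Suc.prems(1) ys(1) by simp
  show ?case
  proof (cases "{e a, e b} \<in> g \<and> {e b, e c} \<in> g \<and> {e c, e d} \<in> g")
    case True
    then have edges: "{e a, e b} \<in> disjoint_paths e" "{e b, e c} \<in> disjoint_paths e" "{e c, e d} \<in> disjoint_paths e"
      using Suc.prems(2) by auto
    have d: "distinct [a, b, c, d]" "distinct (zs @ [a, b, c, d])" using Suc.prems(1) ys(1) by simp_all
    from path_block[OF assms d(1) edges] obtain m where
      "(a = 4 * m \<and> b = 4 * m + 1 \<and> c = 4 * m + 2 \<and> d = 4 * m + 3)
       \<or> (d = 4 * m \<and> c = 4 * m + 1 \<and> b = 4 * m + 2 \<and> a = 4 * m + 3)" ..
    from inv_sign_block[OF this d(2)] have "inv_sign ys = (inv_sign zs :: 'k)" using ys(1) by simp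
    then show ?thesis using IH v True by (simp add: paths_singletons)
  next
    case False
    then have p: "paths {e a} {e b} {e c} {e d} g = 0" by (simp only: paths_singletons if_False)
    show ?thesis unfolding v p by simp
  qed
qed

definition path_graph :: "(nat \<Rightarrow> 'v) \<Rightarrow> nat \<Rightarrow> 'v set set" where
  "path_graph e n = induced (e ` {..<4 * n}) (disjoint_paths e)"

lemma path_graph_graphs: "inj e \<Longrightarrow> path_graph e n \<in> graphs (e ` {..<4 * n})"
  by (auto simp: path_graph_def induced_def graphs_def disjoint_paths_def card_insert_if inj_eq)

lemma singletons_cdom:
  assumes "inj e" "distinct ys" "g \<in> graphs (e ` set ys)"
  shows "(map (\<lambda>i. {e i}) ys, g) \<in> cdom (length ys)"
proof -
  have "disj (map (\<lambda>i. {e i}) ys)" using assms(2)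
    by (induction ys) (use assms(1) in \<open>auto simp: inj_eq\<close>)
  moreover have "ground (map (\<lambda>i. {e i}) ys) = e ` set ys" by auto
  ultimately show ?thesis using assms(3) by (auto simp: cdom_def)
qed

lemma coef_p4_cup_power_standard:
  fixes e :: "nat \<Rightarrow> 'v"
  assumes "inj e"
  shows "coef (p4_cup_power n :: ('v, 'k::field) cochain) (map (\<lambda>i. {e i}) [0..<4 * n]) (path_graph e n) = 1"
proof (induction n)
  case 0
  have "path_graph e 0 = {}" using path_graph_graphs[OF assms, of 0] by (auto simp: graphs_def)
  then show ?case by (simp add: cup_unit_def coef_cochain_of[OF cdom_Nil])
next
  case (Suc n)
  let ?G = "map (\<lambda>i. {e i}) [0..<4 * n]"
  have "4 * Suc n = Suc (Suc (Suc (Suc (4 * n))))" by simp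
  then have "[0..<4 * Suc n] = [0..<4 * n] @ [4 * n, 4 * n + 1, 4 * n + 2, 4 * n + 3]"
    by (simp only: upt_Suc zero_le if_True append.assoc append.simps)
      (simp add: numeral_2_eq_2 numeral_3_eq_3)
  then have split: "map (\<lambda>i. {e i}) [0..<4 * Suc n] = ?G @ [{e (4 * n)}, {e (4 * n + 1)}, {e (4 * n + 2)}, {e (4 * n + 3)}]"
    by simp
  have "(map (\<lambda>i. {e i}) [0..<4 * Suc n], path_graph e (Suc n)) \<in> cdom (4 * Suc n)"
    using singletons_cdom[OF assms, of "[0..<4 * Suc n]" "path_graph e (Suc n)"] path_graph_graphs[OF assms, of "Suc n"]
    by (simp add: atLeast0LessThan)
  then have "coef (p4_cup_power (Suc n)) (map (\<lambda>i. {e i}) [0..<4 * Suc n]) (path_graph e (Suc n))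
      = coef (p4_cup_power n) ?G (induced (ground ?G) (path_graph e (Suc n)))
        * (of_nat (paths {e (4 * n)} {e (4 * n + 1)} {e (4 * n + 2)} {e (4 * n + 3)} (path_graph e (Suc n))) :: 'k)"
    unfolding split by (rule coef_p4_cup_power_Suc)
  moreover have "induced (ground ?G) (path_graph e (Suc n)) = path_graph e n"
  proof -
    have "ground ?G = e ` {..<4 * n}" by auto
    then show ?thesis unfolding path_graph_def by (simp add: induced_induced image_mono)
  qed
  moreover have "{e (4 * n), e (4 * n + 1)} \<in> path_graph e (Suc n)"
    "{e (4 * n + 1), e (4 * n + 2)} \<in> path_graph e (Suc n)"
    "{e (4 * n + 2), e (4 * n + 3)} \<in> path_graph e (Suc n)"
    unfolding path_graph_def induced_def mem_Collect_eq disjoint_paths_iff[OF assms] by (simp_all add: mod_Suc)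
  ultimately show ?case using Suc by (simp add: paths_singletons)
qed

theorem test_p4_cup_power:
  fixes e :: "nat \<Rightarrow> 'v"
  assumes "inj e"
  shows "test (map e [0..<4 * n]) (path_graph e n) (p4_cup_power n :: ('v, 'k::field_char_0) cochain) \<noteq> 0"
  unfolding test_def
proof (rule alt_positive)
  let ?a = "coef (p4_cup_power n :: ('v, 'k) cochain)"
  have dom: "(map (\<lambda>i. {e i}) zs, path_graph e n) \<in> cdom (4 * n)" if "distinct zs" "set zs = {..<4 * n}" for zs
    using singletons_cdom[OF assms that(1), of "path_graph e n"] path_graph_graphs[OF assms, of n]
      that distinct_card[OF that(1)] by simp
  have m: "moebius ?a (map (\<lambda>i. {e i}) zs) (path_graph e n) = ?a (map (\<lambda>i. {e i}) zs) (path_graph e n)"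
    if "distinct zs" "set zs = {..<4 * n}" for zs
    by (rule moebius_singletons[OF p4_cup_power_empty dom[OF that]]) auto
  show "sorted_wrt (<) [0..<4 * n]" by simp
  show "inv_sign zs * moebius ?a (map (\<lambda>i. {e i}) zs) (path_graph e n) \<in> \<nat>"
    if "distinct zs" "set zs = set [0..<4 * n]" for zs
  proof -
    have zs: "set zs = {..<4 * n}" using that(2) by (simp only: set_upt atLeast0LessThan)
    have "path_graph e n \<subseteq> disjoint_paths e" unfolding path_graph_def induced_def by blast
    from coef_p4_cup_power_sign[OF assms that(1) this dom[OF that(1) zs], where 'k = 'k]
    show ?thesis unfolding m[OF that(1) zs]
      by (elim disjE conjE) (simp_all only: mult_zero_right mult_1 Nats_0 Nats_1)
  qed
  show "moebius ?a (map (\<lambda>i. {e i}) [0..<4 * n]) (path_graph e n) \<noteq> 0"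
    using m[of "[0..<4 * n]"] coef_p4_cup_power_standard[OF assms, of n, where 'k = 'k] by (simp add: atLeast0LessThan)
qed

section \<open>Cohomology in degrees one and four\<close>

lemma test_relabel:
  assumes "\<alpha> \<in> cochains (length vs)" "distinct vs" "g \<in> graphs (set vs)" "inj_on \<sigma> (set vs)"
  shows "test (map \<sigma> vs) (relabel \<sigma> g) \<alpha> = test vs g \<alpha>"
  unfolding test_def by (rule alt_relabel[OF wsum_natural[OF coef_natural[OF assms(1)]] assms(2-4)])

lemma relabel_transposition:
  assumes g: "g \<in> graphs I" and twins: "\<And>z. z \<in> I - {a, b} \<Longrightarrow> {a, z} \<in> g \<longleftrightarrow> {b, z} \<in> g"
  shows "relabel (id(a := b, b := a)) g = g"
proof -
  let ?\<sigma> = "id(a := b, b := a)"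
  have sw: "{?\<sigma> p, q} \<in> g \<longleftrightarrow> {p, q} \<in> g" if "p \<in> {a, b}" "q \<in> I - {a, b}" for p q
    using that(1) twins[OF that(2)] by (cases "p = b") (simp_all split: if_splits)
  have fix_other: "?\<sigma> q = q" if "q \<notin> {a, b}" for q using that by simp
  have sub: "relabel ?\<sigma> g \<subseteq> g"
  proof
    fix f assume "f \<in> relabel ?\<sigma> g"
    then obtain e where e: "e \<in> g" "f = ?\<sigma> ` e" unfolding relabel_def by (rule imageE)
    then have "card e = 2" "e \<subseteq> I" using g by (simp_all add: graphs_def)
    then obtain x y where xy: "e = {x, y}" "x \<noteq> y" unfolding card_2_iff by blast
    have I: "x \<in> I" "y \<in> I" using \<open>e \<subseteq> I\<close> xy by simp_all
    have f: "f = {?\<sigma> x, ?\<sigma> y}" unfolding e(2) xy(1) by simp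
    have eg: "{x, y} \<in> g" "{y, x} \<in> g" using e(1) xy(1) by (simp_all add: insert_commute)
    show "f \<in> g"
    proof (cases "x \<in> {a, b}"; cases "y \<in> {a, b}")
      assume "x \<in> {a, b}" "y \<in> {a, b}"
      then have "f = {x, y}" using xy(2) unfolding f by (elim insertE emptyE) (simp_all add: insert_commute)
      then show ?thesis using eg by simp
    next
      assume "x \<in> {a, b}" "y \<notin> {a, b}"
      then show ?thesis using sw[of x y] I eg fix_other[of y] unfolding f by simp
    next
      assume "x \<notin> {a, b}" "y \<in> {a, b}"
      then have "{?\<sigma> y, ?\<sigma> x} \<in> g" using sw[of y x] I eg fix_other[of x] by simp
      then show ?thesis unfolding f by (simp only: insert_commute)
    next
      assume "x \<notin> {a, b}" "y \<notin> {a, b}"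
      then show ?thesis using fix_other[of x] fix_other[of y] eg unfolding f by simp
    qed
  qed
  have "?\<sigma> \<circ> ?\<sigma> = id" by auto
  then have "g = relabel ?\<sigma> (relabel ?\<sigma> g)" unfolding relabel_relabel by (simp add: relabel_def)
  also have "\<dots> \<subseteq> relabel ?\<sigma> g" using sub unfolding relabel_def by blast
  finally show ?thesis using sub by blast
qed

text \<open>
  If two vertices have the same neighbours, then their transposition is an automorphism of the
  graph; alternating functions change sign under it and hence vanish.
\<close>

lemma test_twins:
  fixes \<alpha> :: "('v, 'k::field_char_0) cochain"
  assumes "\<alpha> \<in> cochains (length (a # b # us))" "distinct (a # b # us)" "g \<in> graphs (set (a # b # us))"
    and "\<And>z. z \<in> set us \<Longrightarrow> {a, z} \<in> g \<longleftrightarrow> {b, z} \<in> g"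
  shows "test (a # b # us) g \<alpha> = 0"
proof -
  let ?\<sigma> = "id(a := b, b := a)"
  have "inj ?\<sigma>" by (auto simp: inj_def split: if_splits)
  then have inj: "inj_on ?\<sigma> (set (a # b # us))" by (rule inj_on_subset) simp
  have m: "map ?\<sigma> (a # b # us) = b # a # us" using assms(2) by (auto intro!: map_idI)
  have r: "relabel ?\<sigma> g = g" by (rule relabel_transposition[OF assms(3)]) (use assms(4) in auto)
  have "test (b # a # us) g \<alpha> = test (a # b # us) g \<alpha>"
    using test_relabel[OF assms(1-3) inj] unfolding m r .
  moreover have "test (b # a # us) g \<alpha> = - test (a # b # us) g \<alpha>"
    unfolding test_def by (rule alt_swap)
  ultimately show ?thesis by simp
qed

definition twins :: "'v set set \<Rightarrow> 'v \<Rightarrow> 'v \<Rightarrow> 'v \<Rightarrow> 'v \<Rightarrow> bool" where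
  "twins g w x y z \<longleftrightarrow> ({w, y} \<in> g \<longleftrightarrow> {x, y} \<in> g) \<and> ({w, z} \<in> g \<longleftrightarrow> {x, z} \<in> g)"

definition induced_path :: "'v set set \<Rightarrow> 'v \<Rightarrow> 'v \<Rightarrow> 'v \<Rightarrow> 'v \<Rightarrow> bool" where
  "induced_path g w x y z \<longleftrightarrow> {w, x} \<in> g \<and> {x, y} \<in> g \<and> {y, z} \<in> g \<and> {w, y} \<notin> g \<and> {w, z} \<notin> g \<and> {x, z} \<notin> g"

text \<open>
  The six pairs of twins and the twelve induced paths on the four vertices exhaust the sixty-four edge sets.
\<close>

lemma four_vertices:
  "twins g a b c d \<or> twins g a c b d \<or> twins g a d b c \<or> twins g b c a d \<or> twins g b d a c \<or> twins g c d a b \<or>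
   induced_path g a b c d \<or> induced_path g a b d c \<or> induced_path g a c b d \<or> induced_path g a c d b \<or>
   induced_path g a d b c \<or> induced_path g a d c b \<or> induced_path g b a c d \<or> induced_path g b a d c \<or>
   induced_path g b c a d \<or> induced_path g b d a c \<or> induced_path g c a b d \<or> induced_path g c b a d"
proof -
  have c: "{b, a} = {a, b}" "{c, a} = {a, c}" "{d, a} = {a, d}" "{c, b} = {b, c}" "{d, b} = {b, d}" "{d, c} = {c, d}"
    by auto
  show ?thesis
    unfolding twins_def induced_path_def c
    by (cases "{a, b} \<in> g"; cases "{a, c} \<in> g"; cases "{a, d} \<in> g"; simp only: simp_thms) argo+
qed

lemma four_vertices_cases:
  assumes "distinct [a, b, c, d]"
  obtains (twins) w x y z where "distinct [w, x, y, z]" "{w, x, y, z} = {a, b, c, d}" "twins g w x y z"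
  | (path) w x y z where "distinct [w, x, y, z]" "{w, x, y, z} = {a, b, c, d}" "induced_path g w x y z"
proof -
  let ?D = "\<lambda>w x y z. distinct [w, x, y, z] \<and> {w, x, y, z} = {a, b, c, d}"
  have D: "?D a b c d" "?D a c b d" "?D a d b c" "?D b c a d" "?D b d a c" "?D c d a b"
    "?D a b d c" "?D a c d b" "?D a d c b" "?D b a c d" "?D b a d c" "?D c a b d" "?D c b a d"
    using assms by auto
  have t: thesis if "?D w x y z" "twins g w x y z" for w x y z
    using that(1) by (intro twins[OF _ _ that(2)]) (erule conjunct1, erule conjunct2)
  have p: thesis if "?D w x y z" "induced_path g w x y z" for w x y z
    using that(1) by (intro path[OF _ _ that(2)]) (erule conjunct1, erule conjunct2)
  show thesis
    using four_vertices[of g a b c d]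
    by (elim disjE) (erule t[OF D(1)] t[OF D(2)] t[OF D(3)] t[OF D(4)] t[OF D(5)] t[OF D(6)]
      p[OF D(1)] p[OF D(2)] p[OF D(3)] p[OF D(4)] p[OF D(5)] p[OF D(6)] p[OF D(7)] p[OF D(8)] p[OF D(9)] p[OF D(10)] p[OF D(11)] p[OF D(12)] p[OF D(13)])+
qed

lemma induced_path_eq:
  assumes "induced_path g w x y z" "g \<in> graphs {w, x, y, z}"
  shows "g = {{w, x}, {x, y}, {y, z}}"
proof
  show "g \<subseteq> {{w, x}, {x, y}, {y, z}}"
  proof
    fix f assume f: "f \<in> g"
    then have "card f = 2" "f \<subseteq> {w, x, y, z}" using assms(2) by (auto simp: graphs_def)
    then obtain p q where pq: "f = {p, q}" "p \<noteq> q" by (auto simp: card_2_iff)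
    have "p \<in> {w, x, y, z}" "q \<in> {w, x, y, z}" using pq \<open>f \<subseteq> {w, x, y, z}\<close> by auto
    then show "f \<in> {{w, x}, {x, y}, {y, z}}"
      using f assms(1) pq unfolding induced_path_def by (auto simp: insert_commute)
  qed
  show "{{w, x}, {x, y}, {y, z}} \<subseteq> g" using assms(1) by (auto simp: induced_path_def)
qed

lemma path_graph_1:
  assumes "inj e"
  shows "path_graph e 1 = {{e 0, e 1}, {e 1, e 2}, {e 2, e 3}}"
proof (rule induced_path_eq)
  have U: "e ` {..<4 * 1} = {e 0, e 1, e 2, e 3}"
    by (auto simp: numeral_eq_Suc lessThan_Suc)
  show "path_graph e 1 \<in> graphs {e 0, e 1, e 2, e 3}"
    using path_graph_graphs[OF assms, of 1] unfolding U .
  show "induced_path (path_graph e 1) (e 0) (e 1) (e 2) (e 3)"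
    unfolding induced_path_def path_graph_def U induced_def mem_Collect_eq disjoint_paths_iff[OF assms] by simp
qed

lemma test_induced_path:
  assumes e: "inj e" and \<alpha>: "\<alpha> \<in> cochains 4"
    and p: "induced_path g w x y z" "g \<in> graphs {w, x, y, z}" "distinct [w, x, y, z]"
  shows "test [w, x, y, z] g \<alpha> = test (map e [0..<4]) (path_graph e 1) \<alpha>"
proof -
  have vs: "map e [0..<4] = [e 0, e 1, e 2, e 3]"
    by (simp add: upt_rec numeral_eq_Suc)
  define \<sigma> where "\<sigma> v = (if v = e 0 then w else if v = e 1 then x else if v = e 2 then y else z)" for v
  have \<sigma>: "\<sigma> (e 0) = w" "\<sigma> (e 1) = x" "\<sigma> (e 2) = y" "\<sigma> (e 3) = z"
    unfolding \<sigma>_def using inj_eq[OF e] by simp_all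
  have inj: "inj_on \<sigma> (set (map e [0..<4]))"
    unfolding vs using p(3) by (auto simp: \<sigma> \<sigma>(2)[unfolded One_nat_def] inj_on_def)
  have d: "distinct (map e [0..<4])"
    using e by (simp add: distinct_map inj_on_subset[OF e])
  have U: "e ` {..<4 * 1} = set (map e [0..<4])" by (simp add: atLeast0LessThan)
  have gr: "path_graph e 1 \<in> graphs (set (map e [0..<4]))"
    using path_graph_graphs[OF e, of 1] unfolding U .
  have r: "relabel \<sigma> (path_graph e 1) = g"
    unfolding path_graph_1[OF e] induced_path_eq[OF p(1,2)] by (simp add: relabel_def \<sigma> \<sigma>(2)[unfolded One_nat_def])
  have m: "map \<sigma> (map e [0..<4]) = [w, x, y, z]"
    unfolding vs by (simp add: \<sigma> \<sigma>(2)[unfolded One_nat_def])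
  show ?thesis
    using test_relabel[OF _ d gr inj, of \<alpha>] \<alpha> unfolding m r by simp
qed

text \<open>
  A class spans its degree as soon as a multiple of it can be subtracted from every cocycle
  so that the difference is annihilated by all alternating functionals.
\<close>

lemma cohomology_deg_spanned:
  fixes \<omega> :: "('v, 'k::field_char_0) cochain" and S :: "nat \<Rightarrow> 'v set"
  assumes \<omega>: "\<omega> \<in> cocycles (Suc n)"
    and S: "\<And>m. finite (S m)" "\<And>m. card (S m) = m"
    and test: "\<And>\<alpha>. \<alpha> \<in> cocycles (Suc n) \<Longrightarrow> \<exists>c. \<forall>g\<in>graphs (S (Suc n)). \<exists>vs.
      distinct vs \<and> set vs = S (Suc n) \<and> test vs g (\<alpha> + sc (- c) \<omega>) = 0"
  shows "cohomology_deg (Suc n) = {c \<odot>\<^bsub>cohomology\<^esub> cohomology_class (Suc n) \<omega> | c. True}"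
proof -
  have sm: "c \<odot>\<^bsub>cohomology\<^esub> cohomology_class (Suc n) \<omega> = cls (homogeneous (Suc n) (sc c \<omega>))" for c
    unfolding cohomology_class_cls H_scale[OF ZA_homogeneous[OF \<omega>]] scale_homogeneous ..
  have "\<exists>c. cls (homogeneous (Suc n) \<alpha>) = cls (homogeneous (Suc n) (sc c \<omega>))" if \<alpha>: "\<alpha> \<in> cocycles (Suc n)" for \<alpha>
  proof -
    obtain c where c: "\<And>g. g \<in> graphs (S (Suc n)) \<Longrightarrow> \<exists>vs.
      distinct vs \<and> set vs = S (Suc n) \<and> test vs g (\<alpha> + sc (- c) \<omega>) = 0"
      using test[OF \<alpha>] by blast
    have "\<alpha> + sc (- c) \<omega> \<in> cocycles (Suc n)"
      by (rule cocycles_add[OF \<alpha> cocycles_sc[OF \<omega>]])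
    from cocycle_exact[OF this S c] obtain \<gamma> where \<gamma>: "\<gamma> \<in> cochains n" "coboundary n \<gamma> = \<alpha> + sc (- c) \<omega>"
      by blast
    have "\<alpha> = coboundary n \<gamma> + sc c \<omega>"
      unfolding \<gamma>(2) by (intro ext) (simp add: sc_def)
    from cls_homogeneous_eqI[OF \<alpha> cocycles_sc[OF \<omega>] \<gamma>(1) this] show ?thesis by blast
  qed
  moreover have "cls (homogeneous (Suc n) (sc c \<omega>)) \<in> cohomology_deg (Suc n)" for c
    unfolding cohomology_deg_def cohomology_class_cls using cocycles_sc[OF \<omega>] by blast
  ultimately show ?thesis
    unfolding sm unfolding cohomology_deg_def cohomology_class_cls by blast
qed

lemma test_kappa:
  "test [v] {} (kappa :: ('v, 'k::field) cochain) = 1"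
proof -
  have F: "([{v}], {}) \<in> cdom (Suc 0)" by (simp add: cdom_def graphs_def)
  have "moebius (coef (kappa :: ('v, 'k) cochain)) [{v}] {} = coef kappa [{v}] {}"
  proof (rule moebius_singletons[OF _ F])
    fix F :: "'v set list" and g assume "(F, g) \<in> cdom (Suc 0)" "{} \<in> set F"
    then show "coef (kappa :: ('v, 'k) cochain) F g = 0"
      using coef_kappa[of F g, where 'b = 'k] by (auto simp: cdom_def length_1)
  qed auto
  then show ?thesis
    unfolding test_def using F coef_kappa[of "[{v}]" "{}", where 'b = 'k] by simp
qed

lemma graphs_singleton: "graphs {v} = {{}}"
proof -
  have "False" if "f \<subseteq> {v}" "card f = 2" for f :: "'a set"
    using card_mono[of "{v}" f] that by simp
  then show ?thesis by (auto simp: graphs_def)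
qed

lemma H1_spanned:
  assumes e: "inj (e :: nat \<Rightarrow> 'v)"
  shows "cohomology_deg 1 = {c \<odot>\<^bsub>(cohomology :: ('k::field_char_0, (nat \<Rightarrow> ('v, 'k) cochain) set) module)\<^esub>
     cohomology_class 1 kappa | c. True}"
  unfolding One_nat_def
proof (rule cohomology_deg_spanned[where S = "\<lambda>m. e ` {..<m}"])
  show "kappa \<in> cocycles (Suc 0)" using kappa_cocycle by simp
  show "card (e ` {..<m}) = m" for m using card_image[OF inj_on_subset[OF e]] by simp
  fix \<alpha> :: "('v, 'k) cochain"
  have "test [e 0] {} (\<alpha> + sc (- test [e 0] {} \<alpha>) kappa) = 0"
    unfolding test_add test_sc test_kappa by simp
  moreover have "e ` {..<Suc 0} = {e 0}" by auto
  ultimately show "\<exists>c. \<forall>g\<in>graphs (e ` {..<Suc 0}). \<exists>vs. distinct vs \<and> set vs = e ` {..<Suc 0} \<and> test vs g (\<alpha> + sc (- c) kappa) = 0"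
    by (intro exI[of _ "test [e 0] {} \<alpha>"] ballI exI[of _ "[e 0]"]) (simp add: graphs_singleton)
qed simp

lemma p4_cup_power_1: "p4_cup_power 1 = p4"
proof -
  have "p4 \<in> cochains 4" using p4_cocycle by (auto simp: cocycles_def)
  then show ?thesis using cup_unit_left[of p4 4] by simp
qed

lemma H4_spanned:
  assumes e: "inj (e :: nat \<Rightarrow> 'v)"
  shows "cohomology_deg 4 = {c \<odot>\<^bsub>(cohomology :: ('k::field_char_0, (nat \<Rightarrow> ('v, 'k) cochain) set) module)\<^esub>
     cohomology_class 4 p4 | c. True}"
proof -
  have four: "4 = Suc 3" by simp
  show ?thesis
    unfolding four
  proof (rule cohomology_deg_spanned[where S = "\<lambda>m. e ` {..<m}"])
    show p4: "p4 \<in> cocycles (Suc 3)" using p4_cocycle by simp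
    show "card (e ` {..<m}) = m" for m using card_image[OF inj_on_subset[OF e]] by simp
    fix \<alpha> :: "('v, 'k) cochain" assume \<alpha>: "\<alpha> \<in> cocycles (Suc 3)"
    let ?vs = "map e [0..<4]" and ?g = "path_graph e 1"
    \<comment> \<open>The multiple of p4 that agrees with the cocycle on the path, the only graph without twins.\<close>
    define c where "c = test ?vs ?g \<alpha> / test ?vs ?g p4"
    define \<beta> where "\<beta> = \<alpha> + sc (- c) p4"
    have "\<beta> \<in> cocycles (Suc 3)" unfolding \<beta>_def by (rule cocycles_add[OF \<alpha> cocycles_sc[OF p4]])
    then have \<beta>: "\<beta> \<in> cochains 4" by (simp add: cocycles_def)
    have "test ?vs ?g (p4 :: ('v, 'k) cochain) \<noteq> 0"
      using test_p4_cup_power[OF e, of 1, where 'k = 'k] unfolding p4_cup_power_1 by simp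
    then have \<beta>0: "test ?vs ?g \<beta> = 0"
      unfolding \<beta>_def test_add test_sc c_def by simp
    have S: "e ` {..<Suc 3} = {e 0, e 1, e 2, e 3}"
      by (auto simp: numeral_eq_Suc lessThan_Suc)
    have d: "distinct [e 0, e 1, e 2, e 3]" using inj_eq[OF e] by simp
    have "\<exists>vs. distinct vs \<and> set vs = e ` {..<Suc 3} \<and> test vs g \<beta> = 0" if g: "g \<in> graphs (e ` {..<Suc 3})" for g
    proof (rule four_vertices_cases[OF d, of g])
      fix w x y z assume twins: "distinct [w, x, y, z]" "{w, x, y, z} = {e 0, e 1, e 2, e 3}" "twins g w x y z"
      have "test [w, x, y, z] g \<beta> = 0"
      proof (rule test_twins)
        show "\<beta> \<in> cochains (length [w, x, y, z])" using \<beta> by (simp add: eval_nat_numeral)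
        show "g \<in> graphs (set [w, x, y, z])" using g twins(2) unfolding S by simp
      qed (use twins(1,3) in \<open>auto simp: twins_def\<close>)
      then show ?thesis using twins unfolding S by (intro exI[of _ "[w, x, y, z]"]) simp
    next
      fix w x y z assume path: "distinct [w, x, y, z]" "{w, x, y, z} = {e 0, e 1, e 2, e 3}" "induced_path g w x y z"
      have "test [w, x, y, z] g \<beta> = 0"
        using test_induced_path[OF e \<beta> path(3) _ path(1)] \<beta>0 g path(2) unfolding S by simp
      then show ?thesis using path unfolding S by (intro exI[of _ "[w, x, y, z]"]) simp
    qed
    then show "\<exists>c. \<forall>g\<in>graphs (e ` {..<Suc 3}). \<exists>vs. distinct vs \<and> set vs = e ` {..<Suc 3} \<and> test vs g (\<alpha> + sc (- c) p4) = 0"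
      unfolding \<beta>_def by blast
  qed simp
qed

section \<open>The exterior and the polynomial subalgebra\<close>

lemma p4_power:
  "cohomology_class 4 p4 [^]\<^bsub>(cohomology :: ('k::field, (nat \<Rightarrow> ('v, 'k) cochain) set) module)\<^esub> n
     = cls (homogeneous (4 * n) (p4_cup_power n))"
proof (induction n)
  case 0
  show ?case by (simp only: nat_pow_def nat.rec H_one p4_cup_power.simps mult_0_right)
next
  case (Suc n)
  have "cohomology_class 4 p4 [^]\<^bsub>(cohomology :: ('k, (nat \<Rightarrow> ('v, 'k) cochain) set) module)\<^esub> Suc n
      = cls (homogeneous (4 * n) (p4_cup_power n)) \<otimes>\<^bsub>cohomology\<^esub> cls (homogeneous 4 p4)"
    using Suc by (simp add: nat_pow_def cohomology_class_cls)
  also have "\<dots> = cls (homogeneous (4 * n + 4) (cup (4 * n) 4 (p4_cup_power n) p4))"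
    unfolding H_cls(2)[OF ZA_homogeneous[OF p4_cup_power_cocycle] ZA_homogeneous[OF p4_cocycle]] seq_cup_homogeneous ..
  finally show ?case by (simp add: add.commute)
qed

lemma test_homogeneous_class:
  assumes "\<alpha> \<in> cocycles n" "length vs = n" "distinct vs" "g \<in> graphs (set vs)"
    "cls (homogeneous n \<alpha>) = cls 0"
  shows "test vs g \<alpha> = 0"
proof -
  have z: "0 \<in> carrier cocycle_algebra"
    unfolding ZA_simps(1) using CA_zero differential_0 by blast
  show ?thesis
    using test_class[OF ZA_homogeneous[OF assms(1)] z assms(5,3,4)] assms(2)
    by (simp only: homogeneous_simps zero_fun_apply test_zero)
qed

lemma standard_facts:
  assumes e: "inj (e :: nat \<Rightarrow> 'v)"
  shows "distinct (map e [0..<m])" "length (map e [0..<m]) = m" "path_graph e n \<in> graphs (set (map e [0..<4 * n]))"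
  using e path_graph_graphs[OF e, of n] by (simp_all add: distinct_map inj_on_subset[OF e] atLeast0LessThan)

lemma p4_cup_power_class_nonzero:
  assumes e: "inj (e :: nat \<Rightarrow> 'v)"
  shows "cls (homogeneous (4 * n) (p4_cup_power n :: ('v, 'k::field_char_0) cochain)) \<noteq> cls 0"
  using test_homogeneous_class[OF p4_cup_power_cocycle standard_facts(2,1,3)[OF e], where 'b = 'k] test_p4_cup_power[OF e, of n, where 'k = 'k] by blast

text \<open>
  The evaluation of a polynomial at \<open>p4\<close> in the ring of cocycles.
\<close>

definition poly_cocycle :: "'k::field poly \<Rightarrow> nat \<Rightarrow> ('v, 'k) cochain" where
  "poly_cocycle f n = (if 4 dvd n then sc (Polynomial.coeff f (n div 4)) (p4_cup_power (n div 4)) else 0)"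

lemma poly_cocycle_4: "poly_cocycle f (4 * n) = sc (Polynomial.coeff f n) (p4_cup_power n)"
  by (simp add: poly_cocycle_def)

lemma poly_cocycle_other: "\<not> 4 dvd n \<Longrightarrow> poly_cocycle f n = 0"
  by (simp only: poly_cocycle_def if_False)

lemma fun4_eqI:
  fixes a b :: "nat \<Rightarrow> ('v, 'k::field) cochain"
  assumes "\<And>m. a (4 * m) = b (4 * m)" "\<And>n. \<not> 4 dvd n \<Longrightarrow> a n = b n"
  shows "a = b"
proof
  fix n
  show "a n = b n"
  proof (cases "4 dvd n")
    case True
    then obtain m where "n = 4 * m" by (rule dvdE)
    then show ?thesis using assms(1) by simp
  next
    case False
    then show ?thesis by (rule assms(2))
  qed
qed

lemma poly_cocycle_carrier:
  "(poly_cocycle f :: nat \<Rightarrow> ('v, 'k::field) cochain) \<in> carrier cocycle_algebra"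
proof -
  let ?P = "poly_cocycle f :: nat \<Rightarrow> ('v, 'k) cochain"
  have c: "?P n \<in> cocycles n" for n
  proof (cases "4 dvd n")
    case True
    then obtain m where m: "n = 4 * m" by (rule dvdE)
    show ?thesis unfolding m poly_cocycle_4 by (rule cocycles_sc[OF p4_cup_power_cocycle])
  next
    case False
    have "(0 :: ('v, 'k) cochain) \<in> cocycles n" unfolding cocycles_def using zero_in_cochains coboundary_0 by blast
    then show ?thesis unfolding poly_cocycle_other[OF False] .
  qed
  have "?P \<in> carrier cochain_algebra"
  proof (rule CA_carrierI)
    show "?P n \<in> cochains n" for n using c[of n] unfolding cocycles_def by blast
    have "{n. ?P n \<noteq> 0} \<subseteq> (\<lambda>m. 4 * m) ` {..Polynomial.degree f}"
    proof
      fix n assume "n \<in> {n. ?P n \<noteq> 0}"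
      then have n: "?P n \<noteq> 0" by (rule CollectD)
      then obtain m where m: "n = 4 * m" using poly_cocycle_other by (metis dvdE)
      have "Polynomial.coeff f m \<noteq> 0"
      proof
        assume "Polynomial.coeff f m = 0"
        then have "?P n = 0" unfolding m poly_cocycle_4 by (simp only: sc_simps)
        with n show False by contradiction
      qed
      then show "n \<in> (\<lambda>m. 4 * m) ` {..Polynomial.degree f}" using m Polynomial.le_degree by blast
    qed
    then show "finite {n. ?P n \<noteq> 0}" by (rule finite_subset) simp
  qed
  moreover have "differential ?P = 0"
  proof
    fix n
    show "differential ?P n = 0 n"
    proof (cases n)
      case (Suc m)
      have "coboundary m (?P m) = 0" using c[of m] unfolding cocycles_def by blast
      then show ?thesis unfolding Suc differential_simps by (simp only: zero_fun_apply)
    qed (simp only: differential_simps zero_fun_apply)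
  qed
  ultimately show ?thesis unfolding ZA_simps(1) by blast
qed

lemma poly_cocycle_add: "poly_cocycle (f + g) = poly_cocycle f + poly_cocycle g"
proof (rule fun4_eqI)
  show "poly_cocycle (f + g) (4 * m) = (poly_cocycle f + poly_cocycle g) (4 * m)" for m
    by (simp only: plus_fun_apply poly_cocycle_4 Polynomial.coeff_add sc_simps)
  show "poly_cocycle (f + g) n = (poly_cocycle f + poly_cocycle g) n" if "\<not> 4 dvd n" for n
    using that by (simp only: plus_fun_apply poly_cocycle_other add_0 not_False_eq_True)
qed

lemma poly_cocycle_scale: "poly_cocycle (Polynomial.smult c f) = scale c (poly_cocycle f)"
proof (rule fun4_eqI)
  show "poly_cocycle (Polynomial.smult c f) (4 * m) = scale c (poly_cocycle f) (4 * m)" for m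
    by (simp only: scale_eq poly_cocycle_4 Polynomial.coeff_smult sc_simps)
  show "poly_cocycle (Polynomial.smult c f) n = scale c (poly_cocycle f) n" if "\<not> 4 dvd n" for n
    using that by (simp only: scale_eq poly_cocycle_other sc_simps not_False_eq_True)
qed

lemma poly_cocycle_monom: "poly_cocycle (Polynomial.monom 1 k) = homogeneous (4 * k) (p4_cup_power k)"
proof (rule fun4_eqI)
  show "poly_cocycle (Polynomial.monom 1 k) (4 * m) = homogeneous (4 * k) (p4_cup_power k) (4 * m)" for m
  proof (cases "m = k")
    case True
    then show ?thesis by (simp only: poly_cocycle_4 Polynomial.coeff_monom homogeneous_simps sc_simps if_True simp_thms)
  next
    case False
    then have "4 * m \<noteq> 4 * k" by simp
    then show ?thesis using False
      by (simp only: poly_cocycle_4 Polynomial.coeff_monom homogeneous_simps sc_simps if_False not_sym not_False_eq_True)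
  qed
  show "poly_cocycle (Polynomial.monom 1 k) n = homogeneous (4 * k) (p4_cup_power k) n" if "\<not> 4 dvd n" for n
  proof -
    have "n \<noteq> 4 * k" using that by auto
    then show ?thesis using that by (simp only: poly_cocycle_other homogeneous_simps not_False_eq_True)
  qed
qed

lemma sum_sc: "(\<Sum>i\<in>A. sc (f i) \<alpha>) = sc (\<Sum>i\<in>A. f i) \<alpha>"
  by (induction A rule: infinite_finite_induct)
    (simp_all only: sum.infinite sum.empty sum.insert sc_simps not_False_eq_True)

lemma poly_cocycle_mult: "poly_cocycle (f * g) = seq_cup (poly_cocycle f) (poly_cocycle g)"
proof (rule fun4_eqI)
  fix m
  let ?t = "\<lambda>p. cup p (4 * m - p) (poly_cocycle f p) (poly_cocycle g (4 * m - p))"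
  have "seq_cup (poly_cocycle f) (poly_cocycle g) (4 * m) = (\<Sum>p\<in>(\<lambda>i. 4 * i) ` {..m}. ?t p)"
    unfolding seq_cup_def
  proof (rule sum.mono_neutral_right)
    show "\<forall>p\<in>{..4 * m} - (\<lambda>i. 4 * i) ` {..m}. ?t p = 0"
    proof
      fix p assume p: "p \<in> {..4 * m} - (\<lambda>i. 4 * i) ` {..m}"
      have "\<not> 4 dvd p"
      proof
        assume "4 dvd p"
        then obtain i where "p = 4 * i" by (rule dvdE)
        then show False using p by auto
      qed
      then show "?t p = 0" by (simp only: poly_cocycle_other cup_0 not_False_eq_True)
    qed
  qed auto
  also have "\<dots> = (\<Sum>i\<le>m. ?t (4 * i))"
    by (subst sum.reindex) (simp_all add: inj_on_def)
  also have "\<dots> = (\<Sum>i\<le>m. sc (Polynomial.coeff f i * Polynomial.coeff g (m - i)) (p4_cup_power m))"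
  proof (rule sum.cong[OF refl])
    fix i assume i: "i \<in> {..m}"
    have d: "4 * m - 4 * i = 4 * (m - i)" by simp
    have a: "i + (m - i) = m" using i by simp
    show "?t (4 * i) = sc (Polynomial.coeff f i * Polynomial.coeff g (m - i)) (p4_cup_power m)"
      unfolding d poly_cocycle_4 cup_sc_left cup_sc_right cup_p4_cup_power a sc_simps(5)
      by (simp only: mult.commute)
  qed
  also have "\<dots> = poly_cocycle (f * g) (4 * m)"
    unfolding sum_sc poly_cocycle_4 Polynomial.coeff_mult ..
  finally show "poly_cocycle (f * g) (4 * m) = seq_cup (poly_cocycle f) (poly_cocycle g) (4 * m)" ..
next
  fix n :: nat assume n: "\<not> 4 dvd n"
  have "cup p (n - p) (poly_cocycle f p) (poly_cocycle g (n - p)) = 0" if "p \<le> n" for p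
  proof (cases "4 dvd p")
    case True
    then have "\<not> 4 dvd n - p" using n that by (metis dvd_diffD)
    then show ?thesis by (simp only: poly_cocycle_other cup_0 not_False_eq_True)
  next
    case False
    then show ?thesis by (simp only: poly_cocycle_other cup_0 not_False_eq_True)
  qed
  then show "poly_cocycle (f * g) n = seq_cup (poly_cocycle f) (poly_cocycle g) n"
    unfolding poly_cocycle_other[OF n] seq_cup_def by (intro sum.neutral[symmetric] ballI) (simp only: atMost_iff)
qed

lemma polynomial_embedding:
  assumes e: "inj (e :: nat \<Rightarrow> 'v)"
  shows "\<exists>\<psi>\<in>algebra_hom polynomial_algebra (cohomology :: ('k::field_char_0, (nat \<Rightarrow> ('v, 'k) cochain) set) module).
    inj \<psi> \<and> \<psi> [:0, 1:] = cohomology_class 4 p4"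
proof (intro bexI conjI)
  let ?\<psi> = "\<lambda>f. cls (poly_cocycle f :: nat \<Rightarrow> ('v, 'k) cochain)"
  show "?\<psi> \<in> algebra_hom polynomial_algebra cohomology"
  proof (rule class_hom)
    show "poly_cocycle (\<one>\<^bsub>polynomial_algebra\<^esub>) = homogeneous 0 cup_unit"
      using poly_cocycle_monom[of 0] by (simp add: polynomial_algebra_def)
    fix f g :: "'k poly"
    have "poly_cocycle (f * g) = differential 0 + seq_cup (poly_cocycle f) (poly_cocycle g)"
      unfolding differential_0 poly_cocycle_mult by (simp only: add_0)
    then show "f \<otimes>\<^bsub>polynomial_algebra\<^esub> g \<in> carrier polynomial_algebra \<and> (\<exists>c\<in>carrier cochain_algebra.
        poly_cocycle (f \<otimes>\<^bsub>polynomial_algebra\<^esub> g) = differential c + seq_cup (poly_cocycle f) (poly_cocycle g))"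
      using CA_zero by (auto simp only: polynomial_algebra_def partial_object.simps monoid.simps UNIV_I simp_thms)
  qed (simp_all only: poly_cocycle_carrier polynomial_algebra_def poly_cocycle_add poly_cocycle_scale ring.simps module.simps)
  show "inj ?\<psi>"
  proof (rule injI, rule poly_eqI)
    fix f g :: "'k poly" and n
    assume fg: "?\<psi> f = ?\<psi> g"
    let ?vs = "map e [0..<4 * n]"
    have "test ?vs (path_graph e n) (poly_cocycle f (length ?vs) :: ('v, 'k) cochain) = test ?vs (path_graph e n) (poly_cocycle g (length ?vs) :: ('v, 'k) cochain)"
      by (rule test_class[OF poly_cocycle_carrier poly_cocycle_carrier fg standard_facts(1,3)[OF e]])
    then show "Polynomial.coeff f n = Polynomial.coeff g n"
      unfolding standard_facts(2)[OF e] poly_cocycle_4 test_sc using test_p4_cup_power[OF e, of n, where 'k = 'k] by simp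
  qed
  show "?\<psi> [:0, 1:] = cohomology_class 4 p4"
  proof -
    have "[:0, 1:] = Polynomial.monom (1 :: 'k) 1" by (simp add: Polynomial.monom_Suc Polynomial.monom_0)
    then show ?thesis by (simp only: cohomology_class_cls poly_cocycle_monom p4_cup_power_1 mult_1_right)
  qed
qed

definition ext_cocycle :: "'k \<times> 'k \<Rightarrow> nat \<Rightarrow> ('v, 'k::field) cochain" where
  "ext_cocycle x = homogeneous 0 (sc (fst x) cup_unit) + homogeneous 1 (sc (snd x) kappa)"

lemma ext_cocycle_carrier: "ext_cocycle x \<in> carrier cocycle_algebra"
  unfolding ext_cocycle_def
  by (intro ZA_add ZA_homogeneous cocycles_sc unit_cocycle kappa_cocycle)

text \<open>
  The discrepancy is a multiple of the square of \<open>kappa\<close>, which is bounded by \<open>coboundary_square_coef\<close>;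
  the factor one half comes from there.
\<close>

lemma ext_cocycle_mult:
  fixes a b c d :: "'k::field_char_0"
  shows "\<exists>h\<in>carrier cochain_algebra. (ext_cocycle (a * c, a * d + b * c) :: nat \<Rightarrow> ('v, 'k) cochain)
    = differential h + seq_cup (ext_cocycle (a, b)) (ext_cocycle (c, d))"
proof
  let ?u = "cup_unit :: ('v, 'k) cochain" and ?k = "kappa :: ('v, 'k) cochain"
  \<comment> \<open>The coboundary of the square is minus twice the cup square of kappa.\<close>
  let ?q = "sc (b * d / 2) (cochain_of 1 square_coef) :: ('v, 'k) cochain"
  have q: "?q \<in> cochains 1"
    using cochain_of_in_cochains[OF square_coef_natural] by (intro sc_in_cochains) simp
  show "homogeneous 1 ?q \<in> carrier cochain_algebra" by (rule CA_homogeneous[OF q])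
  have k: "?k \<in> cochains 1" using kappa_cocycle unfolding cocycles_def by blast
  have "coboundary 1 ?q = sc (- (b * d)) (cup 1 1 ?k ?k)"
    unfolding coboundary_sc coboundary_square_coef sc_simps(5) by simp
  then have dq: "differential (homogeneous 1 ?q) = homogeneous 2 (sc (- (b * d)) (cup 1 1 ?k ?k))"
    unfolding differential_homogeneous[OF q] by (simp add: numeral_2_eq_2)
  have "seq_cup (ext_cocycle (a, b)) (ext_cocycle (c, d))
      = homogeneous 0 (sc (a * c) ?u) + homogeneous 1 (sc (a * d) ?k)
        + (homogeneous 1 (sc (b * c) ?k) + homogeneous 2 (sc (b * d) (cup 1 1 ?k ?k)))"
    unfolding ext_cocycle_def fst_conv snd_conv seq_cup_add_left seq_cup_add_right seq_cup_homogeneous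
      cup_sc_left cup_sc_right sc_simps(5) cup_unit_left[OF cup_unit_in_cochains]
      cup_unit_left[OF k] cup_unit_right[OF k] add_0_left add_0_right one_add_one
    by (simp only: ac_simps)
  then show "ext_cocycle (a * c, a * d + b * c) = differential (homogeneous 1 ?q) + seq_cup (ext_cocycle (a, b)) (ext_cocycle (c, d))"
    unfolding dq ext_cocycle_def fst_conv snd_conv
    by (intro ext) (simp add: homogeneous_def sc_def algebra_simps)
qed

lemma exterior_embedding:
  assumes e: "inj (e :: nat \<Rightarrow> 'v)"
  shows "\<exists>\<phi>\<in>algebra_hom exterior_algebra (cohomology :: ('k::field_char_0, (nat \<Rightarrow> ('v, 'k) cochain) set) module).
    inj \<phi> \<and> \<phi> (0, 1) = cohomology_class 1 kappa"
proof (intro bexI conjI)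
  let ?\<phi> = "\<lambda>x. cls (ext_cocycle x :: nat \<Rightarrow> ('v, 'k) cochain)"
  have E: "carrier exterior_algebra = (UNIV :: ('k \<times> 'k) set)"
    "x \<otimes>\<^bsub>exterior_algebra\<^esub> y = (fst x * fst y, fst x * snd y + snd x * fst y)"
    "x \<oplus>\<^bsub>exterior_algebra\<^esub> y = (fst x + fst y, snd x + snd y)"
    "\<one>\<^bsub>exterior_algebra\<^esub> = (1, 0 :: 'k)"
    "c \<odot>\<^bsub>exterior_algebra\<^esub> x = (c * fst x, c * snd x)" for x y :: "'k \<times> 'k" and c :: 'k
    by (simp_all add: exterior_algebra_def case_prod_unfold)
  show "?\<phi> \<in> algebra_hom exterior_algebra cohomology"
  proof (rule class_hom)
    fix x y :: "'k \<times> 'k" and c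
    show "ext_cocycle x \<in> carrier cocycle_algebra" by (rule ext_cocycle_carrier)
    show "ext_cocycle (x \<oplus>\<^bsub>exterior_algebra\<^esub> y) = ext_cocycle x + ext_cocycle y"
      unfolding E ext_cocycle_def by (intro ext) (simp add: homogeneous_def sc_def algebra_simps)
    show "ext_cocycle (\<one>\<^bsub>exterior_algebra\<^esub> :: 'k \<times> 'k) = (homogeneous 0 cup_unit :: nat \<Rightarrow> ('v, 'k) cochain)"
      unfolding E ext_cocycle_def by (intro ext) (simp add: homogeneous_def sc_def)
    show "ext_cocycle (c \<odot>\<^bsub>exterior_algebra\<^esub> x) = scale c (ext_cocycle x)"
      unfolding E ext_cocycle_def by (intro ext) (simp add: homogeneous_def sc_def scale_def algebra_simps)
    show "x \<otimes>\<^bsub>exterior_algebra\<^esub> y \<in> carrier exterior_algebra \<and> (\<exists>c\<in>carrier cochain_algebra.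
        ext_cocycle (x \<otimes>\<^bsub>exterior_algebra\<^esub> y) = differential c + seq_cup (ext_cocycle x) (ext_cocycle y))"
      unfolding E using ext_cocycle_mult[of "fst x" "fst y" "snd y" "snd x"] by simp
  qed
  show "inj ?\<phi>"
  proof (rule injI)
    fix x y :: "'k \<times> 'k"
    assume eq: "?\<phi> x = ?\<phi> y"
    have coef: "ext_cocycle x 0 = sc (fst x) cup_unit" "ext_cocycle x 1 = sc (snd x) kappa" for x :: "'k \<times> 'k"
      unfolding ext_cocycle_def by (intro ext; simp add: homogeneous_def)+
    have "test [] {} (ext_cocycle x 0 :: ('v, 'k) cochain) = test [] {} (ext_cocycle y 0 :: ('v, 'k) cochain)"
      using test_class[OF ext_cocycle_carrier ext_cocycle_carrier eq, of "[]" "{}"] by (simp add: graphs_def)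
    moreover have "test [] {} (cup_unit :: ('v, 'k) cochain) \<noteq> 0"
    proof -
      have "path_graph e 0 = {}" using path_graph_graphs[OF e, of 0] by (auto simp: graphs_def)
      then show ?thesis using test_p4_cup_power[OF e, of 0, where 'k = 'k] by simp
    qed
    ultimately have 0: "fst x = fst y" unfolding coef test_sc by simp
    have "test [e 0] {} (ext_cocycle x 1 :: ('v, 'k) cochain) = test [e 0] {} (ext_cocycle y 1 :: ('v, 'k) cochain)"
      using test_class[OF ext_cocycle_carrier ext_cocycle_carrier eq, of "[e 0]" "{}"] by (simp add: graphs_def)
    then have 1: "snd x = snd y" unfolding coef test_sc test_kappa by simp
    show "x = y" using 0 1 by (rule prod_eqI)
  qed
  show "?\<phi> (0, 1) = cohomology_class 1 kappa"
  proof -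
    have "ext_cocycle (0, 1) = homogeneous 1 (kappa :: ('v, 'k) cochain)"
      unfolding ext_cocycle_def by (intro ext) (simp add: homogeneous_def sc_def)
    then show ?thesis unfolding cohomology_class_cls by simp
  qed
qed

theorem mainTheorem12:
  assumes "infinite (UNIV :: 'v set)"
  shows
    "let H = (cohomology :: ('k::field_char_0, (nat \<Rightarrow> ('v, 'k) cochain) set) module);
         k = cohomology_class 1 kappa;
         p = cohomology_class 4 p4
     in
       (kappa :: ('v, 'k) cochain) \<in> cocycles 1 \<and>
       cohomology_deg 1 = {c \<odot>\<^bsub>H\<^esub> k | c. True} \<and>
       (p4 :: ('v, 'k) cochain) \<in> cocycles 4 \<and>
       cohomology_deg 4 = {c \<odot>\<^bsub>H\<^esub> p | c. True} \<and>
       (\<forall>n\<ge>1. p [^]\<^bsub>H\<^esub> (n::nat) \<noteq> \<zero>\<^bsub>H\<^esub> \<and> cohomology_deg (4 * n) \<noteq> {\<zero>\<^bsub>H\<^esub>}) \<and>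
       (\<exists>\<phi>\<in>algebra_hom exterior_algebra H. inj \<phi> \<and> \<phi> (0, 1) = k) \<and>
       (\<exists>\<psi>\<in>algebra_hom polynomial_algebra H. inj \<psi> \<and> \<psi> [:0, 1:] = p)"
proof -
  obtain e :: "nat \<Rightarrow> 'v" where e: "inj e"
    using infinite_countable_subset[OF assms] by blast
  let ?H = "cohomology :: ('k, (nat \<Rightarrow> ('v, 'k) cochain) set) module"
  have pow: "cohomology_class 4 p4 [^]\<^bsub>?H\<^esub> n \<noteq> \<zero>\<^bsub>?H\<^esub>" for n :: nat
    unfolding p4_power H_zero by (rule p4_cup_power_class_nonzero[OF e])
  have "cls (homogeneous (4 * n) (p4_cup_power n :: ('v, 'k) cochain)) \<in> cohomology_deg (4 * n)" for n
    unfolding cohomology_deg_def cohomology_class_cls using p4_cup_power_cocycle by blast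
  then have "cohomology_deg (4 * n) \<noteq> {\<zero>\<^bsub>?H\<^esub>}" for n
    using pow[of n] unfolding p4_power by blast
  then show ?thesis
    unfolding Let_def
    using kappa_cocycle p4_cocycle H1_spanned[OF e] H4_spanned[OF e] pow exterior_embedding[OF e] polynomial_embedding[OF e]
    by (intro conjI allI impI) assumption+
qed

end
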